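(* Consider, for rank-4 tensors on $\mathbb{R}^3$ and with summation over repeated indices, the equation $$N_{jklm}\,C_{lmrs}(t)+(F_{jklm}\ast C_{lmrs})(t)=t\,(\delta_{jr}\delta_{ks}+\delta_{js}\delta_{kr}),\qquad j,k,r,s=1,2,3,\ t>0. \quad (\mathrm{E})$$ 1. Let $N_{ijkl}$ be a constant tensor satisfying $N_{ijkl}=N_{jikl}=N_{klij}$ which is positive semi-definite, i.e. $N_{ijkl}e_{ij}e_{kl}\ge0$ for every symmetric $e_{kl}$. Let $F_{ijkl}(t)$ be a tensor-valued LICM function satisfying $F_{ijkl}=F_{jikl}=F_{klij}$, and let $\mathbf{F}(t)$ be the corresponding symmetric $6\times6$ matrix-valued function. Assume that for every non-zero $\mathbf{v}\in\mathbb{R}^6$ the function $t\mapsto\mathbf{v}^{\mathsf T}\mathbf{F}(t)\mathbf{v}$ does not vanish identically, and that the limit $\mathbf{F}_0:=\lim_{t\to0}\mathbf{F}(t)^{-1}$ exists. Then equation (E) has a unique solution $C_{ijkl}(t)$, and $C_{ijkl}(t)$ is a rank-4 tensor-valued Bernstein function satisfying $C_{ijkl}=C_{jikl}=C_{klij}$. 2. Let $C_{ijkl}(t)$ be a rank-4 tensor-valued Bernstein function satisfying $C_{ijkl}=C_{jikl}=C_{klij}$ and such that for every non-zero symmetric rank-2 tensor $e_{kl}$ the function $t\mapsto C_{ijkl}(t)\,e_{ij}\,e_{kl}$ is not constant. Then equation (E) has a unique solution $(N_{ijkl},F_{ijkl})$. The function $F_{ijkl}$ is a rank-4 tensor-valued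 LICM function satisfying $F_{ijkl}=F_{jikl}=F_{klij}$, and $N_{ijkl}$ is a rank-4 tensor satisfying $N_{ijkl}=N_{jikl}=N_{klij}$ and $N_{ijkl}e_{ij}e_{kl}\ge0$ for every symmetric rank-2 tensor $e_{kl}$.
   Context: Convolution: $(f\ast g)(t)=\int_0^tf(t-s)\,g(s)\,\mathrm{d}s$. A scalar function on $]0,\infty[$ is completely monotone (CM) if it is infinitely differentiable and $(-1)^n$ times its $n$-th derivative is non-negative for all integers $n\ge0$; it is locally integrable completely monotone (LICM) if moreover it is integrable over $]0,1]$. A tensor-valued function $F_{ijkl}(t)$ with the symmetries $F_{ijkl}=F_{jikl}=F_{klij}$ is LICM if $t\mapsto e_{ij}e_{kl}F_{ijkl}(t)$ is LICM for every symmetric $3\times3$ matrix $e_{ij}$. A tensor-valued function $C_{ijkl}(t)$ with the same symmetries is a Bernstein function if for every symmetric $e_{ij}$ the function $t\mapsto e_{ij}e_{kl}C_{ijkl}(t)$ is non-negative and differentiable for $t>0$ with CM derivative; it is extended to $t=0$ by its limit. A tensor $R_{ijkl}$ with these symmetries is identified with a symmetric $6\times6$ matrix $R_{IJ}=f(I)f(J)R_{i(I)j(I)k(J)l(J)}$, where $I=1,2,3$ corresponds to the index pairs $11,22,33$ and $I=4,5,6$ to the pairs $23,13,12$, with $f(I)=1$ for $I\le3$ and $f(I)=\sqrt2$ for $I\ge4$. Under this identification, contraction over a pair of indices becomes matrix multiplication. All unknown tensors are assumed to have the symmetries $R_{ijkl}=R_{jikl}=R_{klij}$. Unknown functions are sought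 among locally integrable functions on $[0,\infty[$ whose Laplace transform exists for all $p>0$, the unknown $N_{ijkl}$ in part 2 being a constant tensor; uniqueness of functions is up to equality almost everywhere. *)

theory Defs
  imports "HOL-Analysis.Analysis"
begin

type_synonym tensor2 = "real^3^3"
type_synonym tensor4 = "real^3^3^3^3"

text \<open>The component \<open>R\<^sub>i\<^sub>j\<^sub>k\<^sub>l\<close> is \<open>R $ i $ j $ k $ l\<close>. In the index types \<open>3\<close> and \<open>6\<close> the last
  index is written \<open>3\<close> resp. \<open>6\<close>, although it coincides with \<open>0\<close>.\<close>

definition sym2 :: "tensor2 \<Rightarrow> bool" where
  "sym2 e \<longleftrightarrow> transpose e = e"

definition sym4 :: "tensor4 \<Rightarrow> bool" where
  "sym4 R \<longleftrightarrow> (\<forall>i j k l. R $ i $ j $ k $ l = R $ j $ i $ k $ l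
                        \<and> R $ i $ j $ k $ l = R $ k $ l $ i $ j)"

definition qform :: "tensor4 \<Rightarrow> tensor2 \<Rightarrow> real" where
  "qform R e = (\<Sum>i\<in>UNIV. \<Sum>j\<in>UNIV. \<Sum>k\<in>UNIV. \<Sum>l\<in>UNIV.
                  R $ i $ j $ k $ l * e $ i $ j * e $ k $ l)"

definition psd4 :: "tensor4 \<Rightarrow> bool" where
  "psd4 R \<longleftrightarrow> (\<forall>e. sym2 e \<longrightarrow> qform R e \<ge> 0)"

definition idx_pair :: "6 \<Rightarrow> 3 \<times> 3" where
  "idx_pair I = (if I = 1 then (1, 1) else if I = 2 then (2, 2) else if I = 3 then (3, 3)
                 else if I = 4 then (2, 3) else if I = 5 then (1, 3) else (1, 2))"

definition idx_factor :: "6 \<Rightarrow> real" where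
  "idx_factor I = (if I = 1 \<or> I = 2 \<or> I = 3 then 1 else sqrt 2)"

definition mat6 :: "tensor4 \<Rightarrow> real^6^6" where
  "mat6 R = (\<chi> I J. idx_factor I * idx_factor J
      * R $ fst (idx_pair I) $ snd (idx_pair I) $ fst (idx_pair J) $ snd (idx_pair J))"

text \<open>Functions on \<open>]0,\<infinity>[\<close> are total functions whose values at \<open>t \<le> 0\<close> are irrelevant.\<close>

definition completely_monotone :: "(real \<Rightarrow> real) \<Rightarrow> bool" where
  "completely_monotone f \<longleftrightarrow>
     (\<forall>n. \<forall>t>0. (deriv ^^ n) f differentiable (at t) \<and> (-1) ^ n * (deriv ^^ n) f t \<ge> 0)"

definition LICM :: "(real \<Rightarrow> real) \<Rightarrow> bool" where
  "LICM f \<longleftrightarrow> completely_monotone f \<and> f absolutely_integrable_on {0<..1}"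

definition bernstein :: "(real \<Rightarrow> real) \<Rightarrow> bool" where
  "bernstein f \<longleftrightarrow> (\<forall>t>0. f t \<ge> 0 \<and> f differentiable (at t)) \<and> completely_monotone (deriv f)"

definition tensor_LICM :: "(real \<Rightarrow> tensor4) \<Rightarrow> bool" where
  "tensor_LICM F \<longleftrightarrow> (\<forall>t>0. sym4 (F t)) \<and> (\<forall>e. sym2 e \<longrightarrow> LICM (\<lambda>t. qform (F t) e))"

text \<open>The last conjunct is the convention that a Bernstein function is extended to \<open>t = 0\<close>
  by its limit.\<close>

definition tensor_bernstein :: "(real \<Rightarrow> tensor4) \<Rightarrow> bool" where
  "tensor_bernstein C \<longleftrightarrow> (\<forall>t>0. sym4 (C t)) \<and> (\<forall>e. sym2 e \<longrightarrow> bernstein (\<lambda>t. qform (C t) e))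
     \<and> (C \<longlongrightarrow> C 0) (at_right 0)"

text \<open>The class in which unknown functions are sought: symmetric, locally integrable on
  \<open>[0,\<infinity>[\<close>, with (absolutely convergent) Laplace integral for all \<open>p > 0\<close>.\<close>

definition admissible :: "(real \<Rightarrow> tensor4) \<Rightarrow> bool" where
  "admissible R \<longleftrightarrow> (\<forall>t>0. sym4 (R t))
     \<and> (\<forall>T>0. R absolutely_integrable_on {0..T})
     \<and> (\<forall>p>0. (\<lambda>t. exp (- p * t) *\<^sub>R R t) absolutely_integrable_on {0..})"

definition conv :: "(real \<Rightarrow> real) \<Rightarrow> (real \<Rightarrow> real) \<Rightarrow> real \<Rightarrow> real" where
  "conv f g t = (LINT s:{0..t}|lebesgue. f (t - s) * g s)"

definition conv_exists :: "(real \<Rightarrow> real) \<Rightarrow> (real \<Rightarrow> real) \<Rightarrow> real \<Rightarrow> bool" where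
  "conv_exists f g t \<longleftrightarrow> (\<lambda>s. f (t - s) * g s) absolutely_integrable_on {0..t}"

text \<open>The equation \<open>N C + F * C = t (\<delta>\<^sub>j\<^sub>r \<delta>\<^sub>k\<^sub>s + \<delta>\<^sub>j\<^sub>s \<delta>\<^sub>k\<^sub>r)\<close> at time \<open>t\<close>, with \<open>*\<close> the
  convolution on \<open>[0,t]\<close>. Existence of the convolutions is part of the equation, since
  the integral of a non-integrable function is \<open>0\<close> by convention.\<close>

definition equation_at :: "tensor4 \<Rightarrow> (real \<Rightarrow> tensor4) \<Rightarrow> (real \<Rightarrow> tensor4) \<Rightarrow> real \<Rightarrow> bool" where
  "equation_at N F C t \<longleftrightarrow> (\<forall>j k r s.
     (\<forall>l m. conv_exists (\<lambda>u. F u $ j $ k $ l $ m) (\<lambda>u. C u $ l $ m $ r $ s) t) \<and>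
     (\<Sum>l\<in>UNIV. \<Sum>m\<in>UNIV. N $ j $ k $ l $ m * C t $ l $ m $ r $ s)
     + (\<Sum>l\<in>UNIV. \<Sum>m\<in>UNIV.
          conv (\<lambda>u. F u $ j $ k $ l $ m) (\<lambda>u. C u $ l $ m $ r $ s) t)
     = t * (of_bool (j = r) * of_bool (k = s) + of_bool (j = s) * of_bool (k = r)))"

end

theory Submission
  imports Defs "HOL-Complex_Analysis.Great_Picard"
begin

text \<open>Write a Bernstein function as \<open>C = C\<^sub>0 + 1 \<star> C'\<close> and put \<open>G = N + 1 \<star> F\<close>. Integrated once, the
  equation says \<open>G \<star> C = t\<^sup>2 I\<close>, which is symmetric in the Bernstein functions \<open>G\<close> and \<open>C\<close>. So solving
  for \<open>(N, F)\<close> amounts to solving the first problem with the data \<open>(C\<^sub>0, C')\<close>.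

  For existence no integral representation is needed. Taylor expansion of \<open>F\<close> around a distant point
  \<open>n\<close> has the terms \<open>A\<^sub>k (1 - t/n)\<^sup>k\<close> with positive semi-definite \<open>A\<^sub>k\<close>, and these are close to
  \<open>A\<^sub>k exp (-kt/n)\<close>. For a finite sum of such exponentials, and with \<open>N + I/n\<close> in place of \<open>N\<close>, the
  equation is a linear system of ordinary differential equations with an energy form whose value at the
  \<open>a\<close>-th derivative at time \<open>t\<close> and the \<open>b\<close>-th derivative at time \<open>s\<close> depends on \<open>a + b\<close> and \<open>t + s\<close>
  only; hence \<open>C'\<close> is completely monotone. The trace of the equation bounds these approximate
  solutions uniformly, a subsequence converges pointwise, and pointwise limits of completely monotone
  functions are completely monotone.

  For uniqueness, convolve the difference of two equations with the known solution from the other side: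
  what remains is \<open>t \<star> D = 0\<close> for the difference \<open>D\<close>.\<close>

section \<open>Convolution of locally integrable functions\<close>

text \<open>Three obstacles shape the development. Unknown functions are only locally integrable, so
  their convolutions exist almost everywhere, and associativity at every time is available with a
  locally bounded left factor; in the uniqueness proofs this factor is the Bernstein function, which
  is continuous on [0,T]. Matrices do not commute, so a solution has to be turned into an inverse on
  the other side; the symmetry of N, F and C provides it by transposition. Finally, N may be
  singular: adding I/n makes the approximate systems solvable, but bounds through the inverse of N +
  I/n would blow up. The bound comes from the kernel instead: its quadratic forms decrease in time
  and vanish identically in no direction, so by compactness of the sphere they are uniformly
  positive at one common time. The dependence on a + b and t + s reflects that the linear system z'
  = M z has a generator M that is self-adjoint and non-positive for the energy form.\<close>

lemma lebesgue_cong_AE: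
  fixes f g :: "real \<Rightarrow> real"
  assumes "AE x in lebesgue. f x = g x"
  shows "integrable lebesgue f \<longleftrightarrow> integrable lebesgue g"
    and "integral\<^sup>L lebesgue f = integral\<^sup>L lebesgue g"
proof -
  have sym: "AE x in lebesgue. g x = f x" using assms by eventually_elim simp
  \<comment> \<open>Completeness of Lebesgue measure carries measurability itself along almost
    everywhere equality.\<close>
  have meas: "f \<in> borel_measurable lebesgue \<longleftrightarrow> g \<in> borel_measurable lebesgue"
    using borel_measurable_AE[OF _ assms] borel_measurable_AE[OF _ sym] by blast
  show *: "integrable lebesgue f \<longleftrightarrow> integrable lebesgue g"
    using meas integrable_cong_AE[of f lebesgue g] assms borel_measurable_integrable by blast
  show "integral\<^sup>L lebesgue f = integral\<^sup>L lebesgue g"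
  proof (cases "f \<in> borel_measurable lebesgue")
    case True
    then show ?thesis using meas assms by (intro integral_cong_AE) auto
  next
    case False
    \<comment> \<open>Both integrals are then 0 by the convention for non-integrable
      functions.\<close>
    then have "\<not> integrable lebesgue f" "\<not> integrable lebesgue g"
      using meas borel_measurable_integrable by blast+
    then show ?thesis by (simp add: not_integrable_integral_eq)
  qed
qed

lemma AE_lebesgue_reflect:
  fixes t :: real
  assumes "AE x in lebesgue. P x"
  shows "AE x in lebesgue. P (t - x)"
proof -
  have n: "negligible {x. \<not> P x}"
    using assms negligible_subset by (auto simp: eventually_ae_filter_negligible)
  have "{x. \<not> P (t - x)} \<subseteq> (\<lambda>x. t - x) ` {x. \<not> P x}"
  proof
    fix x assume "x \<in> {x. \<not> P (t - x)}"
    then have "x = t - (t - x)" "t - x \<in> {x. \<not> P x}" by auto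
    then show "x \<in> (\<lambda>x. t - x) ` {x. \<not> P x}" by blast
  qed
  moreover have "negligible ((\<lambda>x. t - x) ` {x. \<not> P x})"
    using n by (intro negligible_differentiable_image_negligible) (auto intro!: derivative_intros)
  ultimately show ?thesis
    by (auto simp: eventually_ae_filter_negligible)
qed

definition locally_integrable :: "(real \<Rightarrow> real) \<Rightarrow> bool" where
  "locally_integrable f \<longleftrightarrow> (\<forall>T>0. f absolutely_integrable_on {0..T})"

lemma locally_integrableD:
  assumes "locally_integrable f" shows "f absolutely_integrable_on {0..T}"
proof -
  have "f absolutely_integrable_on {0..max T 1}" using assms by (simp add: locally_integrable_def)
  then show ?thesis by (rule set_integrable_subset) auto
qed

text \<open>Borel measurability makes \<open>f (t - s) * g s\<close> jointly measurable, as Fubini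
  on \<open>lborel\<close> requires; vanishing outside [0,T] turns the convolution on [0,t] into an
  integral over the whole line.\<close>

definition representative :: "real \<Rightarrow> (real \<Rightarrow> real) \<Rightarrow> (real \<Rightarrow> real) \<Rightarrow> bool" where
  "representative T f g \<longleftrightarrow> g \<in> borel_measurable borel \<and> integrable lborel g
     \<and> (\<forall>x. x \<notin> {0..T} \<longrightarrow> g x = 0) \<and> (AE x in lebesgue. g x = indicator {0..T} x * f x)"

lemma representativeD:
  assumes "representative T f g"
  shows "g \<in> borel_measurable borel" "integrable lborel g" "\<And>x. x \<notin> {0..T} \<Longrightarrow> g x = 0"
    "AE x in lebesgue. g x = indicator {0..T} x * f x"
  using assms unfolding representative_def by blast+

lemma representative_exists:
  assumes "locally_integrable f"
  obtains g where "representative T f g"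
proof -
  let ?f = "\<lambda>x. indicator {0..T} x * f x"
  have f: "integrable lebesgue ?f"
    using locally_integrableD[OF assms, of T] by (simp add: set_integrable_def)
  obtain g where g: "g \<in> borel_measurable lborel" "AE x in lborel. ?f x = g x"
    using completion_ex_borel_measurable_real[OF borel_measurable_integrable[OF f]] by auto
  define h where "h x = indicator {0..T} x * g x" for x
  have h1: "h \<in> borel_measurable borel" unfolding h_def using g(1) by simp
  have h2: "AE x in lebesgue. h x = ?f x" using AE_completion[OF g(2)]
  proof eventually_elim
    case (elim x) then show ?case by (cases "x \<in> {0..T}") (auto simp: h_def)
  qed
  have "integrable lebesgue h" using lebesgue_cong_AE(1)[OF h2] f by simp
  then have "integrable lborel h" using h1 by (simp add: integrable_completion)
  then show ?thesis using that[of h] h1 h2 by (simp add: representative_def h_def)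
qed

text \<open>The supports do the truncation: for \<open>s\<close> outside [0,t] either
  \<open>s\<close> or \<open>t - s\<close> is negative and one factor vanishes. The representatives
  depend on \<open>T\<close>, not on \<open>t\<close>, so that Fubini can be applied with
  \<open>t\<close> varying.\<close>

lemma conv_line:
  assumes rep: "representative T f' f" "representative T g' g" and t: "t \<le> T"
  shows "conv_exists f' g' t \<longleftrightarrow> integrable lborel (\<lambda>s. f (t - s) * g s)"
    and "conv f' g' t = (\<integral>s. f (t - s) * g s \<partial>lborel)"
proof -
  note f = representativeD(1,3,4)[OF rep(1)] and g = representativeD(1,3,4)[OF rep(2)]
  let ?h = "\<lambda>s. f (t - s) * g s"
  have [measurable]: "?h \<in> borel_measurable borel" using f(1) g(1) by measurable
  have ae: "AE s in lebesgue. indicator {0..t} s *\<^sub>R (f' (t - s) * g' s) = ?h s"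
    using AE_lebesgue_reflect[OF f(3), of t] g(3)
  proof eventually_elim
    case (elim s)
    show ?case
    proof (cases "s \<in> {0..t}")
      case True
      then show ?thesis using elim t by (simp add: indicator_def)
    next
      case False
      then have "t - s \<notin> {0..T} \<or> s \<notin> {0..T}" by auto
      then show ?thesis using False f(2) g(2) by auto
    qed
  qed
  show "conv_exists f' g' t \<longleftrightarrow> integrable lborel ?h"
    unfolding conv_exists_def set_integrable_def lebesgue_cong_AE(1)[OF ae]
    by (simp add: integrable_completion)
  show "conv f' g' t = integral\<^sup>L lborel ?h"
    unfolding conv_def set_lebesgue_integral_def lebesgue_cong_AE(2)[OF ae]
    by (simp add: integral_completion)
qed

lemma lborel_integral_reflect:
  fixes f :: "real \<Rightarrow> real"
  shows "(\<integral>s. f (t - s) \<partial>lborel) = (\<integral>s. (f s :: real) \<partial>lborel)"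
  using lborel_integral_real_affine[of "-1" f t] by simp

lemma lborel_integral_shift:
  fixes f :: "real \<Rightarrow> real"
  shows "(\<integral>s. f (s - t) \<partial>lborel) = (\<integral>s. (f s :: real) \<partial>lborel)"
  using lborel_integral_real_affine[of 1 f "-t"] by simp

lemma lborel_integrable_reflect:
  fixes f :: "real \<Rightarrow> real"
  shows "integrable lborel (\<lambda>s. f (t - s)) \<longleftrightarrow> integrable lborel (f :: real \<Rightarrow> real)"
  using lborel_integrable_real_affine_iff[of "-1" f t] by simp

lemma lborel_integrable_shift:
  fixes f :: "real \<Rightarrow> real"
  shows "integrable lborel (\<lambda>s. f (s - t)) \<longleftrightarrow> integrable lborel (f :: real \<Rightarrow> real)"
  using lborel_integrable_real_affine_iff[of 1 f "-t"] by simp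

text \<open>Tonelli and translation invariance: the inner integral of the norm is the L1 norm of
  \<open>f\<close> times the absolute value of \<open>g s\<close>.\<close>

lemma line_conv_integrable:
  fixes f g :: "real \<Rightarrow> real"
  assumes f: "f \<in> borel_measurable borel" "integrable lborel f"
    and g: "g \<in> borel_measurable borel" "integrable lborel g"
  shows "integrable (lborel \<Otimes>\<^sub>M lborel) (\<lambda>(s, t). f (t - s) * g s)"
proof (rule lborel_pair.Fubini_integrable)
  note [measurable] = f(1) g(1)
  show "(\<lambda>(s, t). f (t - s) * g s) \<in> borel_measurable (lborel \<Otimes>\<^sub>M lborel)" by measurable
  have "(\<integral>t. norm (f (t - s) * g s) \<partial>lborel) = (\<integral>t. \<bar>f t\<bar> \<partial>lborel) * \<bar>g s\<bar>" for s
    using lborel_integral_shift[of "\<lambda>t. \<bar>f t\<bar>" s] by (simp add: abs_mult)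
  then show "integrable lborel (\<lambda>s. \<integral>t. norm (case (s, t) of (s, t) \<Rightarrow> f (t - s) * g s) \<partial>lborel)"
    using g by simp
  show "AE s in lborel. integrable lborel (\<lambda>t. case (s, t) of (s, t) \<Rightarrow> f (t - s) * g s)"
    using lborel_integrable_shift[of f] f by simp
qed

lemma conv_commute:
  assumes "locally_integrable f" "locally_integrable g"
  shows "conv f g t = conv g f t" and "conv_exists f g t \<longleftrightarrow> conv_exists g f t"
proof -
  obtain a where a: "representative t f a" using representative_exists[OF assms(1)] .
  obtain b where b: "representative t g b" using representative_exists[OF assms(2)] .
  note ab = conv_line[OF a b order_refl] and ba = conv_line[OF b a order_refl]
  show "conv f g t = conv g f t"
    using ab(2) ba(2) lborel_integral_reflect[of "\<lambda>s. a (t - s) * b s" t] by (simp add: mult.commute)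
  show "conv_exists f g t \<longleftrightarrow> conv_exists g f t"
    using ab(1) ba(1) lborel_integrable_reflect[of "\<lambda>s. a (t - s) * b s" t] by (simp add: mult.commute)
qed

text \<open>Fubini for the integrable product on the plane. At single times the convolution may fail
  to exist, for instance where interior singularities of the two factors meet.\<close>

lemma conv_AE_exists:
  assumes "locally_integrable f" "locally_integrable g"
  shows "AE t in lebesgue. conv_exists f g t" and "locally_integrable (conv f g)"
proof -
  have *: "(AE t in lebesgue. t \<in> {0..T} \<longrightarrow> conv_exists f g t) \<and> conv f g absolutely_integrable_on {0..T}" for T
  proof -
    obtain a where a: "representative T f a" using representative_exists[OF assms(1)] .
    obtain b where b: "representative T g b" using representative_exists[OF assms(2)] .
    note ab = conv_line[OF a b]
    have i: "integrable (lborel \<Otimes>\<^sub>M lborel) (\<lambda>(t, s). a (t - s) * b s)"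
      using lborel_pair.integrable_product_swap[OF line_conv_integrable[OF representativeD(1,2)[OF a] representativeD(1,2)[OF b]]] by simp
    have "AE t in lborel. integrable lborel (\<lambda>s. a (t - s) * b s)"
      using lborel_pair.AE_integrable_fst'[OF i] by simp
    then have e: "AE t in lborel. t \<in> {0..T} \<longrightarrow> conv_exists f g t"
      by eventually_elim (use ab in auto)
    have c: "integrable lborel (\<lambda>t. \<integral>s. a (t - s) * b s \<partial>lborel)"
      using lborel_pair.integrable_fst'[OF i] by simp
    have d: "integrable lebesgue (\<lambda>t. indicator {0..T} t *\<^sub>R (\<integral>s. a (t - s) * b s \<partial>lborel))"
      using integrable_real_mult_indicator[OF _ c, of "{0..T}"] c borel_measurable_integrable[OF c]
      by (subst integrable_completion) (auto simp: mult.commute)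
    have "(\<lambda>t. indicator {0..T} t *\<^sub>R (\<integral>s. a (t - s) * b s \<partial>lborel)) = (\<lambda>t. indicator {0..T} t *\<^sub>R conv f g t)"
      using ab(2) by (auto simp: indicator_def)
    then have "conv f g absolutely_integrable_on {0..T}" using d by (simp add: set_integrable_def)
    then show ?thesis using e by (blast intro: AE_completion)
  qed
  show "locally_integrable (conv f g)" using * by (simp add: locally_integrable_def)
  \<comment> \<open>The exceptional null sets of the intervals [0,n] are countably many; for
    negative \<open>t\<close> the convolution runs over the empty set.\<close>
  have "AE t in lebesgue. \<forall>n::nat. t \<in> {0..real n} \<longrightarrow> conv_exists f g t"
    using * by (subst AE_all_countable) blast
  then show "AE t in lebesgue. conv_exists f g t"
  proof eventually_elim
    case (elim t)
    show ?case
    proof (cases "t \<ge> 0")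
      case True
      then show ?thesis using elim real_arch_simple[of t] by auto
    next
      case False
      then show ?thesis by (simp add: conv_exists_def)
    qed
  qed
qed

definition locally_bounded :: "(real \<Rightarrow> real) \<Rightarrow> bool" where
  "locally_bounded f \<longleftrightarrow> (\<forall>T. \<exists>B. \<forall>t\<in>{0..T}. \<bar>f t\<bar> \<le> B)"

lemma bounded_representative_exists:
  assumes "locally_integrable f" "locally_bounded f"
  obtains g B where "representative T f g" "\<And>x. \<bar>g x\<bar> \<le> B"
proof -
  obtain B where B: "\<And>t. t \<in> {0..T} \<Longrightarrow> \<bar>f t\<bar> \<le> B" using assms(2) unfolding locally_bounded_def by meson
  obtain a where a: "representative T f a" using representative_exists[OF assms(1)] .
  note [measurable] = representativeD(1)[OF a] and a = representativeD[OF a]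
  \<comment> \<open>Clipping changes the representative only on a null set, since \<open>f\<close>
    is bounded by \<open>B\<close> on [0,T]. The absolute value covers negative \<open>T\<close>,
    where \<open>B\<close> may be negative.\<close>
  define g where "g x = max (- \<bar>B\<bar>) (min \<bar>B\<bar> (a x))" for x
  have 1: "g \<in> borel_measurable borel" unfolding g_def by measurable
  have "integrable lborel g"
    by (rule Bochner_Integration.integrable_bound[OF a(2)]) (use 1 in \<open>auto simp: g_def\<close>)
  moreover have "g x = 0" if "x \<notin> {0..T}" for x using a(3)[OF that] by (simp add: g_def)
  moreover have "AE x in lebesgue. g x = indicator {0..T} x * f x"
    using a(4)
  proof eventually_elim
    case (elim x) then show ?case using B[of x] by (auto simp: g_def indicator_def)
  qed
  ultimately have "representative T f g" using 1 unfolding representative_def by blast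
  moreover have "\<bar>g x\<bar> \<le> \<bar>B\<bar>" for x by (auto simp: g_def)
  ultimately show ?thesis by (rule that)
qed

lemma conv_exists_bounded:
  assumes "locally_integrable f" "locally_bounded f" "locally_integrable g"
  shows "conv_exists f g t"
proof -
  obtain a B where a: "representative t f a" "\<And>x. \<bar>a x\<bar> \<le> B"
    by (rule bounded_representative_exists[OF assms(1,2)]) (rule that)
  obtain b where b: "representative t g b" using representative_exists[OF assms(3)] .
  note [measurable] = representativeD(1)[OF a(1)] representativeD(1)[OF b]
  have "integrable lborel (\<lambda>s. a (t - s) * b s)"
    by (rule Bochner_Integration.integrable_bound[of _ "\<lambda>s. B * b s"])
      (auto simp: abs_mult representativeD(2)[OF b] intro!: AE_I2 mult_right_mono order_trans[OF a(2) abs_ge_self])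
  then show ?thesis using conv_line(1)[OF a(1) b order_refl] by blast
qed

text \<open>For fixed \<open>t\<close> the triple product is dominated by a multiple of
  \<open>b (s - r) * c r\<close>, which is integrable on the plane. This is where boundedness of
  \<open>f\<close> enters, and it gives the identity at every \<open>t\<close>, not just almost
  everywhere.\<close>

lemma conv_assoc:
  assumes f: "locally_integrable f" "locally_bounded f" and g: "locally_integrable g" and h: "locally_integrable h"
  shows "conv f (conv g h) t = conv (conv f g) h t"
proof -
  obtain a B where a: "representative t f a" "\<And>x. \<bar>a x\<bar> \<le> B"
    by (rule bounded_representative_exists[OF f]) (rule that)
  obtain b where b: "representative t g b" using representative_exists[OF g] .
  obtain c where c: "representative t h c" using representative_exists[OF h] .
  note ra = representativeD[OF a(1)] and rb = representativeD[OF b] and rc = representativeD[OF c]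
  note [measurable] = ra(1) rb(1) rc(1)
  have B0: "B \<ge> 0" using a(2)[of 0] by simp
  define bc where "bc s = (\<integral>r. b (s - r) * c r \<partial>lborel)" for s
  define ab where "ab s = (\<integral>r. a (s - r) * b r \<partial>lborel)" for s
  have [measurable]: "bc \<in> borel_measurable borel" "ab \<in> borel_measurable borel"
    unfolding bc_def ab_def by measurable
  have bc: "bc s = conv g h s" if "s \<le> t" for s
    unfolding bc_def using conv_line(2)[OF b c that] by simp
  have ab: "ab s = conv f g s" if "s \<le> t" for s
    unfolding ab_def using conv_line(2)[OF a(1) b that] by simp
  have i0: "integrable (lborel \<Otimes>\<^sub>M lborel) (\<lambda>(r, s). b (s - r) * c r)"
    by (rule line_conv_integrable[OF rb(1,2) rc(1,2)])
  have i: "integrable (lborel \<Otimes>\<^sub>M lborel) (\<lambda>(r, s). a (t - s) * (b (s - r) * c r))"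
  proof (rule Bochner_Integration.integrable_bound[OF integrable_mult_right[OF i0, of B]])
    show "(\<lambda>(r, s). a (t - s) * (b (s - r) * c r)) \<in> borel_measurable (lborel \<Otimes>\<^sub>M lborel)" by measurable
    show "AE x in lborel \<Otimes>\<^sub>M lborel. norm (case x of (r, s) \<Rightarrow> a (t - s) * (b (s - r) * c r))
          \<le> norm (B * (case x of (r, s) \<Rightarrow> b (s - r) * c r))"
      by (auto simp: abs_mult B0 intro!: AE_I2 mult_right_mono a(2))
  qed
  have L: "conv f (conv g h) t = (\<integral>s. a (t - s) * bc s \<partial>lborel)"
  proof -
    have ae: "AE s in lebesgue. indicator {0..t} s *\<^sub>R (f (t - s) * conv g h s) = a (t - s) * (indicator {0..t} s * bc s)"
      using AE_lebesgue_reflect[OF ra(4), of t]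
      by eventually_elim (auto simp: indicator_def bc)
    have "conv f (conv g h) t = (\<integral>s. a (t - s) * (indicator {0..t} s * bc s) \<partial>lborel)"
      unfolding conv_def[of f] set_lebesgue_integral_def lebesgue_cong_AE(2)[OF ae] by (simp add: integral_completion)
    also have "(\<lambda>s. a (t - s) * (indicator {0..t} s * bc s)) = (\<lambda>s. a (t - s) * bc s)"
    proof
      fix s
      show "a (t - s) * (indicator {0..t} s * bc s) = a (t - s) * bc s"
      proof (cases "s \<in> {0..t}")
        case False
        \<comment> \<open>Both factors vanish on negative arguments, hence so does their convolution
          on the line; on the part of the complement beyond \<open>t\<close> it is
          \<open>a (t - s)\<close> that vanishes.\<close>
        have "bc s = 0" if "s < 0"
        proof -
          have "b (s - r) * c r = 0" for r using rb(3)[of "s - r"] rc(3)[of r] that by (cases "r < 0") auto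
          then show ?thesis unfolding bc_def by (simp only: Bochner_Integration.integral_zero)
        qed
        then show ?thesis using ra(3)[of "t - s"] False by (cases "s < 0") auto
      qed simp
    qed
    finally show ?thesis .
  qed
  have R: "conv (conv f g) h t = (\<integral>r. ab (t - r) * c r \<partial>lborel)"
  proof -
    have ae: "AE r in lebesgue. indicator {0..t} r *\<^sub>R (conv f g (t - r) * h r) = (indicator {0..t} r * ab (t - r)) * c r"
      using rc(4)
      by eventually_elim (auto simp: indicator_def ab)
    have "conv (conv f g) h t = (\<integral>r. (indicator {0..t} r * ab (t - r)) * c r \<partial>lborel)"
      unfolding conv_def[of "conv f g"] set_lebesgue_integral_def lebesgue_cong_AE(2)[OF ae] by (simp add: integral_completion)
    also have "(\<lambda>r. (indicator {0..t} r * ab (t - r)) * c r) = (\<lambda>r. ab (t - r) * c r)"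
    proof
      fix r show "(indicator {0..t} r * ab (t - r)) * c r = ab (t - r) * c r"
        using rc(3)[of r] by (cases "r \<in> {0..t}") auto
    qed
    finally show ?thesis .
  qed
  have "(\<integral>s. a (t - s) * bc s \<partial>lborel) = (\<integral>s. (\<integral>r. a (t - s) * (b (s - r) * c r) \<partial>lborel) \<partial>lborel)"
    unfolding bc_def by (simp only: integral_mult_right_zero)
  also have "\<dots> = (\<integral>r. (\<integral>s. a (t - s) * (b (s - r) * c r) \<partial>lborel) \<partial>lborel)"
    using lborel_pair.Fubini_integral[OF i] by simp
  also have "\<dots> = (\<integral>r. ab (t - r) * c r \<partial>lborel)"
  proof (rule Bochner_Integration.integral_cong[OF refl])
    fix r :: real
    have "(\<integral>s. a (t - s) * (b (s - r) * c r) \<partial>lborel) = (\<integral>s. a (t - r - (s - r)) * b (s - r) \<partial>lborel) * c r"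
      by (simp add: mult.assoc[symmetric])
    also have "(\<integral>s. a (t - r - (s - r)) * b (s - r) \<partial>lborel) = ab (t - r)"
      unfolding ab_def by (rule lborel_integral_shift)
    finally show "(\<integral>s. a (t - s) * (b (s - r) * c r) \<partial>lborel) = ab (t - r) * c r" .
  qed
  finally show ?thesis using L R by simp
qed

lemma conv_AE_cong:
  assumes "AE s in lebesgue. 0 < s \<longrightarrow> g s = h s"
  shows "conv f g t = conv f h t" and "conv_exists f g t \<longleftrightarrow> conv_exists f h t"
proof -
  have "AE s in lebesgue. s \<noteq> (0::real)"
    by (auto simp: eventually_ae_filter_negligible intro!: exI[of _ "{0::real}"])
  with assms have ae: "AE s in lebesgue. indicator {0..t} s *\<^sub>R (f (t - s) * g s) = indicator {0..t} s *\<^sub>R (f (t - s) * h s)"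
    by eventually_elim (auto simp: indicator_def)
  show "conv f g t = conv f h t"
    unfolding conv_def set_lebesgue_integral_def using lebesgue_cong_AE(2)[OF ae] .
  show "conv_exists f g t \<longleftrightarrow> conv_exists f h t"
    unfolding conv_exists_def set_integrable_def using lebesgue_cong_AE(1)[OF ae] .
qed

lemma locally_integrable_AE_cong:
  assumes "AE s in lebesgue. 0 < s \<longrightarrow> g s = h s"
  shows "locally_integrable g \<longleftrightarrow> locally_integrable h"
proof -
  have "AE s in lebesgue. s \<noteq> (0::real)"
    by (auto simp: eventually_ae_filter_negligible intro!: exI[of _ "{0::real}"])
  with assms have ae: "AE s in lebesgue. indicator {0..T} s *\<^sub>R g s = indicator {0..T} s *\<^sub>R h s" for T
    by eventually_elim (auto simp: indicator_def)
  show ?thesis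
    unfolding locally_integrable_def set_integrable_def using lebesgue_cong_AE(1)[OF ae] by simp
qed

lemma conv_add_right:
  assumes "conv_exists f g t" "conv_exists f h t"
  shows "conv f (\<lambda>s. g s + h s) t = conv f g t + conv f h t" "conv_exists f (\<lambda>s. g s + h s) t"
  using set_integral_add[OF assms[unfolded conv_exists_def]]
  by (auto simp: conv_def conv_exists_def distrib_left)

lemma conv_add_left:
  assumes "conv_exists f h t" "conv_exists g h t"
  shows "conv (\<lambda>s. f s + g s) h t = conv f h t + conv g h t" "conv_exists (\<lambda>s. f s + g s) h t"
  using set_integral_add[OF assms[unfolded conv_exists_def]]
  by (auto simp: conv_def conv_exists_def distrib_right)

lemma conv_mult_right: "conv f (\<lambda>s. c * g s) t = c * conv f g t"
  by (simp add: conv_def mult.left_commute[of _ c])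

lemma conv_mult_left: "conv (\<lambda>s. c * f s) g t = c * conv f g t"
  by (simp add: conv_def mult.assoc)

lemma conv_exists_mult:
  "conv_exists f g t \<Longrightarrow> conv_exists f (\<lambda>s. c * g s) t" "conv_exists f g t \<Longrightarrow> conv_exists (\<lambda>s. c * f s) g t"
  using set_integrable_mult_right[of c lebesgue "{0..t}" "\<lambda>s. f (t - s) * g s"]
  by (auto simp: conv_exists_def mult.assoc mult.left_commute)

lemma conv_sum_right:
  assumes "finite I" "\<And>i. i \<in> I \<Longrightarrow> conv_exists f (g i) t"
  shows "conv f (\<lambda>s. \<Sum>i\<in>I. g i s) t = (\<Sum>i\<in>I. conv f (g i) t) \<and> conv_exists f (\<lambda>s. \<Sum>i\<in>I. g i s) t"
  using assms
proof (induction I)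
  case empty
  show ?case by (simp add: conv_def conv_exists_def set_lebesgue_integral_def set_integrable_def)
next
  case (insert i I)
  then show ?case using conv_add_right[of f "g i" t "\<lambda>s. \<Sum>i\<in>I. g i s"] by simp
qed

lemma conv_sum_left:
  assumes "finite I" "\<And>i. i \<in> I \<Longrightarrow> conv_exists (f i) g t"
  shows "conv (\<lambda>s. \<Sum>i\<in>I. f i s) g t = (\<Sum>i\<in>I. conv (f i) g t) \<and> conv_exists (\<lambda>s. \<Sum>i\<in>I. f i s) g t"
  using assms
proof (induction I)
  case empty
  show ?case by (simp add: conv_def conv_exists_def set_lebesgue_integral_def set_integrable_def)
next
  case (insert i I)
  then show ?case using conv_add_left[of "f i" g t "\<lambda>s. \<Sum>i\<in>I. f i s"] by simp
qed

lemma locally_integrable_add: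
  "locally_integrable f \<Longrightarrow> locally_integrable g \<Longrightarrow> locally_integrable (\<lambda>s. f s + g s)"
  unfolding locally_integrable_def by (auto intro: set_integral_add(1))

lemma locally_integrable_diff:
  "locally_integrable f \<Longrightarrow> locally_integrable g \<Longrightarrow> locally_integrable (\<lambda>s. f s - g s)"
  unfolding locally_integrable_def by (auto intro: set_integral_diff(1))

lemma locally_integrable_mult:
  "locally_integrable f \<Longrightarrow> locally_integrable (\<lambda>s. c * f s)"
  unfolding locally_integrable_def by (auto intro: set_integrable_mult_right)

lemma locally_integrable_sum:
  assumes "finite I" "\<And>i. i \<in> I \<Longrightarrow> locally_integrable (f i)"
  shows "locally_integrable (\<lambda>s. \<Sum>i\<in>I. f i s)"
  using assms
proof (induction I)
  case empty show ?case by (simp add: locally_integrable_def set_integrable_def)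
qed (simp add: locally_integrable_add)

lemma locally_integrable_continuous:
  assumes "\<And>T. continuous_on {0..T} f"
  shows "locally_integrable f" "locally_bounded f"
proof -
  show "locally_integrable f" unfolding locally_integrable_def using assms absolutely_integrable_continuous_real by blast
  show "locally_bounded f" unfolding locally_bounded_def
  proof
    fix T
    have "bounded (f ` {0..T})" using compact_continuous_image[OF assms] compact_imp_bounded by blast
    then show "\<exists>B. \<forall>t\<in>{0..T}. \<bar>f t\<bar> \<le> B" by (auto simp: bounded_iff)
  qed
qed

lemma locally_integrable_one: "locally_integrable (\<lambda>_. 1)" "locally_bounded (\<lambda>_. 1)"
  by (rule locally_integrable_continuous, simp)+

lemma conv_integral:
  assumes "locally_integrable g"
  shows "conv (\<lambda>_. c) g t = c * integral {0..t} g"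
  using set_lebesgue_integral_eq_integral(2)[OF locally_integrableD[OF assms, of t]]
  by (simp add: conv_def)

section \<open>Recovering a function from the vanishing of its primitives\<close>

lemma continuous_AE_zero:
  fixes h :: "real \<Rightarrow> real"
  assumes h: "continuous_on {0<..} h" and ae: "AE t in lebesgue. 0 < t \<longrightarrow> h t = 0" and t: "0 < t"
  shows "h t = 0"
proof (rule ccontr)
  let ?S = "{t\<in>{0<..}. h t \<in> - {0}}"
  assume "h t \<noteq> 0"
  then have "?S \<noteq> {}" using t by auto
  moreover have "open ?S"
    using continuous_open_preimage[OF h open_greaterThan, of "- {0}"] by (simp add: Int_def vimage_def open_Compl)
  moreover have "negligible ?S"
  proof -
    obtain N where "negligible N" "{x. \<not> (0 < x \<longrightarrow> h x = 0)} \<subseteq> N"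
      using ae by (auto simp: eventually_ae_filter_negligible)
    then show ?thesis by (auto intro: negligible_subset)
  qed
  ultimately show False using open_not_negligible by blast
qed

lemma integral_zero_imp_AE_zero:
  assumes p: "locally_integrable p" and z: "\<And>t. 0 < t \<Longrightarrow> integral {0..t} p = 0"
  shows "AE t in lebesgue. 0 < t \<longrightarrow> p t = 0"
proof -
  define f where "f x = (if x \<in> {0..} then p x else 0)" for x
  have pi: "p integrable_on {0..T}" for T
    using locally_integrableD[OF p] by (simp add: set_lebesgue_integral_eq_integral(1))
  have f: "f integrable_on cbox a b" for a b
  proof -
    have "p integrable_on {max 0 a..b}" using pi[of b] by (rule integrable_subinterval_real) auto
    then have "p integrable_on ({0..} \<inter> {a..b})" by (simp add: Int_atLeastAtMostR2 Int_commute max.commute)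
    then have "(\<lambda>x. if x \<in> {0..} then p x else 0) integrable_on {a..b}"
      by (simp only: integrable_restrict_Int)
    then show ?thesis unfolding f_def box_real .
  qed
  \<comment> \<open>Lebesgue differentiation: outside a null set the averages over [x, x+h] tend to
    the value at x, and here all these averages are 0.\<close>
  obtain N where N: "negligible N" "\<And>x e. \<lbrakk>x \<notin> N; 0 < e\<rbrakk> \<Longrightarrow>
       \<exists>d>0. \<forall>h. 0 < h \<and> h < d \<longrightarrow> norm (integral (cbox x (x + h *\<^sub>R One)) f /\<^sub>R h ^ DIM(real) - f x) < e"
    using integrable_ccontinuous_explicit[OF f] by blast
  have "p x = 0" if x: "0 < x" "x \<notin> N" for x
  proof (rule ccontr)
    assume "p x \<noteq> 0"
    then obtain d where d: "d > 0" "\<And>h. 0 < h \<Longrightarrow> h < d \<Longrightarrow> norm (integral (cbox x (x + h *\<^sub>R One)) f /\<^sub>R h ^ DIM(real) - f x) < \<bar>p x\<bar>"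
      using N(2)[OF x(2), of "\<bar>p x\<bar>"] by auto
    have "integral {x..x + d/2} f = integral {x..x + d/2} p"
      using x by (intro integral_cong) (auto simp: f_def)
    also have "integral {0..x} p + integral {x..x + d/2} p = integral {0..x + d/2} p"
      using x d by (intro Henstock_Kurzweil_Integration.integral_combine pi) auto
    then have "integral {x..x + d/2} p = 0" using z[of x] z[of "x + d/2"] x d by simp
    finally show False using d(2)[of "d/2"] d(1) x by (simp add: f_def)
  qed
  then show ?thesis using N(1) by (auto simp: eventually_ae_filter_negligible)
qed

lemma continuous_on_indefinite:
  assumes "locally_integrable p"
  shows "continuous_on {0..T} (\<lambda>t. integral {0..t} p)"
  using locally_integrableD[OF assms, of T]
  by (intro indefinite_integral_continuous_1) (simp add: set_lebesgue_integral_eq_integral(1))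

text \<open>The expression is the primitive of \<open>P\<close>, and \<open>P\<close> is
  \<open>q\<close> plus the primitive of \<open>p\<close>. Both are continuous, so vanishing almost
  everywhere becomes vanishing everywhere, and differentiating twice reaches
  \<open>p\<close>.\<close>

lemma linear_conv_zero:
  assumes p: "locally_integrable p"
    and z: "AE t in lebesgue. 0 < t \<longrightarrow> q * t + conv (\<lambda>s. s) p t = 0"
  shows "q = 0" and "AE t in lebesgue. 0 < t \<longrightarrow> p t = 0"
proof -
  define P where "P t = q + integral {0..t} p" for t
  note one = locally_integrable_one
  have cP: "continuous_on {0..T} P" for T unfolding P_def by (intro continuous_intros continuous_on_indefinite p)
  have eq: "q * t + conv (\<lambda>s. s) p t = integral {0..t} P" if "0 < t" for t
  proof -
    \<comment> \<open>The identity function is 1 convolved with 1, so convolving with it is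
      integrating twice.\<close>
    have c11: "0 < s \<longrightarrow> s = conv (\<lambda>_. 1) (\<lambda>_. 1) s" for s
      using conv_integral[OF one(1), of 1 s] by simp
    have id: "locally_integrable (\<lambda>s. s)" by (rule locally_integrable_continuous) simp
    have "conv (\<lambda>s. s) p t = conv p (\<lambda>s. s) t" by (rule conv_commute(1)[OF id p])
    also have "\<dots> = conv p (conv (\<lambda>_. 1) (\<lambda>_. 1)) t"
      by (rule conv_AE_cong) (use c11 in simp)
    also have "\<dots> = conv (conv (\<lambda>_. 1) (\<lambda>_. 1)) p t"
      by (rule conv_commute) (rule p conv_AE_exists one)+
    also have "\<dots> = conv (\<lambda>_. 1) (conv (\<lambda>_. 1) p) t"
      by (rule conv_assoc[symmetric]) (rule p one)+
    also have "\<dots> = integral {0..t} (conv (\<lambda>_. 1) p)"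
      by (subst conv_integral) (auto intro!: conv_AE_exists one p)
    also have "\<dots> = integral {0..t} (\<lambda>s. integral {0..s} p)"
      by (simp add: conv_integral[OF p, abs_def])
    also have "q * t + \<dots> = integral {0..t} P"
      unfolding P_def using that
      by (subst Henstock_Kurzweil_Integration.integral_add) (auto intro!: integrable_continuous_real continuous_on_indefinite p)
    finally show ?thesis by simp
  qed
  have cIP: "continuous_on {0<..} (\<lambda>t. integral {0..t} P)"
  proof -
    have "continuous_on {0..} (\<lambda>t. integral {0..t} P)"
      unfolding continuous_on_eq_continuous_within
    proof
      fix x :: real assume "x \<in> {0..}"
      then have "continuous (at x within {0..x+1}) (\<lambda>t. integral {0..t} P)"
        using continuous_on_indefinite[OF locally_integrable_continuous(1)[OF cP], of "x+1"]
        by (auto simp: continuous_on_eq_continuous_within)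
      moreover have "at x within {0..} = at x within {0..x+1}"
        by (rule at_within_nhd[of _ "{..<x+1}"]) auto
      ultimately show "continuous (at x within {0..}) (\<lambda>t. integral {0..t} P)" by simp
    qed
    then show ?thesis by (rule continuous_on_subset) auto
  qed
  have IP: "integral {0..t} P = 0" if "0 < t" for t
    using cIP _ that by (rule continuous_AE_zero) (use z eq in auto)
  have "P t = 0" if "0 < t" for t
  proof -
    have "AE t in lebesgue. 0 < t \<longrightarrow> P t = 0"
      by (rule integral_zero_imp_AE_zero) (use IP locally_integrable_continuous(1)[OF cP] in auto)
    moreover have "continuous_on {0<..} P"
    proof -
      have "continuous (at x) P" if "x > 0" for x
      proof -
        have "continuous_on {0<..<x+1} P" by (rule continuous_on_subset[OF cP[of "x+1"]]) auto
        then show ?thesis using that by (simp add: continuous_on_eq_continuous_at)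
      qed
      then show ?thesis by (simp add: continuous_at_imp_continuous_on)
    qed
    ultimately show ?thesis using continuous_AE_zero that by blast
  qed
  note P0 = this
  \<comment> \<open>\<open>P 0\<close> is \<open>q\<close>, so continuity from the right separates
    the constant from the function part.\<close>
  have "P 0 = 0"
  proof -
    have "(P \<longlongrightarrow> P 0) (at_right 0)"
      using cP[of 1] by (simp add: continuous_on_Icc_at_rightD)
    moreover have "\<forall>\<^sub>F t in at_right 0. P t = 0"
      using P0 by (auto simp: eventually_at_filter)
    ultimately have "((\<lambda>_. 0) \<longlongrightarrow> P 0) (at_right (0::real))" by (rule Lim_transform_eventually)
    then show ?thesis by (simp add: tendsto_const_iff)
  qed
  then show q: "q = 0" by (simp add: P_def)
  show "AE t in lebesgue. 0 < t \<longrightarrow> p t = 0"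
    by (rule integral_zero_imp_AE_zero[OF p]) (use P0 q in \<open>simp add: P_def\<close>)
qed

section \<open>Pointwise limits of completely monotone functions\<close>

text \<open>Higher derivatives can be supplied as an explicit sequence \<open>D\<close>. The
  induction carries the equality on the whole open half-line, because differentiating once more
  needs it in a neighbourhood.\<close>

lemma iterated_deriv_eq:
  assumes D0: "\<And>t. 0 < t \<Longrightarrow> D 0 t = f t"
    and D: "\<And>n t. 0 < t \<Longrightarrow> (D n has_real_derivative D (Suc n) t) (at t)"
    and t: "0 < t"
  shows "(deriv ^^ n) f t = D n t" and "((deriv ^^ n) f has_real_derivative D (Suc n) t) (at t)"
proof -
  have *: "\<forall>t>0. (deriv ^^ n) f t = D n t \<and> ((deriv ^^ n) f has_real_derivative D (Suc n) t) (at t)" for n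
  proof (induction n)
    case 0
    have "(f has_real_derivative D (Suc 0) t) (at t)" if "0 < t" for t
      by (rule has_field_derivative_transform_within_open[OF D[OF that, of 0], of "{0<..}"]) (use that D0 in auto)
    then show ?case using D0 by simp
  next
    case (Suc n)
    have eq: "(deriv ^^ Suc n) f t = D (Suc n) t" if "0 < t" for t
      using Suc that DERIV_imp_deriv[of "(deriv ^^ n) f" "D (Suc n) t" t] by simp
    have "((deriv ^^ Suc n) f has_real_derivative D (Suc (Suc n)) t) (at t)" if "0 < t" for t
      by (rule has_field_derivative_transform_within_open[OF D[OF that, of "Suc n"], of "{0<..}"]) (use that eq in auto)
    then show ?case using eq by blast
  qed
  show "(deriv ^^ n) f t = D n t" "((deriv ^^ n) f has_real_derivative D (Suc n) t) (at t)"
    using * t by blast+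
qed

lemma completely_monotoneI:
  assumes D0: "\<And>t. 0 < t \<Longrightarrow> D 0 t = f t"
    and D: "\<And>n t. 0 < t \<Longrightarrow> (D n has_real_derivative D (Suc n) t) (at t)"
    and pos: "\<And>n t. 0 < t \<Longrightarrow> (-1) ^ n * D n t \<ge> 0"
  shows "completely_monotone f"
  unfolding completely_monotone_def real_differentiable_def
  using iterated_deriv_eq[where D=D and f=f, OF D0 D] pos by metis

lemma completely_monotoneD:
  assumes "completely_monotone f" "0 < t"
  shows "((deriv ^^ n) f has_real_derivative (deriv ^^ Suc n) f t) (at t)"
    and "(-1) ^ n * (deriv ^^ n) f t \<ge> 0"
  using assms by (auto simp: completely_monotone_def DERIV_deriv_iff_real_differentiable)

lemma completely_monotone_derivs:
  assumes "completely_monotone f"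
  shows "completely_monotone (\<lambda>t. (-1) ^ m * (deriv ^^ m) f t)"
proof (rule completely_monotoneI)
  let ?D = "\<lambda>n t. (-1) ^ m * (deriv ^^ (n + m)) f t"
  show "(?D n has_real_derivative ?D (Suc n) t) (at t)" if "0 < t" for n t
    using completely_monotoneD(1)[OF assms that, of "n + m"] by (auto intro!: DERIV_cmult)
  show "(-1) ^ n * ?D n t \<ge> 0" if "0 < t" for n t
    using completely_monotoneD(2)[OF assms that, of "n + m"] by (simp add: power_add mult.assoc)
qed simp

lemma completely_monotone_cong:
  assumes "completely_monotone f" "\<And>t. 0 < t \<Longrightarrow> f t = g t"
  shows "completely_monotone g"
  by (rule completely_monotoneI[of "\<lambda>n. (deriv ^^ n) f"])
    (use assms completely_monotoneD[OF assms(1)] in auto)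

lemma completely_monotone_nonneg: "completely_monotone f \<Longrightarrow> 0 < t \<Longrightarrow> f t \<ge> 0"
  using completely_monotoneD(2)[of f t 0] by simp

lemma completely_monotone_deriv:
  "completely_monotone f \<Longrightarrow> 0 < t \<Longrightarrow> (f has_real_derivative deriv f t) (at t)"
  using completely_monotoneD(1)[of f t 0] by simp

lemma completely_monotone_minus_deriv: "completely_monotone f \<Longrightarrow> completely_monotone (\<lambda>t. - deriv f t)"
  using completely_monotone_derivs[of f 1] by simp

lemma completely_monotone_antimono:
  assumes "completely_monotone f" "0 < s" "s \<le> t"
  shows "f t \<le> f s"
proof (rule DERIV_nonpos_imp_nonincreasing[OF assms(3)])
  fix x assume "s \<le> x" "x \<le> t"
  then have "0 < x" using assms by simp
  then show "\<exists>y. (f has_real_derivative y) (at x) \<and> y \<le> 0"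
    using completely_monotone_deriv[OF assms(1)]
      completely_monotone_nonneg[OF completely_monotone_minus_deriv[OF assms(1)]] by force
qed

lemma completely_monotone_continuous: "completely_monotone f \<Longrightarrow> continuous_on {0<..} f"
  by (auto intro!: continuous_at_imp_continuous_on DERIV_isCont completely_monotone_deriv)

text \<open>The bound on the second derivative that makes the difference quotients converge uniformly
  in \<open>n\<close> comes for free from monotonicity.\<close>

lemma completely_monotone_limit_derivative:
  assumes cm: "\<And>n. completely_monotone (g n)"
    and der: "\<And>n t. 0 < t \<Longrightarrow> (f n has_real_derivative g n t) (at t)"
    and lim: "\<And>t. 0 < t \<Longrightarrow> (\<lambda>n. f n t) \<longlonglongrightarrow> F t"
    and t: "0 < t"
  shows "convergent (\<lambda>n. g n t)" and "(F has_real_derivative lim (\<lambda>n. g n t)) (at t)"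
proof -
  have "Bseq (\<lambda>n. f n (t/4) - f n (t/8))"
    using tendsto_diff[OF lim[of "t/4"] lim[of "t/8"]] t by (intro convergent_imp_Bseq convergentI) auto
  then obtain M where M: "\<And>n. norm (f n (t/4) - f n (t/8)) \<le> M" "M > 0" by (auto simp: Bseq_def)
  \<comment> \<open>Two mean value steps: on [t/8, t/4] the bound \<open>M\<close> on the increments
    of \<open>f n\<close> bounds \<open>g n (t/4)\<close> at the cost 8/t; on [t/4, t/2] this bounds
    the derivative of \<open>g n\<close> at the cost 4/t.\<close>
  define K where "K = 32 * M / t^2"
  have g4: "g n (t/4) \<le> 8 * M / t" for n
  proof -
    obtain z where z: "t/8 < z" "z < t/4" "f n (t/4) - f n (t/8) = (t/4 - t/8) * g n z"
      using MVT2[of "t/8" "t/4" "f n" "g n"] der t by auto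
    have "(t/8) * g n (t/4) \<le> (t/8) * g n z"
      using completely_monotone_antimono[OF cm, of z "t/4" n] z t by (intro mult_left_mono) auto
    also have "\<dots> \<le> M" using z(3) M(1)[of n] by simp
    finally show ?thesis using t by (simp add: field_simps)
  qed
  have d2: "- deriv (g n) x \<le> K" "0 \<le> - deriv (g n) x" if "x \<ge> t/2" for n x
  proof -
    let ?h = "\<lambda>t. - deriv (g n) t"
    note h = completely_monotone_minus_deriv[OF cm[of n]]
    obtain z where z: "t/4 < z" "z < t/2" "g n (t/2) - g n (t/4) = (t/2 - t/4) * deriv (g n) z"
      using MVT2[of "t/4" "t/2" "g n" "deriv (g n)"] completely_monotone_deriv[OF cm[of n]] t by auto
    have "(t/4) * ?h x \<le> (t/4) * ?h z"
      using completely_monotone_antimono[OF h, of z x] z that t by (intro mult_left_mono) auto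
    also have "\<dots> = g n (t/4) - g n (t/2)" using z(3) by simp
    also have "\<dots> \<le> 8 * M / t" using g4[of n] completely_monotone_nonneg[OF cm, of "t/2" n] t by simp
    finally show "?h x \<le> K" using t by (simp add: field_simps K_def power2_eq_square)
    show "0 \<le> ?h x" using completely_monotone_nonneg[OF h] that t by simp
  qed
  have K0: "K \<ge> 0" unfolding K_def using M(2) by simp
  have lip: "\<bar>g n x - g n t\<bar> \<le> K * \<bar>x - t\<bar>" if "x \<ge> t/2" for n x
  proof -
    have "norm (g n x - g n t) \<le> K * norm (x - t)"
    proof (rule field_differentiable_bound[of "{t/2..}"])
      fix z assume "z \<in> {t/2..}"
      then show "(g n has_field_derivative deriv (g n) z) (at z within {t/2..})"
        using completely_monotone_deriv[OF cm[of n], of z] t by (auto intro: has_field_derivative_at_within)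
      show "norm (deriv (g n) z) \<le> K" using d2[of z n] \<open>z \<in> _\<close> by auto
    qed (use that t in auto)
    then show ?thesis by simp
  qed
  have key: "\<bar>f n x - f n t - g n t * (x - t)\<bar> \<le> K * (x - t)^2" if "x \<ge> t/2" for n x
  proof -
    let ?S = "{min x t..max x t}"
    have "norm ((f n x - g n t * x) - (f n t - g n t * t)) \<le> (K * \<bar>x - t\<bar>) * norm (x - t)"
    proof (rule field_differentiable_bound[of ?S])
      fix z assume z: "z \<in> ?S"
      then have "z \<ge> t/2" using that t by auto
      then show "((\<lambda>x. f n x - g n t * x) has_field_derivative (g n z - g n t)) (at z within ?S)"
        using t by (intro has_field_derivative_at_within[OF DERIV_diff] der DERIV_cmult_Id) auto
      show "norm (g n z - g n t) \<le> K * \<bar>x - t\<bar>"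
      proof -
        have "\<bar>z - t\<bar> \<le> \<bar>x - t\<bar>" using z by (auto simp: min_def max_def split: if_splits)
        then show ?thesis using lip[OF \<open>z \<ge> t/2\<close>, of n] mult_left_mono[OF _ K0] by force
      qed
    qed auto
    also have "\<dots> = K * (x - t)\<^sup>2" using power2_abs[of "x - t"] by (simp add: power2_eq_square)
    also have "f n x - g n t * x - (f n t - g n t * t) = f n x - f n t - g n t * (x - t)"
      by (simp add: right_diff_distrib)
    finally show ?thesis by simp
  qed
  have "Cauchy (\<lambda>n. g n t)"
  proof (rule metric_CauchyI)
    fix e :: real assume e: "0 < e"
    \<comment> \<open>The two quadratic errors \<open>K * h^2\<close> must together stay below half
      of \<open>e * h\<close>; \<open>K + 1\<close> avoids a zero denominator.\<close>
    define h where "h = e / (4 * (K + 1))"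
    have h: "h > 0" "2 * K * h \<le> e / 2" using e K0 by (auto simp: h_def field_simps)
    have "Cauchy (\<lambda>n. f n (t + h) - f n t)"
      using tendsto_diff[OF lim[of "t+h"] lim[of "t"]] t h by (intro LIMSEQ_imp_Cauchy) auto
    then obtain N where N: "\<And>m n. m \<ge> N \<Longrightarrow> n \<ge> N \<Longrightarrow> dist (f m (t + h) - f m t) (f n (t + h) - f n t) < e * h / 2"
      using metric_CauchyD[of "\<lambda>n. f n (t + h) - f n t" "e * h / 2"] e h by auto
    show "\<exists>M. \<forall>m\<ge>M. \<forall>n\<ge>M. dist (g m t) (g n t) < e"
    proof (intro exI allI impI)
      fix m n assume "m \<ge> N" "n \<ge> N"
      then have "\<bar>(f m (t + h) - f m t) - (f n (t + h) - f n t)\<bar> < e * h / 2" using N by (simp add: dist_real_def)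
      moreover have "\<bar>f m (t+h) - f m t - g m t * h\<bar> \<le> K * h^2" "\<bar>f n (t+h) - f n t - g n t * h\<bar> \<le> K * h^2"
        using key[of "t+h" m] key[of "t+h" n] h t by auto
      ultimately have "\<bar>g m t * h - g n t * h\<bar> < e * h / 2 + 2 * (K * h^2)" by linarith
      also have "\<dots> \<le> e * h / 2 + (e / 2) * h"
      proof -
        have "2 * K * h * h \<le> (e / 2) * h" by (rule mult_right_mono) (use h in auto)
        then show ?thesis unfolding power2_eq_square by (simp only: mult.assoc)
      qed
      finally have "\<bar>g m t - g n t\<bar> * h < e * h" using h(1) by (simp add: abs_mult flip: left_diff_distrib)
      then show "dist (g m t) (g n t) < e" using h(1) by (simp add: dist_real_def)
    qed
  qed
  then show conv: "convergent (\<lambda>n. g n t)" by (simp add: Cauchy_convergent_iff)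
  define G where "G = lim (\<lambda>n. g n t)"
  have G: "(\<lambda>n. g n t) \<longlonglongrightarrow> G" using conv by (simp add: G_def convergent_LIMSEQ_iff)
  \<comment> \<open>The quadratic error bound is uniform in \<open>n\<close>, hence survives in the
    limit and identifies the derivative of \<open>F\<close>.\<close>
  have keyF: "\<bar>F x - F t - G * (x - t)\<bar> \<le> K * (x - t)^2" if "x \<ge> t/2" for x
  proof (rule LIMSEQ_le_const2)
    show "(\<lambda>n. \<bar>f n x - f n t - g n t * (x - t)\<bar>) \<longlonglongrightarrow> \<bar>F x - F t - G * (x - t)\<bar>"
      using that t by (intro tendsto_intros lim G) auto
  qed (use key[OF that] in auto)
  have "((\<lambda>h. (F (t + h) - F t) / h) \<longlongrightarrow> G) (at 0)"
  proof (rule Lim_null_comparison[THEN Lim_null[THEN iffD2]])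
    have "\<forall>\<^sub>F h in at 0. \<bar>h\<bar> < t/2 \<and> h \<noteq> (0::real)"
      using t by (auto simp: eventually_at dist_real_def intro!: exI[of _ "t/2"])
    then show "\<forall>\<^sub>F h in at 0. norm ((F (t + h) - F t) / h - G) \<le> K * \<bar>h\<bar>"
    proof eventually_elim
      case (elim h)
      have "\<bar>F (t + h) - F t - G * h\<bar> \<le> K * h^2" using keyF[of "t+h"] elim by auto
      then have "\<bar>F (t + h) - F t - G * h\<bar> \<le> K * \<bar>h\<bar> * \<bar>h\<bar>"
        by (simp add: power2_eq_square)
      moreover have "(F (t + h) - F t) / h - G = (F (t + h) - F t - G * h) / h"
        using elim by (simp add: diff_divide_distrib)
      ultimately show ?case using elim by (simp add: abs_divide pos_divide_le_eq)
    qed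
    show "((\<lambda>h. K * \<bar>h\<bar>) \<longlongrightarrow> 0) (at 0)" by (auto intro!: tendsto_eq_intros)
  qed
  then show "(F has_real_derivative lim (\<lambda>n. g n t)) (at t)" by (simp add: DERIV_def G_def)
qed

text \<open>Convergence of the derivatives is gained order by order from the preceding lemma. It is
  applied to the k-th derivatives times \<open>(-1) ^ Suc k\<close>, because this is the sign that
  makes their derivatives completely monotone.\<close>

lemma completely_monotone_limit:
  assumes cm: "\<And>n. completely_monotone (g n)"
    and lim: "\<And>t. 0 < t \<Longrightarrow> (\<lambda>n. g n t) \<longlonglongrightarrow> G t"
  shows "completely_monotone G"
proof -
  define D where "D k t = lim (\<lambda>n. (deriv ^^ k) (g n) t)" for k t
  have conv: "\<forall>t>0. convergent (\<lambda>n. (deriv ^^ k) (g n) t)" for k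
  proof (induction k)
    case 0 then show ?case using lim by (auto simp: convergent_def)
  next
    case (Suc k)
    show ?case
    proof (intro allI impI)
      fix t :: real assume t: "0 < t"
      have "convergent (\<lambda>n. (-1) ^ Suc k * (deriv ^^ Suc k) (g n) t)"
      proof (rule completely_monotone_limit_derivative(1)[where f="\<lambda>n t. (-1) ^ Suc k * (deriv ^^ k) (g n) t"
              and F="\<lambda>t. (-1) ^ Suc k * D k t"])
        show "completely_monotone (\<lambda>t. (-1) ^ Suc k * (deriv ^^ Suc k) (g n) t)" for n
          by (rule completely_monotone_derivs[OF cm])
        show "((\<lambda>t. (-1) ^ Suc k * (deriv ^^ k) (g n) t) has_real_derivative
               (-1) ^ Suc k * (deriv ^^ Suc k) (g n) t) (at t)" if "0 < t" for n t
          by (rule DERIV_cmult[OF completely_monotoneD(1)[OF cm that]])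
        show "(\<lambda>n. (-1) ^ Suc k * (deriv ^^ k) (g n) t) \<longlonglongrightarrow> (-1) ^ Suc k * D k t" if "0 < t" for t
          using Suc that unfolding D_def convergent_LIMSEQ_iff by (intro tendsto_intros) blast
      qed (use t in simp)
      then show "convergent (\<lambda>n. (deriv ^^ Suc k) (g n) t)"
        using convergent_mult_const_iff[of "(-1) ^ Suc k :: real"] by fastforce
    qed
  qed
  then have D: "(\<lambda>n. (deriv ^^ k) (g n) t) \<longlonglongrightarrow> D k t" if "0 < t" for k t
    using that by (simp add: D_def convergent_LIMSEQ_iff)
  show ?thesis
  proof (rule completely_monotoneI[where D=D])
    show "D 0 t = G t" if "0 < t" for t
      using LIMSEQ_unique[OF D[OF that, of 0]] lim[OF that] by simp
    show "(-1) ^ k * D k t \<ge> 0" if "0 < t" for k t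
      by (rule LIMSEQ_le_const[OF tendsto_mult_left[OF D[OF that]]])
         (use completely_monotoneD(2)[OF cm that] in auto)
    show "(D k has_real_derivative D (Suc k) t) (at t)" if t: "0 < t" for k t
    proof -
      have "((\<lambda>t. (-1) ^ Suc k * D k t) has_real_derivative lim (\<lambda>n. (-1) ^ Suc k * (deriv ^^ Suc k) (g n) t)) (at t)"
      proof (rule completely_monotone_limit_derivative(2)[where f="\<lambda>n t. (-1) ^ Suc k * (deriv ^^ k) (g n) t"
              and F="\<lambda>t. (-1) ^ Suc k * D k t"])
        show "completely_monotone (\<lambda>t. (-1) ^ Suc k * (deriv ^^ Suc k) (g n) t)" for n
          by (rule completely_monotone_derivs[OF cm])
        show "((\<lambda>t. (-1) ^ Suc k * (deriv ^^ k) (g n) t) has_real_derivative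
               (-1) ^ Suc k * (deriv ^^ Suc k) (g n) t) (at t)" if "0 < t" for n t
          by (rule DERIV_cmult[OF completely_monotoneD(1)[OF cm that]])
        show "(\<lambda>n. (-1) ^ Suc k * (deriv ^^ k) (g n) t) \<longlonglongrightarrow> (-1) ^ Suc k * D k t" if "0 < t" for t
          by (intro tendsto_intros D that)
      qed (use t in simp)
      also have "lim (\<lambda>n. (-1) ^ Suc k * (deriv ^^ Suc k) (g n) t) = (-1) ^ Suc k * D (Suc k) t"
        by (intro limI tendsto_mult_left D t)
      finally have "((\<lambda>t. (-1) ^ Suc k * ((-1) ^ Suc k * D k t)) has_real_derivative (-1) ^ Suc k * ((-1) ^ Suc k * D (Suc k) t)) (at t)"
        by (rule DERIV_cmult)
      then show ?thesis by (simp flip: mult.assoc)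
    qed
  qed
qed

section \<open>Approximation by sums of exponentials\<close>

text \<open>The expansion of \<open>f\<close> about the centre \<open>c\<close>, with the signs
  arranged so that for completely monotone \<open>f\<close> and \<open>t \<le> c\<close> every
  Taylor term is non-negative.\<close>

definition taylor_remainder :: "(real \<Rightarrow> real) \<Rightarrow> nat \<Rightarrow> real \<Rightarrow> real \<Rightarrow> real" where
  "taylor_remainder f m c t = f t - (\<Sum>k<Suc m. (-1) ^ k * (deriv ^^ k) f c * (c - t) ^ k / fact k)"

lemma taylor_remainder_self: "taylor_remainder f m t t = 0"
proof -
  have "(\<Sum>k<Suc m. (-1) ^ k * (deriv ^^ k) f t * (t - t) ^ k / fact k) = (\<Sum>k<Suc m. if k = 0 then f t else 0)"
    by (intro sum.cong) auto
  then show ?thesis unfolding taylor_remainder_def by (simp add: sum.delta)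
qed

text \<open>Differentiating in the centre \<open>c\<close> of the expansion makes the sum telescope.\<close>

lemma taylor_remainder_derivative:
  assumes cm: "completely_monotone f" and c: "0 < c"
  shows "((\<lambda>c. taylor_remainder f m c t) has_real_derivative
    (-1) ^ Suc m * (deriv ^^ Suc m) f c * (c - t) ^ m / fact m) (at c)"
proof (induction m)
  case 0
  show ?case unfolding taylor_remainder_def
    using completely_monotoneD(1)[OF cm c, of 0] by (auto intro!: derivative_eq_intros)
next
  case (Suc m)
  define d where "d k = (deriv ^^ k) f" for k
  let ?s = "(-1) ^ Suc m :: real"
  have d: "(d (Suc m) has_real_derivative d (Suc (Suc m)) c) (at c)"
    unfolding d_def by (rule completely_monotoneD(1)[OF cm c])
  have p: "((\<lambda>c. (c - t) ^ Suc m) has_real_derivative real (Suc m) * (c - t) ^ m) (at c)"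
    by (rule derivative_eq_intros refl)+ simp
  have "((\<lambda>c. taylor_remainder f m c t - ?s / fact (Suc m) * (d (Suc m) c * (c - t) ^ Suc m)) has_real_derivative
    ?s * d (Suc m) c * (c - t) ^ m / fact m -
    ?s / fact (Suc m) * (d (Suc (Suc m)) c * (c - t) ^ Suc m + real (Suc m) * (c - t) ^ m * d (Suc m) c)) (at c)"
    using Suc unfolding d_def[symmetric] by (intro DERIV_diff DERIV_cmult DERIV_mult d p)
  also have "(\<lambda>c. taylor_remainder f m c t - ?s / fact (Suc m) * (d (Suc m) c * (c - t) ^ Suc m)) = (\<lambda>c. taylor_remainder f (Suc m) c t)"
    by (simp add: taylor_remainder_def fun_eq_iff d_def[symmetric])
  also have "?s * d (Suc m) c * (c - t) ^ m / fact m -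
    ?s / fact (Suc m) * (d (Suc (Suc m)) c * (c - t) ^ Suc m + real (Suc m) * (c - t) ^ m * d (Suc m) c)
    = (-1) ^ Suc (Suc m) * d (Suc (Suc m)) c * (c - t) ^ Suc m / fact (Suc m)"
  proof -
    have "?s / fact (Suc m) * real (Suc m) = ?s / fact m" unfolding fact_Suc by (simp add: field_simps del: of_nat_Suc)
    then have "?s / fact (Suc m) * (real (Suc m) * (c - t) ^ m * d (Suc m) c) = ?s * d (Suc m) c * (c - t) ^ m / fact m"
      by (metis (no_types, lifting) mult.assoc mult.commute times_divide_eq_left)
    then show ?thesis by (simp add: distrib_left)
  qed
  finally show ?case unfolding d_def .
qed

text \<open>The remainder is 0 when the centre is \<open>t\<close> itself and grows as the centre
  moves to the right.\<close>

lemma taylor_remainder_nonneg: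
  assumes cm: "completely_monotone f" and t: "0 < t" "t \<le> a"
  shows "0 \<le> taylor_remainder f m a t"
proof -
  have "taylor_remainder f m t t \<le> taylor_remainder f m a t"
  proof (rule DERIV_nonneg_imp_nondecreasing[OF t(2)])
    fix c assume c: "t \<le> c" "c \<le> a"
    have "0 \<le> (-1) ^ Suc m * (deriv ^^ Suc m) f c * (c - t) ^ m / fact m"
      using completely_monotoneD(2)[OF cm, of c "Suc m"] c t by (intro divide_nonneg_pos mult_nonneg_nonneg[of _ "(c - t) ^ m"] zero_le_power) auto
    then show "\<exists>y. ((\<lambda>c. taylor_remainder f m c t) has_real_derivative y) (at c) \<and> 0 \<le> y"
      using taylor_remainder_derivative[OF cm, of c m t] c t by auto
  qed
  then show ?thesis by (simp add: taylor_remainder_self)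
qed

text \<open>Compare derivatives in the centre \<open>c\<close>: the ratio (c - t)/(c - s) increases
  with c and reaches \<open>q\<close> at c = a. So the remainder at \<open>t\<close> is at most
  \<open>q ^ m\<close> times the one at \<open>s\<close>, which in turn is at most
  \<open>f s\<close> because the Taylor terms are non-negative.\<close>

lemma taylor_remainder_le:
  assumes cm: "completely_monotone f" and s: "0 < s" "s < t" "t \<le> a"
  shows "taylor_remainder f m a t \<le> ((a - t) / (a - s)) ^ m * f s"
proof -
  define q where "q = (a - t) / (a - s)"
  have q: "0 \<le> q" "q \<le> 1" using s by (auto simp: q_def field_simps)
  let ?h = "\<lambda>c. q ^ m * taylor_remainder f m c s - taylor_remainder f m c t"
  have "?h t \<le> ?h a"
  proof (rule DERIV_nonneg_imp_nondecreasing[OF s(3)])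
    fix c assume c: "t \<le> c" "c \<le> a"
    let ?D = "(-1) ^ Suc m * (deriv ^^ Suc m) f c"
    have "(c - t) * (a - s) \<le> (a - t) * (c - s)" using mult_nonneg_nonneg[of "a - c" "t - s"] c s by (simp add: algebra_simps)
    then have "c - t \<le> q * (c - s)" using s by (simp add: q_def field_simps)
    then have "(c - t) ^ m \<le> q ^ m * (c - s) ^ m" using c unfolding power_mult_distrib[symmetric] by (intro power_mono) auto
    then have "?D * (c - t) ^ m / fact m \<le> q ^ m * (?D * (c - s) ^ m / fact m)"
      using completely_monotoneD(2)[OF cm, of c "Suc m"] c s mult_left_mono[of "(c - t) ^ m" "q ^ m * (c - s) ^ m" "?D"]
      by (simp add: divide_right_mono mult.left_commute del: funpow.simps)
    then show "\<exists>y. (?h has_real_derivative y) (at c) \<and> 0 \<le> y"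
      using c s by (intro exI[of _ "q ^ m * (?D * (c - s) ^ m / fact m) - ?D * (c - t) ^ m / fact m"] conjI
          DERIV_diff DERIV_cmult taylor_remainder_derivative[OF cm]) (simp_all del: funpow.simps power_Suc)
  qed
  moreover have "0 \<le> ?h t" using taylor_remainder_nonneg[OF cm, of s t m] q s by (simp add: taylor_remainder_self)
  ultimately have "taylor_remainder f m a t \<le> q ^ m * taylor_remainder f m a s" by simp
  also have "\<dots> \<le> q ^ m * f s"
  proof -
    have "0 \<le> (-1) ^ k * (deriv ^^ k) f a * (a - s) ^ k / fact k" for k
      using completely_monotoneD(2)[OF cm, of a k] s by (intro divide_nonneg_pos mult_nonneg_nonneg[of _ "(a - s) ^ k"] zero_le_power) auto
    then have "taylor_remainder f m a s \<le> f s"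
      unfolding taylor_remainder_def by (simp add: sum_nonneg del: sum.lessThan_Suc)
    then show ?thesis using q by (intro mult_left_mono) auto
  qed
  finally show ?thesis by (simp add: q_def)
qed

definition exp_coeff :: "(real \<Rightarrow> real) \<Rightarrow> real \<Rightarrow> nat \<Rightarrow> real" where
  "exp_coeff f a k = (-1) ^ k * (deriv ^^ k) f a * a ^ k / fact k"

definition exp_approx :: "(real \<Rightarrow> real) \<Rightarrow> real \<Rightarrow> nat \<Rightarrow> real \<Rightarrow> real" where
  "exp_approx f a m t = (\<Sum>k<Suc m. exp_coeff f a k * exp (- (real k / a) * t))"

lemma exp_coeff_nonneg: "completely_monotone f \<Longrightarrow> 0 < a \<Longrightarrow> exp_coeff f a k \<ge> 0"
  unfolding exp_coeff_def using completely_monotoneD(2)[of f a k] by simp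

lemma taylor_sum_eq:
  assumes "0 < a"
  shows "(\<Sum>k<Suc m. exp_coeff f a k * (1 - t / a) ^ k) = f t - taylor_remainder f m a t"
proof -
  have "exp_coeff f a k * (1 - t / a) ^ k = (-1) ^ k * (deriv ^^ k) f a * (a - t) ^ k / fact k" for k
  proof -
    have "(a - t) ^ k = a ^ k * (1 - t / a) ^ k" using assms by (simp add: field_simps flip: power_mult_distrib)
    then show ?thesis by (simp add: exp_coeff_def)
  qed
  then show ?thesis unfolding taylor_remainder_def by simp
qed

lemma exp_power: "exp (- (real k / a) * t) = exp (- (t / a)) ^ k"
  by (simp add: exp_of_nat_mult[symmetric])

text \<open>The lower bound uses \<open>1 - x \<le> exp (-x)\<close>, the upper bound \<open>exp (-x) \<le> 1 - x + x\<^sup>2/2\<close>.\<close>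

lemma exp_approx_bounds:
  assumes cm: "completely_monotone f" and t: "0 < t" "t \<le> a"
  shows "f t - ((a - t) / (a - t / 2)) ^ m * f (t / 2) \<le> exp_approx f a m t"
    and "exp_approx f a m t \<le> f (t - t\<^sup>2 / (2 * a))"
    and "exp_approx f a m t \<le> f (t / 2)"
proof -
  have a: "0 < a" using t by simp
  have x: "0 < t / a" "t / a \<le> 1" using t by auto
  have "f t - ((a - t) / (a - t / 2)) ^ m * f (t / 2) \<le> f t - taylor_remainder f m a t"
    using taylor_remainder_le[OF cm, of "t/2" t a m] t by simp
  also have "\<dots> = (\<Sum>k<Suc m. exp_coeff f a k * (1 - t / a) ^ k)" using taylor_sum_eq[OF a] by simp
  also have "\<dots> \<le> exp_approx f a m t"
    unfolding exp_approx_def exp_power using x exp_ge_add_one_self[of "- (t / a)"]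
    by (intro sum_mono mult_left_mono power_mono exp_coeff_nonneg[OF cm a]) auto
  finally show "f t - ((a - t) / (a - t / 2)) ^ m * f (t / 2) \<le> exp_approx f a m t" .
  \<comment> \<open>Chosen so that 1 - x + x^2/2 at x = t/a equals 1 - t'/a: the upper estimate is
    then a Taylor sum at \<open>t'\<close>, hence at most \<open>f t'\<close>.\<close>
  define t' where "t' = t - t\<^sup>2 / (2 * a)"
  have "t * t \<le> t * a" using t by (intro mult_left_mono) auto
  then have t': "t / 2 \<le> t'" using a by (simp add: t'_def field_simps power2_eq_square)
  have t'a: "t' \<le> t" using a by (simp add: t'_def)
  have e: "exp (- (t / a)) \<le> 1 - t' / a"
  proof -
    have "exp (- x) \<le> 1 - x + x\<^sup>2 / 2" if "0 \<le> x" for x :: real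
    proof -
      let ?p = "\<lambda>x::real. 1 - x + x\<^sup>2 / 2 - exp (- x)"
      have "?p 0 \<le> ?p x"
      proof (rule DERIV_nonneg_imp_nondecreasing[OF that])
        fix y :: real
        show "\<exists>z. (?p has_real_derivative z) (at y) \<and> 0 \<le> z"
          using exp_ge_add_one_self[of "-y"]
          by (intro exI[of _ "- 1 + y + exp (- y)"]) (auto intro!: derivative_eq_intros)
      qed
      then show ?thesis by simp
    qed
    from this[of "t/a"] have "exp (- (t / a)) \<le> 1 - t / a + (t / a)\<^sup>2 / 2" using x by simp
    also have "\<dots> = 1 - t' / a" using a by (simp add: t'_def field_simps power2_eq_square)
    finally show ?thesis .
  qed
  have "exp_approx f a m t \<le> (\<Sum>k<Suc m. exp_coeff f a k * (1 - t' / a) ^ k)"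
    unfolding exp_approx_def exp_power using e
    by (intro sum_mono mult_left_mono power_mono exp_coeff_nonneg[OF cm a]) auto
  also have "\<dots> \<le> f t'"
    unfolding taylor_sum_eq[OF a] using taylor_remainder_nonneg[OF cm, of t' a m] t' t t'a by simp
  finally show 1: "exp_approx f a m t \<le> f (t - t\<^sup>2 / (2 * a))" by (simp add: t'_def)
  then show "exp_approx f a m t \<le> f (t / 2)"
    using completely_monotone_antimono[OF cm, of "t/2" t'] t t' by (simp add: t'_def)
qed

text \<open>The remainder bound is at most exp(-(t/2) m/a) times \<open>f (t/2)\<close>, so the
  degree m must outgrow the centre a. With a = n + 1 and m = a^2 the factor is exp(-(t/2)(n +
  1)).\<close>

lemma exp_approx_tendsto:
  assumes cm: "completely_monotone f" and t: "0 < t"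
  shows "(\<lambda>n. exp_approx f (real (Suc n)) ((Suc n)\<^sup>2) t) \<longlonglongrightarrow> f t"
proof (rule tendsto_sandwich)
  obtain n0 where n0: "t \<le> real n0" using real_arch_simple by blast
  let ?q = "\<lambda>n. exp (- (t / 2) * real (Suc n))"
  show "\<forall>\<^sub>F n in sequentially. f t - ?q n * f (t / 2) \<le> exp_approx f (real (Suc n)) ((Suc n)\<^sup>2) t"
    using eventually_ge_at_top[of n0]
  proof eventually_elim
    case (elim n)
    define a where "a = real (Suc n)"
    have a: "t \<le> a" "0 < a" using elim n0 t by (auto simp: a_def)
    have q: "0 \<le> (a - t) / (a - t / 2)" using a t by simp
    have "(a - t) / (a - t / 2) \<le> 1 - (t / 2) / a"
    proof -
      have "(a - t) * a \<le> (a - t/2) * (a - t/2)" by (simp add: algebra_simps power2_eq_square)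
      then have "(a - t) / (a - t / 2) \<le> (a - t/2) / a" using a t by (simp add: field_simps)
      then show ?thesis using a by (simp add: diff_divide_distrib)
    qed
    also have "\<dots> \<le> exp (- ((t / 2) / a))" using exp_ge_add_one_self[of "- ((t / 2) / a)"] by simp
    finally have "((a - t) / (a - t / 2)) ^ (Suc n)\<^sup>2 \<le> exp (- ((t / 2) / a)) ^ (Suc n)\<^sup>2"
      using q by (intro power_mono)
    also have "\<dots> = ?q n"
    proof -
      have "(real (Suc n) * real (Suc n)) * - (t / 2 / real (Suc n)) = - (t / 2) * real (Suc n)"
        by (simp add: field_simps del: of_nat_Suc)
      then show ?thesis
        unfolding exp_of_nat_mult[symmetric] a_def power2_eq_square of_nat_mult by simp
    qed
    finally have "((a - t) / (a - t / 2)) ^ (Suc n)\<^sup>2 * f (t/2) \<le> ?q n * f (t/2)"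
      using completely_monotone_nonneg[OF cm, of "t/2"] t by (intro mult_right_mono) auto
    then show ?case using exp_approx_bounds(1)[OF cm t a(1), of "(Suc n)\<^sup>2"] by (simp add: a_def)
  qed
  show "\<forall>\<^sub>F n in sequentially. exp_approx f (real (Suc n)) ((Suc n)\<^sup>2) t \<le> f (t - t\<^sup>2 / (2 * real (Suc n)))"
    using eventually_ge_at_top[of n0]
    by eventually_elim (rule exp_approx_bounds(2)[OF cm t], use n0 in auto)
  have "?q \<longlonglongrightarrow> 0"
  proof (rule filterlim_compose[OF exp_at_bot])
    show "filterlim (\<lambda>n. - (t / 2) * real (Suc n)) at_bot sequentially"
      by (rule filterlim_tendsto_neg_mult_at_bot[OF tendsto_const])
        (use t filterlim_compose[OF filterlim_real_sequentially filterlim_Suc] in \<open>simp_all del: of_nat_Suc\<close>)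
  qed
  then have "(\<lambda>n. f t - ?q n * f (t / 2)) \<longlonglongrightarrow> f t - 0 * f (t / 2)"
    by (rule tendsto_diff[OF tendsto_const tendsto_mult_right])
  then show "(\<lambda>n. f t - ?q n * f (t / 2)) \<longlonglongrightarrow> f t" by simp
  have "(\<lambda>n. t - t\<^sup>2 / (2 * real (Suc n))) \<longlonglongrightarrow> t - 0"
  proof (intro tendsto_intros)
    have "(\<lambda>n. (t\<^sup>2 / 2) * inverse (real (Suc n))) \<longlonglongrightarrow> (t\<^sup>2 / 2) * 0"
      by (intro tendsto_intros LIMSEQ_inverse_real_of_nat)
    then show "(\<lambda>n. t\<^sup>2 / (2 * real (Suc n))) \<longlonglongrightarrow> 0" by (simp add: field_simps)
  qed
  moreover have "isCont f t" using completely_monotone_deriv[OF cm t] DERIV_isCont by blast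
  ultimately show "(\<lambda>n. f (t - t\<^sup>2 / (2 * real (Suc n)))) \<longlonglongrightarrow> f t"
    using isCont_tendsto_compose[of t f "\<lambda>n. t - t\<^sup>2 / (2 * real (Suc n))" sequentially] by simp
qed

section \<open>Kernels that are finite sums of exponentials\<close>

text \<open>The function whose derivatives at 0 are the \<open>a k\<close>. Differentiation is a
  shift of the sequence, so a linear differential system with constant coefficients becomes a
  recursion, whose solutions grow at most geometrically and give everywhere convergent
  series.\<close>

definition egf :: "(nat \<Rightarrow> 'a::euclidean_space) \<Rightarrow> real \<Rightarrow> 'a" where
  "egf a t = (\<Sum>k. (t ^ k / fact k) *\<^sub>R a k)"

definition geometric_growth :: "(nat \<Rightarrow> 'a::euclidean_space) \<Rightarrow> bool" where
  "geometric_growth a \<longleftrightarrow> (\<exists>c R. \<forall>k. norm (a k) \<le> c * R ^ k)"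

lemma egf_0: "egf a 0 = a 0"
proof -
  have "(\<lambda>k. (0 ^ k / fact k) *\<^sub>R a k) = (\<lambda>k. if k = 0 then a 0 else 0)" by (auto simp: fun_eq_iff)
  then show ?thesis unfolding egf_def using sums_single[of 0 "\<lambda>_. a 0"] by (simp add: sums_iff)
qed

lemma egf_sums:
  assumes "geometric_growth a"
  shows "(\<lambda>k. (t ^ k / fact k) *\<^sub>R a k) sums egf a t"
proof -
  obtain c R where cR: "\<And>k. norm (a k) \<le> c * R ^ k" using assms by (auto simp: geometric_growth_def)
  have c: "0 \<le> c" using order_trans[OF norm_ge_zero cR[of 0]] by simp
  show ?thesis unfolding egf_def
  proof (rule summable_sums, rule summable_comparison_test')
  show "summable (\<lambda>k. c * ((\<bar>t\<bar> * \<bar>R\<bar>) ^ k / fact k))"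
    using summable_exp[of "\<bar>t\<bar> * \<bar>R\<bar>"] by (intro summable_mult) (simp add: divide_inverse mult.commute)
  show "norm ((t ^ k / fact k) *\<^sub>R a k) \<le> c * ((\<bar>t\<bar> * \<bar>R\<bar>) ^ k / fact k)" for k
  proof -
    have "c * R ^ k \<le> c * \<bar>R\<bar> ^ k" using c by (intro mult_left_mono) (auto simp: power_abs[symmetric])
    then have "norm (a k) \<le> c * \<bar>R\<bar> ^ k" using cR[of k] by linarith
    then have "\<bar>t\<bar> ^ k / fact k * norm (a k) \<le> \<bar>t\<bar> ^ k / fact k * (c * \<bar>R\<bar> ^ k)"
      by (intro mult_left_mono) auto
    then show ?thesis by (simp add: power_abs power_mult_distrib mult.left_commute)
  qed
  qed
qed

lemma geometric_growth_Suc: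
  assumes "geometric_growth a" shows "geometric_growth (\<lambda>k. a (Suc k))"
proof -
  obtain c R where "\<And>k. norm (a k) \<le> c * R ^ k" using assms by (auto simp: geometric_growth_def)
  then have "norm (a (Suc k)) \<le> (c * R) * R ^ k" for k by (metis mult.assoc power_Suc)
  then show ?thesis unfolding geometric_growth_def by blast
qed

text \<open>Prepending a coefficient is integration with a prescribed initial value; it serves the
  primitives \<open>C\<close> and \<open>Y\<close> below.\<close>

lemma geometric_growth_case:
  assumes "geometric_growth a" shows "geometric_growth (\<lambda>k. case k of 0 \<Rightarrow> b | Suc k \<Rightarrow> a k)"
proof -
  obtain c R where cR: "\<And>k. norm (a k) \<le> c * R ^ k" using assms by (auto simp: geometric_growth_def)
  have c: "0 \<le> c" using order_trans[OF norm_ge_zero cR[of 0]] by simp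
  let ?c = "c + norm b" let ?R = "\<bar>R\<bar> + 1"
  have "norm (case k of 0 \<Rightarrow> b | Suc k \<Rightarrow> a k) \<le> ?c * ?R ^ k" for k
  proof (cases k)
    case (Suc m)
    have "c * R ^ m \<le> c * ?R ^ m"
      using c power_mono[of "\<bar>R\<bar>" ?R m] abs_ge_self[of "R ^ m"] by (intro mult_left_mono) (auto simp: power_abs)
    also have "\<dots> \<le> ?c * ?R ^ k"
      using c Suc by (intro mult_mono power_increasing) auto
    finally show ?thesis using Suc cR[of m] by simp
  qed (use c in simp)
  then show ?thesis unfolding geometric_growth_def by blast
qed

lemma geometric_growth_linear:
  assumes "geometric_growth a" "bounded_linear h" shows "geometric_growth (\<lambda>k. h (a k))"
proof -
  obtain c R where cR: "\<And>k. norm (a k) \<le> c * R ^ k" using assms by (auto simp: geometric_growth_def)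
  obtain K where K: "\<And>x. norm (h x) \<le> norm x * K" "K > 0" using bounded_linear.pos_bounded[OF assms(2)] by blast
  have "norm (h (a k)) \<le> (c * K) * R ^ k" for k
    using order_trans[OF K(1)[of "a k"] mult_right_mono[OF cR[of k] less_imp_le[OF K(2)]]] by (simp add: mult_ac)
  then show ?thesis unfolding geometric_growth_def by blast
qed

lemma egf_linear:
  assumes "geometric_growth a" "bounded_linear h"
  shows "h (egf a t) = egf (\<lambda>k. h (a k)) t"
proof (rule sums_unique2)
  interpret bounded_linear h by fact
  show "(\<lambda>k. (t ^ k / fact k) *\<^sub>R h (a k)) sums h (egf a t)"
    using bounded_linear.sums[OF assms(2) egf_sums[OF assms(1)]] by (simp add: scaleR)
qed (rule egf_sums[OF geometric_growth_linear[OF assms]])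

lemma egf_derivative_real:
  fixes a :: "nat \<Rightarrow> real"
  assumes "geometric_growth a"
  shows "(egf a has_real_derivative egf (\<lambda>k. a (Suc k)) t) (at t)"
proof -
  have "((\<lambda>x. \<Sum>n. (a n / fact n) * x ^ n) has_real_derivative (\<Sum>n. diffs (\<lambda>n. a n / fact n) n * t ^ n)) (at t)"
    using egf_sums[OF assms] by (intro termdiffs_strong_converges_everywhere) (auto simp: sums_iff mult.commute)
  moreover have "diffs (\<lambda>n. a n / fact n) n * t ^ n = (t ^ n / fact n) *\<^sub>R a (Suc n)" for n
    by (simp add: diffs_def field_simps del: of_nat_Suc)
  ultimately show ?thesis by (simp add: egf_def[abs_def] mult.commute)
qed

lemma egf_derivative:
  assumes "geometric_growth a"
  shows "(egf a has_vector_derivative egf (\<lambda>k. a (Suc k)) t) (at t)"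
  unfolding has_vector_derivative_def
proof (subst has_derivative_componentwise_within, intro ballI)
  fix i :: 'a assume "i \<in> Basis"
  have *: "egf b x \<bullet> i = egf (\<lambda>k. b k \<bullet> i) x" if "geometric_growth b" for b :: "nat \<Rightarrow> 'a" and x
    using egf_linear[OF that bounded_linear_inner_left[of i]] .
  show "((\<lambda>x. egf a x \<bullet> i) has_derivative (\<lambda>x. x *\<^sub>R egf (\<lambda>k. a (Suc k)) t \<bullet> i)) (at t)"
    using egf_derivative_real[OF geometric_growth_linear[OF assms bounded_linear_inner_left[of i]], of t]
    by (simp add: * assms geometric_growth_Suc has_field_derivative_def mult_commute_abs)
qed

lemma geometric_growth_shift: "geometric_growth a \<Longrightarrow> geometric_growth (\<lambda>k. a (m + k))"
proof (induction m)
  case (Suc m)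
  then show ?case using geometric_growth_Suc[of "\<lambda>k. a (m + k)"] by simp
qed simp

lemma bounded_linear_matrix_mult: "bounded_linear (\<lambda>X. (A :: real^'n^'m) ** (X :: real^'k^'n))"
proof -
  have "linear (\<lambda>X. A ** (X :: real^'k^'n))"
    by (auto simp: linear_iff matrix_matrix_mult_def vec_eq_iff sum.distrib distrib_left sum_distrib_left mult.left_commute)
  then show ?thesis by (simp add: linear_conv_bounded_linear)
qed

lemma bounded_linear_matrix_vector: "bounded_linear (\<lambda>X. (X :: real^'n^'m) *v v)"
proof -
  have "linear (\<lambda>X. (X :: real^'n^'m) *v v)"
    by (auto simp: linear_iff matrix_vector_mult_def vec_eq_iff sum.distrib distrib_right sum_distrib_left mult.assoc)
  then show ?thesis by (simp add: linear_conv_bounded_linear)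
qed

lemma symmetric_inner:
  fixes A :: "real^'n^'n"
  assumes "transpose A = A"
  shows "(A *v x) \<bullet> y = x \<bullet> (A *v y)"
  by (metis assms dot_lmul_matrix transpose_matrix_vector)

lemma symmetric_inner_commute:
  fixes A :: "real^'n^'n"
  assumes "transpose A = A"
  shows "(A *v x) \<bullet> y = (A *v y) \<bullet> x"
  using symmetric_inner[OF assms] by (simp add: inner_commute)

text \<open>For the kernel with summands exp(-r i t) \<open>A i\<close>, the memory variables x_i =
  exp(-r i t) \<star> u turn the convolution equation into differential equations. With u the
  derivative of the solution, the equation differentiated once reads N u + \<Sum> A i x_i = I; at
  time 0 the memory is empty, so u starts at \<open>Ninv\<close>.\<close>

locale exponential_system =
  fixes N Ninv :: "real^'n^'n" and A :: "nat \<Rightarrow> real^'n^'n" and r :: "nat \<Rightarrow> real" and J :: nat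
  assumes N_sym: "transpose N = N" and N_inv: "N ** Ninv = mat 1"
    and A_sym: "\<And>i. i < J \<Longrightarrow> transpose (A i) = A i"
    and A_psd: "\<And>i v. i < J \<Longrightarrow> 0 \<le> v \<bullet> (A i *v v)"
    and r_nonneg: "\<And>i. i < J \<Longrightarrow> 0 \<le> r i"
    and N_psd: "\<And>v. 0 \<le> v \<bullet> (N *v v)"
begin

text \<open>Taylor coefficients at \<open>0\<close> of the solution of \<open>N u' = \<Sum> A\<^sub>i (r\<^sub>i x\<^sub>i - u)\<close>, \<open>x\<^sub>i' = u - r\<^sub>i x\<^sub>i\<close>,
  with \<open>u\<close> at index \<open>0\<close> and \<open>x\<^sub>i\<close> at index \<open>Suc i\<close>.\<close>

primrec state :: "nat \<Rightarrow> nat \<Rightarrow> real^'n^'n" where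
  "state 0 = (\<lambda>i. if i = 0 then Ninv else 0)"
| "state (Suc k) = (\<lambda>i. if i = 0 then Ninv ** (\<Sum>j<J. A j ** (r j *\<^sub>R state k (Suc j) - state k 0))
     else state k 0 - r (i - 1) *\<^sub>R state k i)"

lemma state_bound: "\<exists>c R. \<forall>k. \<forall>i\<le>J. norm (state k i) \<le> c * R ^ k"
proof -
  have "\<forall>M::real^'n^'n. \<exists>K. K > 0 \<and> (\<forall>X::real^'n^'n. norm (M ** X) \<le> norm X * K)"
    using bounded_linear.pos_bounded[OF bounded_linear_matrix_mult] by blast
  then obtain K where K0: "\<forall>M::real^'n^'n. K M > 0 \<and> (\<forall>X::real^'n^'n. norm (M ** X) \<le> norm X * K M)"
    by (rule choice[THEN exE])
  have K: "\<And>M. K M > 0" "\<And>M X. norm (M ** (X::real^'n^'n)) \<le> norm X * K M"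
    using K0 by simp_all
  \<comment> \<open>One summand per kind of row: the first bounds the recursion for u through
    operator bounds, the other two the recursion for the memory variables, which needs the absolute
    value of \<open>r j\<close> plus 1.\<close>
  define R where "R = K Ninv * (\<Sum>j<J. K (A j) * (\<bar>r j\<bar> + 1)) + (\<Sum>j<J. \<bar>r j\<bar>) + 1"
  have R1: "K Ninv * (\<Sum>j<J. K (A j) * (\<bar>r j\<bar> + 1)) \<le> R" "R \<ge> 0"
    unfolding R_def using K(1) by (auto intro!: sum_nonneg add_nonneg_nonneg mult_nonneg_nonneg simp: less_imp_le)
  have R2: "\<bar>r j\<bar> + 1 \<le> R" if "j < J" for j
    unfolding R_def using K(1) that member_le_sum[of j "{..<J}" "\<lambda>j. \<bar>r j\<bar>"]
    by (auto intro!: add_increasing sum_nonneg mult_nonneg_nonneg simp: less_imp_le)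
  have "\<forall>i\<le>J. norm (state k i) \<le> norm Ninv * R ^ k" for k
  proof (induction k)
    case 0 show ?case by simp
  next
    case (Suc k)
    let ?b = "norm Ninv * R ^ k"
    have b: "0 \<le> ?b" using R1 by simp
    show ?case
    proof (intro allI impI)
      fix i assume i: "i \<le> J"
      show "norm (state (Suc k) i) \<le> norm Ninv * R ^ Suc k"
      proof (cases "i = 0")
        case True
        have "norm (\<Sum>j<J. A j ** (r j *\<^sub>R state k (Suc j) - state k 0)) \<le> (\<Sum>j<J. ?b * (K (A j) * (\<bar>r j\<bar> + 1)))"
        proof (rule sum_norm_le)
          fix j assume "j \<in> {..<J}"
          then have j: "norm (state k (Suc j)) \<le> ?b" "norm (state k 0) \<le> ?b" using Suc by auto
          have "norm (r j *\<^sub>R state k (Suc j) - state k 0) \<le> \<bar>r j\<bar> * norm (state k (Suc j)) + norm (state k 0)"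
            using norm_triangle_ineq4[of "r j *\<^sub>R state k (Suc j)" "state k 0"] by simp
          also have "\<dots> \<le> \<bar>r j\<bar> * ?b + ?b" using j by (intro add_mono mult_left_mono) auto
          finally have "norm (r j *\<^sub>R state k (Suc j) - state k 0) * K (A j) \<le> (\<bar>r j\<bar> * ?b + ?b) * K (A j)"
            using K(1)[of "A j"] by (intro mult_right_mono) auto
          with K(2)[of "A j" "r j *\<^sub>R state k (Suc j) - state k 0"]
          show "norm (A j ** (r j *\<^sub>R state k (Suc j) - state k 0)) \<le> ?b * (K (A j) * (\<bar>r j\<bar> + 1))"
            by (simp add: algebra_simps)
        qed
        then have "norm (\<Sum>j<J. A j ** (r j *\<^sub>R state k (Suc j) - state k 0)) * K Ninv \<le> ?b * (\<Sum>j<J. K (A j) * (\<bar>r j\<bar> + 1)) * K Ninv"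
          using K(1)[of Ninv] by (intro mult_right_mono) (auto simp: sum_distrib_left)
        also have "\<dots> \<le> ?b * R" using mult_left_mono[OF R1(1) b] by (simp add: mult_ac)
        finally show ?thesis using True K(2)[of Ninv "\<Sum>j<J. A j ** (r j *\<^sub>R state k (Suc j) - state k 0)"] by (simp add: mult_ac)
      next
        case False
        then have "norm (state k i) \<le> ?b" "norm (state k 0) \<le> ?b" using Suc i by auto
        moreover have "norm (state k 0 - r (i - 1) *\<^sub>R state k i) \<le> norm (state k 0) + \<bar>r (i - 1)\<bar> * norm (state k i)"
          using norm_triangle_ineq4[of "state k 0" "r (i - 1) *\<^sub>R state k i"] by simp
        moreover have "\<bar>r (i - 1)\<bar> * norm (state k i) \<le> \<bar>r (i - 1)\<bar> * ?b" using calculation by (intro mult_left_mono) auto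
        ultimately have "norm (state (Suc k) i) \<le> (\<bar>r (i - 1)\<bar> + 1) * ?b" using False by (simp add: algebra_simps)
        also have "\<dots> \<le> R * ?b" using R2[of "i - 1"] i False b by (intro mult_right_mono) auto
        finally show ?thesis by (simp add: mult_ac)
      qed
    qed
  qed
  then show ?thesis by blast
qed

lemma state_growth: "i \<le> J \<Longrightarrow> geometric_growth (\<lambda>k. state k i)"
  using state_bound unfolding geometric_growth_def by blast

text \<open>\<open>U m\<close> and \<open>X m i\<close> are the m-th derivatives of u and
  x_i.\<close>

definition U :: "nat \<Rightarrow> real \<Rightarrow> real^'n^'n" where "U m = egf (\<lambda>k. state (m + k) 0)"
definition X :: "nat \<Rightarrow> nat \<Rightarrow> real \<Rightarrow> real^'n^'n" where "X m i = egf (\<lambda>k. state (m + k) (Suc i))"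

lemma U_sums: "(\<lambda>k. (t ^ k / fact k) *\<^sub>R state (m + k) 0) sums U m t"
  unfolding U_def by (rule egf_sums[OF geometric_growth_shift[OF state_growth]]) simp

lemma X_sums: "i < J \<Longrightarrow> (\<lambda>k. (t ^ k / fact k) *\<^sub>R state (m + k) (Suc i)) sums X m i t"
  unfolding X_def by (rule egf_sums[OF geometric_growth_shift[OF state_growth]]) simp

lemma U_deriv: "(U m has_vector_derivative U (Suc m) t) (at t)"
  using egf_derivative[OF geometric_growth_shift[OF state_growth[of 0]], of m t] by (simp add: U_def)

lemma X_deriv: "i < J \<Longrightarrow> (X m i has_vector_derivative X (Suc m) i t) (at t)"
  using egf_derivative[OF geometric_growth_shift[OF state_growth[of "Suc i"]], of m t] by (simp add: X_def)

lemma X_Suc: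
  assumes "i < J" shows "X (Suc m) i t = U m t - r i *\<^sub>R X m i t"
proof (rule sums_unique2[OF X_sums[OF assms]])
  have "(\<lambda>k. (t ^ k / fact k) *\<^sub>R state (m + k) 0 - r i *\<^sub>R ((t ^ k / fact k) *\<^sub>R state (m + k) (Suc i))) sums (U m t - r i *\<^sub>R X m i t)"
    by (intro sums_diff sums_scaleR_right U_sums X_sums assms)
  then show "(\<lambda>k. (t ^ k / fact k) *\<^sub>R state (Suc m + k) (Suc i)) sums (U m t - r i *\<^sub>R X m i t)"
    by (simp add: scaleR_diff_right mult.commute)
qed

lemma U_Suc: "U (Suc m) t = Ninv ** (\<Sum>j<J. A j ** (r j *\<^sub>R X m j t - U m t))"
proof (rule sums_unique2[OF U_sums])
  have "(\<lambda>k. Ninv ** (\<Sum>j<J. A j ** (r j *\<^sub>R ((t ^ k / fact k) *\<^sub>R state (m + k) (Suc j)) - (t ^ k / fact k) *\<^sub>R state (m + k) 0)))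
     sums (Ninv ** (\<Sum>j<J. A j ** (r j *\<^sub>R X m j t - U m t)))"
    by (intro bounded_linear.sums[OF bounded_linear_matrix_mult] sums_sum sums_diff sums_scaleR_right U_sums X_sums) auto
  moreover have "Ninv ** (\<Sum>j<J. A j ** (r j *\<^sub>R ((t ^ k / fact k) *\<^sub>R state (m + k) (Suc j)) - (t ^ k / fact k) *\<^sub>R state (m + k) 0))
     = (t ^ k / fact k) *\<^sub>R state (Suc m + k) 0" for k
  proof -
    let ?c = "t ^ k / fact k"
    have s: "M ** (?c *\<^sub>R Y) = ?c *\<^sub>R (M ** Y)" for M Y :: "real^'n^'n"
      using linear_scale[OF bounded_linear.linear[OF bounded_linear_matrix_mult]] .
    have "r j *\<^sub>R (?c *\<^sub>R state (m + k) (Suc j)) - ?c *\<^sub>R state (m + k) 0 = ?c *\<^sub>R (r j *\<^sub>R state (m + k) (Suc j) - state (m + k) 0)" for j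
      by (simp add: scaleR_diff_right mult.commute)
    then show ?thesis by (simp add: s scaleR_sum_right[symmetric])
  qed
  ultimately show "(\<lambda>k. (t ^ k / fact k) *\<^sub>R state (Suc m + k) 0) sums (Ninv ** (\<Sum>j<J. A j ** (r j *\<^sub>R X m j t - U m t)))"
    by simp
qed

lemma U_0: "U 0 0 = Ninv" and X_0: "X 0 i 0 = 0"
  by (simp_all add: U_def X_def egf_0)

text \<open>Writing the system as z' = M z, this pairs the a-th derivative at time \<open>t\<close>,
  started from \<open>v\<close>, with the b-th derivative at time \<open>s\<close>, started from
  \<open>w\<close>. The weights \<open>N\<close> and \<open>r i * A i\<close> are those for which M
  is self-adjoint.\<close>

definition energy :: "nat \<Rightarrow> nat \<Rightarrow> real \<Rightarrow> real \<Rightarrow> real^'n \<Rightarrow> real^'n \<Rightarrow> real" where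
  "energy a b t s v w = (N *v (U a t *v v)) \<bullet> (U b s *v w)
     + (\<Sum>i<J. r i * ((A i *v (X a i t *v v)) \<bullet> (X b i s *v w)))"

lemma energy_commute: "energy a b t s v w = energy b a s t w v"
proof -
  have 1: "(N *v (U a t *v v)) \<bullet> (U b s *v w) = (N *v (U b s *v w)) \<bullet> (U a t *v v)"
    by (rule symmetric_inner_commute[OF N_sym])
  have 2: "(A i *v (X a i t *v v)) \<bullet> (X b i s *v w) = (A i *v (X b i s *v w)) \<bullet> (X a i t *v v)" if "i < J" for i
    by (rule symmetric_inner_commute[OF A_sym[OF that]])
  show ?thesis unfolding energy_def 1 by (simp add: 2)
qed

text \<open>The decisive computation: pairing M z with another state gives an expression that is
  visibly symmetric in the two states and non-positive when they coincide. Substituting the equation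
  for \<open>N u'\<close> and combining it with the memory part completes the second factor to a
  derivative of x_i.\<close>

lemma energy_Suc: "energy (Suc a) b t s v w = - (\<Sum>i<J. (A i *v (X (Suc a) i t *v v)) \<bullet> (X (Suc b) i s *v w))"
proof -
  have NU: "N *v (U (Suc a) t *v v) = (\<Sum>i<J. - (A i *v (X (Suc a) i t *v v)))"
  proof -
    have "N *v (U (Suc a) t *v v) = (N ** Ninv) *v ((\<Sum>j<J. A j ** (r j *\<^sub>R X a j t - U a t)) *v v)"
      by (simp add: U_Suc matrix_vector_mul_assoc matrix_mul_assoc)
    also have "\<dots> = (\<Sum>j<J. (A j ** (r j *\<^sub>R X a j t - U a t)) *v v)"
      by (simp add: N_inv linear_sum[OF bounded_linear.linear[OF bounded_linear_matrix_vector]])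
    also have "\<dots> = (\<Sum>i<J. - (A i *v (X (Suc a) i t *v v)))"
    proof (rule sum.cong[OF refl])
      fix j assume "j \<in> {..<J}"
      then have "r j *\<^sub>R X a j t - U a t = - X (Suc a) j t" using X_Suc by simp
      then show "(A j ** (r j *\<^sub>R X a j t - U a t)) *v v = - (A j *v (X (Suc a) j t *v v))"
        by (simp add: matrix_vector_mul_assoc[symmetric] linear_neg[OF bounded_linear.linear[OF bounded_linear_matrix_vector]]
            linear_neg[OF matrix_vector_mul_linear])
    qed
    finally show ?thesis .
  qed
  show ?thesis unfolding energy_def NU inner_sum_left sum.distrib[symmetric] sum_negf[symmetric]
  proof (rule sum.cong[OF refl])
    fix i assume i: "i \<in> {..<J}"
    let ?z = "A i *v (X (Suc a) i t *v v)"
    have "X (Suc b) i s *v w = U b s *v w - r i *\<^sub>R (X b i s *v w)"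
      using i by (simp add: X_Suc matrix_vector_mult_diff_rdistrib scaleR_matrix_vector_assoc)
    then show "- ?z \<bullet> (U b s *v w) + r i * (?z \<bullet> (X b i s *v w)) = - (?z \<bullet> (X (Suc b) i s *v w))"
      by (simp add: inner_diff_right)
  qed
qed

text \<open>Self-adjointness of M: a derivative moves from one slot to the other.\<close>

lemma energy_shift: "energy (Suc a) b t s v w = energy a (Suc b) t s v w"
proof -
  have "energy a (Suc b) t s v w = - (\<Sum>i<J. (A i *v (X (Suc b) i s *v w)) \<bullet> (X (Suc a) i t *v v))"
    unfolding energy_commute[of a "Suc b"] energy_Suc ..
  also have "\<dots> = energy (Suc a) b t s v w"
    unfolding energy_Suc by (auto intro!: sum.cong symmetric_inner_commute A_sym)
  finally show ?thesis ..
qed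

lemma energy_sum: "energy a b t s v w = energy 0 (a + b) t s v w"
  by (induction a arbitrary: b) (auto simp: energy_shift)

text \<open>Along x and t + s - x the derivative of the pairing is the difference of the two sides
  of \<open>energy_shift\<close>, so time moves between the slots as well.\<close>

lemma energy_const: "energy a b t s v w = energy a b 0 (t + s) v w"
proof -
  let ?f = "\<lambda>x. energy a b x (t + s - x) v w"
  have "(?f has_real_derivative 0) (at x)" for x
  proof -
    have u: "((\<lambda>x. N *v (U a x *v v)) has_vector_derivative N *v (U (Suc a) x *v v)) (at x)"
      by (intro bounded_linear.has_vector_derivative[OF matrix_vector_mul_bounded_linear]
          bounded_linear.has_vector_derivative[OF bounded_linear_matrix_vector] U_deriv)
    have m: "((\<lambda>x. t + s - x) has_real_derivative -1) (at x)" by (auto intro!: derivative_eq_intros)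
    have u': "((\<lambda>x. U b (t + s - x) *v w) has_vector_derivative (- U (Suc b) (t + s - x)) *v w) (at x)"
      using vector_diff_chain_at[OF m[THEN has_real_derivative_iff_has_vector_derivative[THEN iffD1]] U_deriv[of b "t + s - x"]]
      by (intro bounded_linear.has_vector_derivative[OF bounded_linear_matrix_vector]) (simp add: o_def)
    have y: "((\<lambda>x. A i *v (X a i x *v v)) has_vector_derivative A i *v (X (Suc a) i x *v v)) (at x)" if "i < J" for i
      by (intro bounded_linear.has_vector_derivative[OF matrix_vector_mul_bounded_linear]
          bounded_linear.has_vector_derivative[OF bounded_linear_matrix_vector] X_deriv that)
    have y': "((\<lambda>x. X b i (t + s - x) *v w) has_vector_derivative (- X (Suc b) i (t + s - x)) *v w) (at x)" if "i < J" for i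
      using vector_diff_chain_at[OF m[THEN has_real_derivative_iff_has_vector_derivative[THEN iffD1]] X_deriv[OF that, of b "t + s - x"]]
      by (intro bounded_linear.has_vector_derivative[OF bounded_linear_matrix_vector]) (simp add: o_def)
    have n: "(- M) *v z = - (M *v z)" for M :: "real^'n^'n" and z
      using linear_neg[OF bounded_linear.linear[OF bounded_linear_matrix_vector]] .
    have "(?f has_vector_derivative
       ((N *v (U a x *v v)) \<bullet> ((- U (Suc b) (t + s - x)) *v w) + (N *v (U (Suc a) x *v v)) \<bullet> (U b (t + s - x) *v w))
       + (\<Sum>i<J. r i * ((A i *v (X a i x *v v)) \<bullet> ((- X (Suc b) i (t + s - x)) *v w) + (A i *v (X (Suc a) i x *v v)) \<bullet> (X b i (t + s - x) *v w)))) (at x)"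
      unfolding energy_def
      by (intro has_vector_derivative_add has_vector_derivative_sum has_vector_derivative_mult_right
          bounded_bilinear.has_vector_derivative[OF bounded_bilinear_inner] u u' y y') auto
    also have "((N *v (U a x *v v)) \<bullet> ((- U (Suc b) (t + s - x)) *v w) + (N *v (U (Suc a) x *v v)) \<bullet> (U b (t + s - x) *v w))
       + (\<Sum>i<J. r i * ((A i *v (X a i x *v v)) \<bullet> ((- X (Suc b) i (t + s - x)) *v w) + (A i *v (X (Suc a) i x *v v)) \<bullet> (X b i (t + s - x) *v w)))
       = energy (Suc a) b x (t + s - x) v w - energy a (Suc b) x (t + s - x) v w"
      unfolding energy_def n by (simp add: distrib_left sum.distrib sum_subtractf right_diff_distrib sum_negf)
    also have "\<dots> = 0" by (simp add: energy_shift)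
    finally show ?thesis by (simp add: has_real_derivative_iff_has_vector_derivative)
  qed
  then have "?f t = ?f 0" by (intro DERIV_isconst_all allI)
  then show ?thesis by simp
qed

text \<open>With everything moved to one slot, the other holds the initial state: its memory is 0
  and \<open>N ** Ninv\<close> is the identity, so the pairing reads off \<open>U\<close>.\<close>

lemma energy_eq: "energy a b t s v w = v \<bullet> (U (a + b) (t + s) *v w)"
  unfolding energy_sum[of a b] energy_const[of 0 "a + b" t s]
  by (simp add: energy_def U_0 X_0 matrix_vector_mul_assoc N_inv)

lemma U_symmetric: "transpose (U m t) = U m t"
proof -
  have "v \<bullet> (U m t *v w) = w \<bullet> (U m t *v v)" for v w
    using energy_eq[of 0 m 0 t v w] energy_eq[of m 0 t 0 w v] energy_commute[of 0 m 0 t v w] by simp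
  then have "axis i 1 \<bullet> (U m t *v axis j 1) = axis j 1 \<bullet> (U m t *v axis i 1)" for i j by blast
  then have "U m t $ i $ j = U m t $ j $ i" for i j
    by (simp add: inner_axis' matrix_vector_mul_component inner_axis)
  then show ?thesis by (simp add: transpose_def vec_eq_iff)
qed

text \<open>Half of the time and half of the derivatives go to each slot. An even order leaves the
  energy of a single state; an odd order leaves one extra derivative, and \<open>energy_Suc\<close>
  makes the sign negative.\<close>

lemma U_completely_monotone: "(-1) ^ m * (v \<bullet> (U m t *v v)) \<ge> 0"
proof (cases "even m")
  case True
  then obtain a where a: "m = a + a" by (metis evenE mult_2)
  have "v \<bullet> (U m t *v v) = energy a a (t/2) (t/2) v v" by (simp add: energy_eq a)
  also have "\<dots> \<ge> 0"
    unfolding energy_def using N_psd A_psd r_nonneg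
    by (auto intro!: add_nonneg_nonneg sum_nonneg simp: inner_commute)
  finally show ?thesis using True by simp
next
  case False
  then obtain a where a: "m = Suc a + a" by (metis oddE add_Suc mult_2 Suc_eq_plus1)
  have "v \<bullet> (U m t *v v) = energy (Suc a) a (t/2) (t/2) v v" by (simp add: energy_eq a)
  also have "\<dots> \<le> 0"
    unfolding energy_Suc using A_psd
    by (auto intro!: sum_nonneg simp: inner_commute)
  finally show ?thesis using False by simp
qed

text \<open>The primitives of \<open>U 0\<close> and \<open>X 0 i\<close> vanishing at 0.
  \<open>Y i\<close> is the convolution of \<open>C\<close> with exp(-r i t), as shown in
  \<open>Y_eq\<close>.\<close>

definition C :: "real \<Rightarrow> real^'n^'n" where "C = egf (\<lambda>k. case k of 0 \<Rightarrow> 0 | Suc k \<Rightarrow> state k 0)"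
definition Y :: "nat \<Rightarrow> real \<Rightarrow> real^'n^'n" where "Y i = egf (\<lambda>k. case k of 0 \<Rightarrow> 0 | Suc k \<Rightarrow> state k (Suc i))"

lemma C_deriv: "(C has_vector_derivative U 0 t) (at t)"
  unfolding C_def U_def using egf_derivative[OF geometric_growth_case[OF state_growth[of 0]], of 0 t] by simp

lemma Y_deriv: "i < J \<Longrightarrow> (Y i has_vector_derivative X 0 i t) (at t)"
  unfolding Y_def X_def using egf_derivative[OF geometric_growth_case[OF state_growth[of "Suc i"]], of 0 t] by simp

lemma C_0: "C 0 = 0" and Y_0: "Y i 0 = 0"
  by (simp_all add: C_def Y_def egf_0)

lemma constant_derivative_zero:
  fixes f :: "real \<Rightarrow> 'a::euclidean_space"
  assumes "\<And>t. (f has_vector_derivative 0) (at t)"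
  shows "f t = f 0"
  using has_derivative_zero_unique[of UNIV f 0 t] assms by (simp add: has_vector_derivative_def)

lemma X_eq:
  assumes i: "i < J" shows "X 0 i t = C t - r i *\<^sub>R Y i t"
proof -
  let ?f = "\<lambda>t. X 0 i t - (C t - r i *\<^sub>R Y i t)"
  have "(?f has_vector_derivative X (Suc 0) i t - (U 0 t - r i *\<^sub>R X 0 i t)) (at t)" for t
    by (intro has_vector_derivative_diff X_deriv[OF i] C_deriv
        bounded_linear.has_vector_derivative[OF bounded_linear_scaleR_right] Y_deriv[OF i])
  then have "(?f has_vector_derivative 0) (at t)" for t by (simp add: X_Suc[OF i])
  from constant_derivative_zero[OF this, of t] show ?thesis by (simp add: X_0 Y_0 C_0 i)
qed

text \<open>Integrating factor: the derivative of \<open>Y i\<close> is \<open>C\<close> minus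
  \<open>r i\<close> times \<open>Y i\<close>.\<close>

lemma Y_eq:
  assumes i: "i < J" and t: "0 \<le> t"
  shows "((\<lambda>s. exp (- r i * (t - s)) *\<^sub>R C s) has_integral Y i t) {0..t}"
proof -
  have "((\<lambda>s. exp (- r i * (t - s)) *\<^sub>R C s) has_integral
    (exp (- r i * (t - t)) *\<^sub>R Y i t - exp (- r i * (t - 0)) *\<^sub>R Y i 0)) {0..t}"
  proof (rule fundamental_theorem_of_calculus[OF t])
    fix s
    have "((\<lambda>s. exp (- r i * (t - s)) *\<^sub>R Y i s) has_vector_derivative
      exp (- r i * (t - s)) *\<^sub>R X 0 i s + (r i * exp (- r i * (t - s))) *\<^sub>R Y i s) (at s within {0..t})"
      by (rule has_vector_derivative_scaleR) (auto intro!: derivative_eq_intros has_vector_derivative_at_within[OF Y_deriv[OF i]])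
    then show "((\<lambda>s. exp (- r i * (t - s)) *\<^sub>R Y i s) has_vector_derivative exp (- r i * (t - s)) *\<^sub>R C s) (at s within {0..t})"
      by (simp add: X_eq[OF i] scaleR_diff_right mult.commute)
  qed
  then show ?thesis by (simp add: Y_0 i)
qed

text \<open>The system says that \<open>N ** U 0\<close> plus the sum of the
  \<open>A i ** X 0 i\<close> is constant, and its initial value is the identity; one more
  integration gives \<open>t\<close> times the identity.\<close>

lemma C_equation: "N ** C t + (\<Sum>i<J. A i ** Y i t) = t *\<^sub>R mat 1"
proof -
  have mm: "((\<lambda>t. M ** f t) has_vector_derivative M ** f') (at t)"
    if "(f has_vector_derivative f') (at t)" for M :: "real^'n^'n" and f :: "real \<Rightarrow> real^'n^'n" and f' t
    using bounded_linear.has_vector_derivative[OF bounded_linear_matrix_mult that] .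
  have NU: "N ** U (Suc 0) t + (\<Sum>i<J. A i ** X (Suc 0) i t) = 0" for t
  proof -
    have "N ** U (Suc 0) t = (\<Sum>j<J. A j ** (r j *\<^sub>R X 0 j t - U 0 t))"
      by (simp add: U_Suc matrix_mul_assoc N_inv)
    also have "\<dots> = (\<Sum>j<J. - (A j ** X (Suc 0) j t))"
      by (rule sum.cong) (auto simp: X_Suc linear_neg[OF bounded_linear.linear[OF bounded_linear_matrix_mult], symmetric])
    finally show ?thesis by (simp add: sum_negf)
  qed
  have "((\<lambda>t. N ** U 0 t + (\<Sum>i<J. A i ** X 0 i t)) has_vector_derivative 0) (at t)" for t
    unfolding NU[of t, symmetric]
    by (intro has_vector_derivative_add has_vector_derivative_sum mm U_deriv X_deriv) auto
  from constant_derivative_zero[OF this] have 1: "N ** U 0 t + (\<Sum>i<J. A i ** X 0 i t) = mat 1" for t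
    by (auto simp: U_0 X_0 N_inv linear_0[OF bounded_linear.linear[OF bounded_linear_matrix_mult]])
  have "((\<lambda>t. N ** C t + (\<Sum>i<J. A i ** Y i t) - t *\<^sub>R mat 1) has_vector_derivative
      (N ** U 0 t + (\<Sum>i<J. A i ** X 0 i t) - 1 *\<^sub>R mat 1)) (at t)" for t
    by (intro has_vector_derivative_diff has_vector_derivative_add has_vector_derivative_sum mm C_deriv Y_deriv
          bounded_linear.has_vector_derivative[OF bounded_linear_scaleR_left] has_vector_derivative_id) auto
  then have "((\<lambda>t. N ** C t + (\<Sum>i<J. A i ** Y i t) - t *\<^sub>R mat 1) has_vector_derivative 0) (at t)" for t
    by (simp add: 1)
  from constant_derivative_zero[OF this, of t] show ?thesis
    by (auto simp: C_0 Y_0 linear_0[OF bounded_linear.linear[OF bounded_linear_matrix_mult]])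
qed

end

section \<open>Quadratic forms\<close>

definition form :: "real^'n^'n \<Rightarrow> real^'n \<Rightarrow> real" where
  "form A v = v \<bullet> (A *v v)"

definition psd_matrix :: "real^'n^'n \<Rightarrow> bool" where
  "psd_matrix A \<longleftrightarrow> transpose A = A \<and> (\<forall>v. 0 \<le> form A v)"

lemma symmetric_component: "transpose A = A \<Longrightarrow> A $ i $ j = A $ j $ i"
  by (metis transpose_def vec_lambda_beta)

lemma form_expand: "form A v = (\<Sum>i\<in>UNIV. \<Sum>j\<in>UNIV. v $ i * v $ j * A $ i $ j)"
  by (simp add: form_def inner_vec_def matrix_vector_mult_def sum_distrib_left mult_ac)

lemma form_add: "form (A + B) v = form A v + form B v"
  and form_diff: "form (A - B) v = form A v - form B v"
  and form_scaleR: "form (c *\<^sub>R A) v = c * form A v"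
  by (simp_all add: form_expand algebra_simps sum.distrib sum_subtractf sum_distrib_left)

lemma form_sum: "form (\<Sum>i\<in>I. A i) v = (\<Sum>i\<in>I. form (A i) v)"
  by (induction I rule: infinite_finite_induct) (simp_all add: form_add, simp_all add: form_expand)

lemma form_mat: "form (mat c) v = c * (norm v)\<^sup>2"
proof -
  have "mat c *v v = c *\<^sub>R v" by (simp add: vec_eq_iff matrix_vector_mult_def mat_def if_distrib[where f="\<lambda>x. x * _"] cong: if_cong)
  then show ?thesis by (simp add: form_def power2_norm_eq_inner)
qed

lemma form_scale_vector: "form A (c *\<^sub>R v) = c\<^sup>2 * form A v"
  by (simp add: form_expand sum_distrib_left power2_eq_square mult_ac)

lemma form_axis: "form A (axis i 1) = A $ i $ i"
  by (simp add: form_def inner_axis' matrix_vector_mul_component inner_axis)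

lemma form_plus:
  assumes "transpose A = A"
  shows "form A (v + w) = form A v + form A w + 2 * (v \<bullet> (A *v w))"
  using symmetric_inner_commute[OF assms, of v w]
  by (simp add: form_def matrix_vector_right_distrib inner_add_left inner_add_right inner_commute)

lemma inner_axis_axis: "axis i 1 \<bullet> (A *v axis j 1) = A $ i $ (j::'n::finite)" for A :: "real^'n^'m"
  by (simp add: inner_axis' matrix_vector_mul_component inner_axis)

lemma form_axis_sum:
  assumes "transpose A = A"
  shows "form A (axis i 1 + axis j 1) = A $ i $ i + A $ j $ j + 2 * A $ i $ j"
  by (simp add: form_plus[OF assms] form_axis inner_axis_axis)

lemma form_le_norm: "\<bar>form A v\<bar> \<le> (\<Sum>i\<in>UNIV. \<Sum>j\<in>UNIV. \<bar>A $ i $ j\<bar>) * (norm v)\<^sup>2"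
proof -
  have "\<bar>v $ i * v $ j * A $ i $ j\<bar> \<le> \<bar>A $ i $ j\<bar> * (norm v)\<^sup>2" for i j
  proof -
    have "\<bar>v $ i\<bar> * \<bar>v $ j\<bar> \<le> norm v * norm v" by (intro mult_mono component_le_norm_cart) auto
    from mult_left_mono[OF this, of "\<bar>A $ i $ j\<bar>"] show ?thesis by (simp add: abs_mult power2_eq_square mult_ac)
  qed
  then have "(\<Sum>i\<in>UNIV. \<Sum>j\<in>UNIV. \<bar>v $ i * v $ j * A $ i $ j\<bar>) \<le> (\<Sum>i\<in>UNIV. \<Sum>j\<in>UNIV. \<bar>A $ i $ j\<bar> * (norm v)\<^sup>2)"
    by (intro sum_mono)
  moreover have "\<bar>form A v\<bar> \<le> (\<Sum>i\<in>UNIV. \<Sum>j\<in>UNIV. \<bar>v $ i * v $ j * A $ i $ j\<bar>)"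
    unfolding form_expand by (rule order_trans[OF sum_abs sum_mono[OF sum_abs]])
  ultimately show ?thesis by (simp add: sum_distrib_right)
qed

text \<open>Polarisation recovers a symmetric matrix from its quadratic form. It is defined for an
  arbitrary \<open>q\<close>, so that limits and derivatives of forms can be polarised before they
  are known to be quadratic.\<close>

definition polar :: "(real^'n \<Rightarrow> real) \<Rightarrow> real^'n^'n" where
  "polar q = (\<chi> i j. (q (axis i 1 + axis j 1) - q (axis i 1) - q (axis j 1)) / 2)"

lemma polar_symmetric: "transpose (polar q) = polar q"
  by (simp add: polar_def transpose_def vec_eq_iff add.commute)

lemma polar_form: "transpose A = A \<Longrightarrow> polar (form A) = A"
  by (simp add: polar_def vec_eq_iff form_axis_sum form_axis)

text \<open>The entries of a symmetric matrix are linear combinations of values of its form, so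
  pointwise convergence of the forms is convergence of the matrices.\<close>

lemma symmetric_tendsto_polar:
  assumes "\<And>v. ((\<lambda>n. form (A n) v) \<longlongrightarrow> q v) F" "\<And>n. transpose (A n) = A n"
  shows "(A \<longlongrightarrow> polar q) F"
proof (intro vec_tendstoI)
  fix i j
  have "((\<lambda>n. polar (form (A n)) $ i $ j) \<longlongrightarrow> polar q $ i $ j) F"
    unfolding polar_def by (simp, intro tendsto_intros assms(1)) auto
  then show "((\<lambda>n. A n $ i $ j) \<longlongrightarrow> polar q $ i $ j) F"
    by (simp add: polar_form[OF assms(2)])
qed

lemma tendsto_form: "(A \<longlongrightarrow> B) F \<Longrightarrow> ((\<lambda>n. form (A n) v) \<longlongrightarrow> form B v) F"
  unfolding form_expand by (intro tendsto_intros)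

lemma form_polar_limit:
  assumes "\<And>v. ((\<lambda>n. form (A n) v) \<longlongrightarrow> q v) F" "\<And>n. transpose (A n) = A n" "F \<noteq> bot"
  shows "form (polar q) v = q v"
  by (rule tendsto_unique[OF assms(3) tendsto_form[OF symmetric_tendsto_polar[OF assms(1,2)]] assms(1)])

lemma psd_diag: "psd_matrix A \<Longrightarrow> 0 \<le> A $ i $ i"
  using form_axis[of A i] by (metis psd_matrix_def)

lemma psd_entry_le_diag:
  assumes "psd_matrix A"
  shows "\<bar>A $ i $ j\<bar> \<le> (A $ i $ i + A $ j $ j) / 2"
proof -
  have s: "transpose A = A" and p: "\<And>v. 0 \<le> form A v" using assms by (auto simp: psd_matrix_def)
  have "form A (axis i 1 + - axis j 1) = A $ i $ i + A $ j $ j - 2 * A $ i $ j"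
    using form_plus[OF s, of "axis i 1" "- axis j 1"] form_scale_vector[of A "-1" "axis j 1"]
    by (simp add: form_axis inner_axis_axis linear_neg[OF matrix_vector_mul_linear])
  with p[of "axis i 1 + - axis j 1"] p[of "axis i 1 + axis j 1"] show ?thesis
    by (simp add: form_axis_sum[OF s] abs_le_iff)
qed

text \<open>One scalar bound, on the trace, thus controls the whole matrix; all a priori estimates
  below are trace estimates.\<close>

lemma psd_entry_le_trace:
  assumes "psd_matrix A"
  shows "\<bar>A $ i $ j\<bar> \<le> trace A"
proof -
  have "A $ k $ k \<le> trace A" for k
    unfolding trace_def by (rule member_le_sum) (auto simp: psd_diag[OF assms])
  from this[of i] this[of j] psd_entry_le_diag[OF assms, of i j] show ?thesis by simp
qed

lemma trace_nonneg: "psd_matrix A \<Longrightarrow> 0 \<le> trace A"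
  unfolding trace_def by (intro sum_nonneg psd_diag)

text \<open>Each elimination step splits off a rank-one summand \<open>q q\<^sup>T / Q\<^sub>i\<^sub>i\<close> and clears the \<open>i\<close>-th row.\<close>

lemma trace_product_nonneg:
  assumes P: "psd_matrix P" and Q: "psd_matrix Q"
  shows "0 \<le> trace (P ** Q)"
  using Q
proof (induction "card {i. Q $ i $ i \<noteq> 0}" arbitrary: Q rule: less_induct)
  case less
  have s: "transpose Q = Q" and p: "\<And>v. 0 \<le> form Q v" using less.prems by (auto simp: psd_matrix_def)
  show ?case
  proof (cases "\<exists>i. Q $ i $ i \<noteq> 0")
    case False
    then have "Q = 0" using psd_entry_le_diag[OF less.prems] by (simp add: vec_eq_iff)
    then show ?thesis by (simp add: trace_def matrix_matrix_mult_def)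
  next
    case True
    then obtain i where "Q $ i $ i \<noteq> 0" by blast
    then have d: "Q $ i $ i > 0" using psd_diag[OF less.prems, of i] by simp
    define q where "q = Q *v axis i 1"
    define R where "R = (\<chi> j k. Q $ j $ k - q $ j * q $ k / Q $ i $ i)"
    have q: "q $ j = Q $ j $ i" for j by (simp add: q_def matrix_vector_mul_component inner_axis)
    have Rform: "form R x = form Q x - (x \<bullet> q)\<^sup>2 / Q $ i $ i" for x
    proof -
      have "(\<Sum>j\<in>UNIV. \<Sum>k\<in>UNIV. x $ j * x $ k * (q $ j * q $ k / Q $ i $ i)) = (x \<bullet> q)\<^sup>2 / Q $ i $ i"
        by (simp add: inner_vec_def power2_eq_square sum_product sum_divide_distrib mult_ac)
      then show ?thesis by (simp add: form_expand R_def right_diff_distrib sum_subtractf)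
    qed
    have Rp: "0 \<le> form R x" for x
    proof -
      \<comment> \<open>Completing the square: this \<open>c\<close> minimises the form of
        \<open>Q\<close> along the i-th axis, and the minimum is the form of
        \<open>R\<close>.\<close>
      define c where "c = - (x \<bullet> q) / Q $ i $ i"
      have "form Q (x + c *\<^sub>R axis i 1) = form Q x + c\<^sup>2 * Q $ i $ i + 2 * (c * (x \<bullet> q))"
        by (simp add: form_plus[OF s] form_scale_vector form_axis matrix_vector_mult_scaleR q_def)
      also have "\<dots> = form R x" using d by (simp add: c_def Rform field_simps power2_eq_square)
      finally show ?thesis using p by metis
    qed
    have R: "psd_matrix R"
      using Rp s symmetric_component[OF s] by (simp add: psd_matrix_def transpose_def R_def vec_eq_iff mult.commute)
    \<comment> \<open>Termination: diagonal entries do not increase and stay non-negative, so zeros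
      persist, and the i-th entry becomes a new zero.\<close>
    have "{j. R $ j $ j \<noteq> 0} \<subset> {j. Q $ j $ j \<noteq> 0}"
    proof (rule psubsetI)
      have "R $ j $ j = 0" if "Q $ j $ j = 0" for j
      proof -
        have "0 \<le> q $ j * q $ j / Q $ i $ i" using d by simp
        moreover have "R $ j $ j = - (q $ j * q $ j / Q $ i $ i)" using that by (simp add: R_def)
        ultimately show ?thesis using psd_diag[OF R, of j] by linarith
      qed
      then show "{j. R $ j $ j \<noteq> 0} \<subseteq> {j. Q $ j $ j \<noteq> 0}" by blast
      have "R $ i $ i = 0" using d by (simp add: R_def q)
      then have "i \<notin> {j. R $ j $ j \<noteq> 0}" by simp
      moreover have "i \<in> {j. Q $ j $ j \<noteq> 0}" using d by simp
      ultimately show "{j. R $ j $ j \<noteq> 0} \<noteq> {j. Q $ j $ j \<noteq> 0}" by metis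
    qed
    then have "card {j. R $ j $ j \<noteq> 0} < card {j. Q $ j $ j \<noteq> 0}" by (intro psubset_card_mono) auto
    from less.hyps[OF this R] have 1: "0 \<le> trace (P ** R)" .
    have "trace (P ** Q) = trace (P ** R) + form P q / Q $ i $ i"
    proof -
      have "(\<Sum>k\<in>UNIV. \<Sum>j\<in>UNIV. P $ k $ j * (q $ j * q $ k / Q $ i $ i)) = form P q / Q $ i $ i"
        by (simp add: form_expand sum_divide_distrib mult_ac)
      then show ?thesis by (simp add: trace_def matrix_matrix_mult_def R_def right_diff_distrib sum_subtractf)
    qed
    then show ?thesis using 1 P d by (simp add: psd_matrix_def)
  qed
qed

lemma trace_product_ge:
  assumes P: "transpose P = P" "\<And>v. c * (norm v)\<^sup>2 \<le> form P v" and Q: "psd_matrix Q"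
  shows "c * trace Q \<le> trace (P ** Q)"
proof -
  have "psd_matrix (P - mat c)"
  proof -
    have "transpose (P - mat c) = P - mat c"
      using symmetric_component[OF P(1)] by (simp add: transpose_def vec_eq_iff mat_def)
    then show ?thesis using P(2) by (simp add: psd_matrix_def form_diff form_mat)
  qed
  from trace_product_nonneg[OF this Q] have "0 \<le> trace ((P - mat c) ** Q)" .
  also have "(P - mat c) ** Q = P ** Q - c *\<^sub>R Q"
    by (simp add: vec_eq_iff matrix_matrix_mult_def mat_def left_diff_distrib sum_subtractf if_distrib[where f="\<lambda>x. x * _"] cong: if_cong)
  finally show ?thesis by (simp add: trace_def sum_subtractf sum_distrib_left)
qed

definition cm_matrix :: "(real \<Rightarrow> real^'n^'n) \<Rightarrow> bool" where
  "cm_matrix K \<longleftrightarrow> (\<forall>t>0. transpose (K t) = K t) \<and> (\<forall>v. completely_monotone (\<lambda>t. form (K t) v))"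

lemma cm_matrix_psd: "cm_matrix K \<Longrightarrow> 0 < t \<Longrightarrow> psd_matrix (K t)"
  using completely_monotone_nonneg unfolding cm_matrix_def psd_matrix_def by blast

lemma cm_matrix_antimono: "cm_matrix K \<Longrightarrow> 0 < s \<Longrightarrow> s \<le> t \<Longrightarrow> form (K t) v \<le> form (K s) v"
  using completely_monotone_antimono[of "\<lambda>t. form (K t) v" s t] by (simp add: cm_matrix_def)

text \<open>Quadratic forms in \<open>v\<close> stay quadratic forms under differentiation in \<open>t\<close>.\<close>

lemma form_polar_deriv:
  assumes sym: "\<And>t. 0 < t \<Longrightarrow> transpose (K t) = K t"
    and diff: "\<And>v n t. 0 < t \<Longrightarrow> (deriv ^^ n) (\<lambda>t. form (K t) v) differentiable (at t)"
    and t: "0 < t"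
  shows "form (polar (\<lambda>v. (deriv ^^ n) (\<lambda>t. form (K t) v) t)) v = (deriv ^^ n) (\<lambda>t. form (K t) v) t"
proof -
  let ?d = "\<lambda>n v. (deriv ^^ n) (\<lambda>t. form (K t) v)"
  let ?D = "\<lambda>n t. form (polar (\<lambda>v. ?d n v t)) v"
  have d: "(?d n v has_real_derivative ?d (Suc n) v t) (at t)" if "0 < t" for n v t
    using diff[OF that] by (simp add: DERIV_deriv_iff_real_differentiable)
  show ?thesis
  proof (rule iterated_deriv_eq(1)[where D="?D", symmetric, OF _ _ t])
    show "?D 0 t = form (K t) v" if "0 < t" for t
      using polar_form[OF sym[OF that]] by simp
    show "(?D n has_real_derivative ?D (Suc n) t) (at t)" if "0 < t" for n t
      unfolding polar_def form_expand[of "\<chi> i j. _ i j"] vec_lambda_beta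
      by (intro DERIV_sum DERIV_cmult DERIV_cdivide DERIV_diff d that)
  qed
qed

text \<open>The coefficients of the scalar approximations for the individual \<open>v\<close> are
  the values of one quadratic form, so they assemble into a positive semi-definite matrix
  coefficient.\<close>

lemma exp_coeff_matrix:
  assumes K: "cm_matrix K" and a: "0 < a"
  shows "\<exists>A. psd_matrix A \<and> (\<forall>v. form A v = exp_coeff (\<lambda>t. form (K t) v) a k)"
proof -
  define A where "A = ((-1) ^ k * a ^ k / fact k) *\<^sub>R polar (\<lambda>v. (deriv ^^ k) (\<lambda>t. form (K t) v) a)"
  have cm: "completely_monotone (\<lambda>t. form (K t) v)" for v using K by (simp add: cm_matrix_def)
  have 1: "form A v = exp_coeff (\<lambda>t. form (K t) v) a k" for v
    unfolding A_def form_scaleR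
    by (subst form_polar_deriv) (use K a cm in \<open>auto simp: cm_matrix_def completely_monotone_def exp_coeff_def\<close>)
  have "transpose A = A" unfolding A_def using polar_symmetric[of "\<lambda>v. (deriv ^^ k) (\<lambda>t. form (K t) v) a"]
    by (simp add: transpose_def vec_eq_iff)
  then show ?thesis using 1 exp_coeff_nonneg[OF cm a] by (auto simp: psd_matrix_def)
qed

text \<open>Each direction comes with its own time. As t decreases to 0 the forms increase, so the
  sets of unit vectors where they are not positive are nested and compact; a common point would be a
  direction in which the form vanishes for all t. Hence one of these sets is empty, and
  \<open>c\<close> is the minimum on the sphere.\<close>

lemma uniformly_positive:
  fixes K :: "real \<Rightarrow> real^'n^'n"
  assumes K: "cm_matrix K" and nd: "\<And>v. v \<noteq> 0 \<Longrightarrow> \<exists>t>0. form (K t) v \<noteq> 0"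
  obtains t c where "0 < t" "0 < c" "\<And>v. c * (norm v)\<^sup>2 \<le> form (K t) v"
proof -
  let ?t = "\<lambda>n. inverse (real (Suc n))"
  let ?S = "\<lambda>n. {v \<in> sphere 0 1. form (K (?t n)) v \<le> 0}"
  have cont: "continuous_on X (form A)" for X and A :: "real^'n^'n"
    unfolding form_expand[abs_def] by (intro continuous_intros)
  have "\<exists>n. ?S n = {}"
  proof (rule ccontr)
    assume ne: "\<nexists>n. ?S n = {}"
    have "\<Inter> (range ?S) \<noteq> {}"
    proof (rule compact_nest)
      show "compact (?S n)" for n
      proof -
        have "closed {v. form (K (?t n)) v \<le> 0}"
          by (rule closed_Collect_le[OF cont continuous_on_const])
        then have "compact (sphere 0 1 \<inter> {v. form (K (?t n)) v \<le> 0})" by (intro compact_Int_closed compact_sphere)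
        then show ?thesis by (simp add: Int_def)
      qed
      show "?S n \<noteq> {}" for n using ne by blast
      show "?S n \<subseteq> ?S m" if "m \<le> n" for m n
      proof -
        have "form (K (?t m)) v \<le> form (K (?t n)) v" for v
          using that by (intro cm_matrix_antimono[OF K]) (auto simp: field_simps)
        then show ?thesis by (auto intro: order_trans)
      qed
    qed
    then obtain v where v: "norm v = 1" "\<And>n. form (K (?t n)) v \<le> 0" by auto
    then have "v \<noteq> 0" by auto
    then obtain t where t: "t > 0" "form (K t) v \<noteq> 0" using nd by blast
    obtain n where n: "?t n < t" using reals_Archimedean[OF t(1)] by blast
    have "form (K t) v \<le> form (K (?t n)) v" using n by (intro cm_matrix_antimono[OF K]) auto
    then have "form (K t) v \<le> 0" using v(2)[of n] by simp
    then show False using cm_matrix_psd[OF K t(1)] t(2) by (auto simp: psd_matrix_def intro: antisym)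
  qed
  then obtain n where n: "?S n = {}" by blast
  let ?A = "K (?t n)"
  have "sphere 0 1 \<noteq> ({} :: (real^'n) set)" by simp
  then obtain w where w: "w \<in> sphere 0 1" "\<And>v. v \<in> sphere 0 1 \<Longrightarrow> form ?A w \<le> form ?A v"
    using continuous_attains_inf[OF compact_sphere _ cont[of "sphere 0 1" ?A]] by blast
  show ?thesis
  proof (rule that)
    show "0 < ?t n" by simp
    show "0 < form ?A w" using n w(1) by (auto simp: not_le[symmetric])
    show "form ?A w * (norm v)\<^sup>2 \<le> form ?A v" for v
    proof (cases "v = 0")
      case False
      then have "form ?A w \<le> form ?A ((1 / norm v) *\<^sub>R v)" by (intro w(2)) simp
      then show ?thesis using False by (simp add: form_scale_vector power_divide field_simps)
    qed (simp add: form_def)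
  qed
qed

section \<open>Existence for completely monotone matrix kernels\<close>

lemma finite_exponential_solution:
  fixes N :: "real^'n^'n" and A :: "nat \<Rightarrow> real^'n^'n" and r :: "nat \<Rightarrow> real"
  assumes N: "transpose N = N" "\<And>v. v \<noteq> 0 \<Longrightarrow> 0 < form N v"
    and A: "\<And>i. psd_matrix (A i)" and r: "\<And>i. 0 \<le> r i"
  shows "\<exists>C. C 0 = 0 \<and> (\<forall>t. transpose (C t) = C t)
     \<and> (\<forall>v. \<exists>g. completely_monotone g \<and> (\<forall>t. 0 \<le> g t \<and> ((\<lambda>t. form (C t) v) has_real_derivative g t) (at t)))
     \<and> (\<forall>t\<ge>0. \<forall>i j. ((\<lambda>s. ((\<Sum>k<J. exp (- r k * (t - s)) *\<^sub>R A k) ** C s) $ i $ j)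
            has_integral (t *\<^sub>R mat 1 - N ** C t) $ i $ j) {0..t})"
proof -
  \<comment> \<open>A positive definite matrix has trivial kernel; this is what the regularised
    \<open>N\<close> is needed for.\<close>
  have "N *v v = 0 \<Longrightarrow> v = 0" for v using N(2)[of v] by (cases "v = 0") (auto simp: form_def)
  then obtain B where "B ** N = mat 1" using matrix_left_invertible_ker[of N] by blast
  then have B: "N ** B = mat 1" using matrix_left_right_inverse by blast
  have psd: "0 \<le> v \<bullet> (N *v v)" for v using N(2)[of v] by (cases "v = 0") (auto simp: form_def)
  interpret E: exponential_system N B A r J
    by unfold_locales (use N(1) B A r psd in \<open>auto simp: psd_matrix_def form_def\<close>)
  have comp: "bounded_linear (\<lambda>M :: real^'n^'n. M $ i $ j)" for i j
    by (simp add: bounded_linear_compose[OF bounded_linear_vec_nth bounded_linear_vec_nth])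
  have sym: "transpose (E.C t) = E.C t" for t
  proof -
    have "E.C t $ i $ j - E.C t $ j $ i = 0" for i j
    proof -
      have "((\<lambda>t. E.C t $ i $ j - E.C t $ j $ i) has_vector_derivative (E.U 0 t $ i $ j - E.U 0 t $ j $ i)) (at t)" for t
        by (intro has_vector_derivative_diff bounded_linear.has_vector_derivative[OF comp] E.C_deriv)
      then have "((\<lambda>t. E.C t $ i $ j - E.C t $ j $ i) has_vector_derivative 0) (at t)" for t
        using symmetric_component[OF E.U_symmetric] by simp
      from E.constant_derivative_zero[OF this, of t] show ?thesis by (simp add: E.C_0)
    qed
    then show ?thesis by (simp add: transpose_def vec_eq_iff)
  qed
  have formb: "bounded_linear (\<lambda>M :: real^'n^'n. form M v)" for v
    unfolding form_def by (intro bounded_linear_compose[OF bounded_linear_inner_right bounded_linear_matrix_vector])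
  have cm: "completely_monotone (\<lambda>t. form (E.U 0 t) v)" for v
  proof (rule completely_monotoneI[where D="\<lambda>m t. form (E.U m t) v"])
    show "((\<lambda>t. form (E.U n t) v) has_real_derivative form (E.U (Suc n) t) v) (at t)" for n t
      unfolding has_real_derivative_iff_has_vector_derivative
      by (intro bounded_linear.has_vector_derivative[OF formb] E.U_deriv)
    show "(-1) ^ n * form (E.U n t) v \<ge> 0" for n t
      using E.U_completely_monotone by (simp add: form_def)
  qed simp
  have d: "((\<lambda>t. form (E.C t) v) has_real_derivative form (E.U 0 t) v) (at t)" for v t
    unfolding has_real_derivative_iff_has_vector_derivative
    by (intro bounded_linear.has_vector_derivative[OF formb] E.C_deriv)
  have pos: "0 \<le> form (E.U 0 t) v" for t v using E.U_completely_monotone[of 0 v t] by (simp add: form_def)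
  have eq: "((\<lambda>s. ((\<Sum>k<J. exp (- r k * (t - s)) *\<^sub>R A k) ** E.C s) $ i $ j)
            has_integral (t *\<^sub>R mat 1 - N ** E.C t) $ i $ j) {0..t}" if "0 \<le> t" for t i j
  proof -
    have "((\<lambda>s. (\<Sum>k<J. A k ** (exp (- r k * (t - s)) *\<^sub>R E.C s)) $ i $ j) has_integral (\<Sum>k<J. A k ** E.Y k t) $ i $ j) {0..t}"
      by (intro has_integral_linear[OF _ comp, unfolded o_def] has_integral_sum
         has_integral_linear[OF _ bounded_linear_matrix_mult, unfolded o_def] E.Y_eq that) auto
    moreover have "(\<Sum>k<J. A k ** (exp (- r k * (t - s)) *\<^sub>R E.C s)) = (\<Sum>k<J. exp (- r k * (t - s)) *\<^sub>R A k) ** E.C s" for s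
      by (simp add: vec_eq_iff matrix_matrix_mult_def sum_distrib_left sum_distrib_right mult_ac) (subst sum.swap, simp)
    moreover have "(\<Sum>k<J. A k ** E.Y k t) = t *\<^sub>R mat 1 - N ** E.C t"
      using E.C_equation[of t] by (simp add: algebra_simps)
    ultimately show ?thesis by (simp only:)
  qed
  show ?thesis
    by (intro exI[of _ E.C] conjI allI impI sym eq E.C_0) (use cm d pos in blast)+
qed

lemma exp_approx_antimono:
  assumes "completely_monotone f" "0 < a" "s \<le> t"
  shows "exp_approx f a m t \<le> exp_approx f a m s"
  unfolding exp_approx_def using assms
  by (intro sum_mono mult_left_mono exp_coeff_nonneg) (auto simp: mult_left_mono divide_right_mono)

lemma exp_approx_nonneg: "completely_monotone f \<Longrightarrow> 0 < a \<Longrightarrow> 0 \<le> exp_approx f a m t"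
  unfolding exp_approx_def by (intro sum_nonneg mult_nonneg_nonneg exp_coeff_nonneg) auto

text \<open>The n-th approximate problem: \<open>L\<close> is the exponential approximation of
  \<open>K\<close> with centre n + 1 and degree (n + 1)^2, and \<open>N\<close> is shifted by I/(n +
  1). The right-hand side is normalised to \<open>t\<close> times the identity, half of that in
  \<open>matrix_equation\<close> below.\<close>

definition is_approximant :: "real^'n^'n \<Rightarrow> (real \<Rightarrow> real^'n^'n) \<Rightarrow> nat \<Rightarrow> (real \<Rightarrow> real^'n^'n) \<Rightarrow> (real \<Rightarrow> real^'n^'n) \<Rightarrow> bool" where
  "is_approximant N K n L C \<longleftrightarrow> (\<forall>t. psd_matrix (L t))
     \<and> (\<forall>t v. form (L t) v = exp_approx (\<lambda>t. form (K t) v) (real (Suc n)) ((Suc n)\<^sup>2) t)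
     \<and> C 0 = 0 \<and> (\<forall>t. transpose (C t) = C t)
     \<and> (\<forall>v. \<exists>g. completely_monotone g \<and> (\<forall>t. 0 \<le> g t \<and> ((\<lambda>t. form (C t) v) has_real_derivative g t) (at t)))
     \<and> (\<forall>t\<ge>0. \<forall>i j. ((\<lambda>s. (L (t - s) ** C s) $ i $ j)
            has_integral (t *\<^sub>R mat 1 - (N + mat (inverse (real (Suc n)))) ** C t) $ i $ j) {0..t})"

lemma approximant_exists:
  fixes N :: "real^'n^'n"
  assumes N: "psd_matrix N" and K: "cm_matrix K"
  shows "\<exists>L C. is_approximant N K n L C"
proof -
  let ?a = "real (Suc n)" let ?N = "N + mat (inverse ?a)"
  have "\<forall>k. \<exists>A. psd_matrix A \<and> (\<forall>v. form A v = exp_coeff (\<lambda>t. form (K t) v) ?a k)"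
    using exp_coeff_matrix[OF K, of ?a] by simp
  from choice[OF this] obtain A where A: "\<And>k. psd_matrix (A k)" "\<And>k v. form (A k) v = exp_coeff (\<lambda>t. form (K t) v) ?a k" by blast
  define L where "L t = (\<Sum>k<Suc ((Suc n)\<^sup>2). exp (- (real k / ?a) * t) *\<^sub>R A k)" for t
  have cm: "completely_monotone (\<lambda>t. form (K t) v)" for v using K by (simp add: cm_matrix_def)
  have Lf: "form (L t) v = exp_approx (\<lambda>t. form (K t) v) ?a ((Suc n)\<^sup>2) t" for t v
    unfolding L_def form_sum form_scaleR A(2) exp_approx_def by (simp only: mult.commute)
  have As: "A k $ i $ j = A k $ j $ i" for i j k using symmetric_component A(1) by (auto simp: psd_matrix_def)
  have Ls: "transpose (L t) = L t" for t
    unfolding L_def by (simp add: transpose_def vec_eq_iff As)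
  have Np: "transpose ?N = ?N"
  proof -
    have "N $ i $ j = N $ j $ i" for i j using N symmetric_component by (auto simp: psd_matrix_def)
    then show ?thesis by (simp add: transpose_def vec_eq_iff mat_def)
  qed
  have Npos: "0 < form ?N v" if "v \<noteq> 0" for v
    using N that by (simp add: form_add form_mat psd_matrix_def add_nonneg_pos)
  from finite_exponential_solution[where A=A and r="\<lambda>k. real k / ?a" and J="Suc ((Suc n)\<^sup>2)", OF Np Npos A(1) divide_nonneg_nonneg[OF of_nat_0_le_iff of_nat_0_le_iff]]
  obtain C where C: "C 0 = 0 \<and> (\<forall>t. transpose (C t) = C t)
     \<and> (\<forall>v. \<exists>g. completely_monotone g \<and> (\<forall>t. 0 \<le> g t \<and> ((\<lambda>t. form (C t) v) has_real_derivative g t) (at t)))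
     \<and> (\<forall>t\<ge>0. \<forall>i j. ((\<lambda>s. (L (t - s) ** C s) $ i $ j) has_integral (t *\<^sub>R mat 1 - ?N ** C t) $ i $ j) {0..t})"
    unfolding L_def[symmetric] by (rule exE)
  have "psd_matrix (L t)" for t using Ls Lf exp_approx_nonneg[OF cm] by (simp add: psd_matrix_def)
  then show ?thesis
    unfolding is_approximant_def by (intro exI[of _ L] exI[of _ C] conjI[OF _ conjI] C allI Lf)
qed

text \<open>The functions \<open>f n\<close> are concave and vanish at \<open>0\<close>, which bounds their slope away from \<open>0\<close>.\<close>

lemma bernstein_limit:
  assumes cm: "\<And>n. completely_monotone (g n)"
    and der: "\<And>n t. (f n has_real_derivative g n t) (at t)"
    and f0: "\<And>n. f n 0 = 0" and bound: "\<And>n t. 0 \<le> t \<Longrightarrow> f n t \<le> B t"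
    and rat: "\<And>q. q \<in> \<rat> \<Longrightarrow> 0 < q \<Longrightarrow> convergent (\<lambda>n. f n q)"
  shows "\<And>t. 0 < t \<Longrightarrow> (\<lambda>n. f n t) \<longlonglongrightarrow> lim (\<lambda>n. f n t)"
    and "bernstein (\<lambda>t. lim (\<lambda>n. f n t))"
proof -
  have mono: "f n s \<le> f n t" if "0 \<le> s" "s \<le> t" for n s t
  proof (rule DERIV_nonneg_imp_increasing_open[OF that(2)])
    show "\<exists>y. (f n has_real_derivative y) (at x) \<and> 0 \<le> y" if "s < x" "x < t" for x
      using der completely_monotone_nonneg[OF cm] that \<open>0 \<le> s\<close> by (metis order_le_less_trans)
    show "continuous_on {s..t} (f n)"
      using der by (meson DERIV_isCont continuous_at_imp_continuous_on)
  qed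
  have nonneg: "0 \<le> f n t" if "0 \<le> t" for n t using mono[of 0 t n] that f0 by simp
  have slope: "g n t \<le> B d / d" if dt: "0 < d" "d \<le> t" for n d t
  proof -
    obtain z where z: "0 < z" "z < d" "f n d - f n 0 = (d - 0) * g n z"
      using MVT2[of 0 d "f n" "g n", OF dt(1) der] by blast
    have "g n t \<le> g n z" using completely_monotone_antimono[OF cm] z that by simp
    then have "d * g n t \<le> d * g n z" using that by simp
    also have "\<dots> \<le> B d" using z(3) f0 bound[of d n] that by simp
    finally show ?thesis using that by (simp add: field_simps)
  qed
  have conv: "convergent (\<lambda>n. f n t)" if t: "0 < t" for t
  proof -
    have "Cauchy (\<lambda>n. f n t)"
    proof (rule metric_CauchyI)
      fix e :: real assume e: "0 < e"
      define K where "K = B t / t"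
      have K: "0 \<le> K" using slope[of t t 0] completely_monotone_nonneg[OF cm, of t 0] t by (simp add: K_def)
      \<comment> \<open>Beyond \<open>t\<close> all slopes are at most \<open>K\<close>, so moving
        to a slightly larger rational \<open>q\<close> changes each \<open>f n\<close> by less than
        e/3, uniformly in \<open>n\<close>.\<close>
      obtain q where q: "q \<in> \<rat>" "t < q" "q < t + e / (3 * (K + 1))"
        using Rats_dense_in_real[of t "t + e / (3 * (K + 1))"] e K by auto
      have qK: "K * (q - t) < e / 3"
      proof -
        have "K * (q - t) \<le> (K + 1) * (q - t)" using q by simp
        also have "\<dots> < (K + 1) * (e / (3 * (K + 1)))" using q K by (intro mult_strict_left_mono) auto
        also have "\<dots> = e / 3" using K by (simp add: divide_simps)
        finally show ?thesis .
      qed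
      have near: "\<bar>f n t - f n q\<bar> < e / 3" for n
      proof -
        obtain z where z: "t < z" "z < q" "f n q - f n t = (q - t) * g n z"
          using MVT2[of t q "f n" "g n", OF q(2) der] by blast
        have "(q - t) * g n z \<le> (q - t) * K" using slope[of t z n] z q t by (intro mult_left_mono) (auto simp: K_def)
        then have "f n q - f n t < e / 3" using z(3) qK by (simp add: mult.commute)
        then show ?thesis using mono[of t q n] t q by simp
      qed
      obtain M where M: "\<And>m n. m \<ge> M \<Longrightarrow> n \<ge> M \<Longrightarrow> dist (f m q) (f n q) < e / 3"
        using metric_CauchyD[OF convergent_Cauchy[OF rat[of q]], of "e / 3"] q e t by auto
      show "\<exists>M. \<forall>m\<ge>M. \<forall>n\<ge>M. dist (f m t) (f n t) < e"
      proof (intro exI allI impI)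
        fix m n assume "m \<ge> M" "n \<ge> M"
        then show "dist (f m t) (f n t) < e" using M[of m n] near[of m] near[of n] unfolding dist_real_def abs_less_iff by linarith
      qed
    qed
    then show ?thesis by (simp add: Cauchy_convergent_iff)
  qed
  then show lim: "\<And>t. 0 < t \<Longrightarrow> (\<lambda>n. f n t) \<longlonglongrightarrow> lim (\<lambda>n. f n t)" by (simp add: convergent_LIMSEQ_iff)
  let ?F = "\<lambda>t. lim (\<lambda>n. f n t)" and ?G = "\<lambda>t. lim (\<lambda>n. g n t)"
  have G: "convergent (\<lambda>n. g n t)" "(?F has_real_derivative ?G t) (at t)" if "0 < t" for t
    using completely_monotone_limit_derivative[of g f ?F t, OF cm der lim that] by auto
  have "completely_monotone ?G"
    by (rule completely_monotone_limit[OF cm]) (use G in \<open>simp add: convergent_LIMSEQ_iff\<close>)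
  then have "completely_monotone (deriv ?F)"
    by (rule completely_monotone_cong) (use G in \<open>auto intro: DERIV_imp_deriv[symmetric]\<close>)
  moreover have "?F t \<ge> 0" if "0 < t" for t
    by (rule LIMSEQ_le_const[OF lim[OF that]]) (use nonneg that in auto)
  ultimately show "bernstein ?F"
    using G by (auto simp: bernstein_def real_differentiable_def)
qed

section \<open>Matrix-valued Bernstein functions and the passage to the limit\<close>

lemma bernstein_deriv:
  assumes "bernstein f" "0 < t"
  shows "(f has_real_derivative deriv f t) (at t)" "0 \<le> deriv f t" "0 \<le> f t"
  using assms completely_monotone_nonneg[of "deriv f" t]
  by (auto simp: bernstein_def DERIV_deriv_iff_real_differentiable)

lemma bernstein_mono:
  assumes "bernstein f" "0 < s" "s \<le> t"
  shows "f s \<le> f t"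
  by (rule DERIV_nonneg_imp_nondecreasing[OF assms(3)])
    (use bernstein_deriv[OF assms(1)] assms(2) in \<open>meson order_less_le_trans\<close>)

lemma bernstein_limit_at_0:
  assumes "bernstein f"
  shows "\<exists>l. (f \<longlongrightarrow> l) (at_right 0)"
proof
  show "(f \<longlongrightarrow> Inf (f ` ({0<..} \<inter> UNIV))) (at_right 0)"
    using Lim_right_bound[of UNIV 0 f 0] bernstein_mono[OF assms] bernstein_deriv(3)[OF assms] by simp
qed

definition matrix_bernstein :: "(real \<Rightarrow> real^'n^'n) \<Rightarrow> bool" where
  "matrix_bernstein C \<longleftrightarrow> (\<forall>t>0. transpose (C t) = C t) \<and> (\<forall>v. bernstein (\<lambda>t. form (C t) v))
     \<and> (C \<longlongrightarrow> C 0) (at_right 0)"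

lemma matrix_bernstein_psd: "matrix_bernstein C \<Longrightarrow> 0 < t \<Longrightarrow> psd_matrix (C t)"
  using bernstein_deriv(3) unfolding matrix_bernstein_def psd_matrix_def by blast

lemma psd_matrix_limit:
  assumes "(C \<longlongrightarrow> A) F" "\<forall>\<^sub>F t in F. psd_matrix (C t)" "F \<noteq> bot"
  shows "psd_matrix A"
proof -
  have "A $ i $ j = A $ j $ i" for i j
  proof (rule tendsto_unique[OF assms(3)])
    show "((\<lambda>t. C t $ i $ j) \<longlongrightarrow> A $ i $ j) F" by (intro tendsto_intros assms)
    have "((\<lambda>t. C t $ j $ i) \<longlongrightarrow> A $ j $ i) F" by (intro tendsto_intros assms)
    then show "((\<lambda>t. C t $ i $ j) \<longlongrightarrow> A $ j $ i) F"
      by (rule Lim_transform_eventually)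
        (use assms(2) in eventually_elim, auto simp: psd_matrix_def intro: symmetric_component)
  qed
  moreover have "0 \<le> form A v" for v
    by (rule tendsto_lowerbound[OF tendsto_form[OF assms(1)] _ assms(3)])
      (use assms(2) in eventually_elim, simp add: psd_matrix_def)
  ultimately show ?thesis by (simp add: psd_matrix_def transpose_def vec_eq_iff)
qed

lemma matrix_bernstein_psd_0: "matrix_bernstein C \<Longrightarrow> psd_matrix (C 0)"
  using psd_matrix_limit[of C "C 0" "at_right 0"] matrix_bernstein_psd[of C]
  by (auto simp: matrix_bernstein_def eventually_at_filter)

lemma continuous_on_half_line:
  fixes f :: "real \<Rightarrow> 'a::topological_space"
  assumes "continuous_on {0<..} f" "(f \<longlongrightarrow> f 0) (at_right 0)"
  shows "continuous_on {0..T} f"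
  unfolding continuous_on_eq_continuous_within
proof
  fix x assume x: "x \<in> {0..T}"
  show "continuous (at x within {0..T}) f"
  proof (cases "x = 0")
    case True
    have "(f \<longlongrightarrow> f 0) (at 0 within {0..})" using assms(2) by (simp add: at_within_Ici_at_right)
    then show ?thesis using True by (auto simp: continuous_within intro: tendsto_within_subset)
  next
    case False
    then have "isCont f x" using assms(1) x by (simp add: continuous_on_eq_continuous_at)
    then show ?thesis by (rule continuous_at_imp_continuous_at_within)
  qed
qed

lemma matrix_entry_polar:
  assumes "transpose A = A"
  shows "A $ i $ j = (form A (axis i 1 + axis j 1) - form A (axis i 1) - form A (axis j 1)) / 2"
  by (simp add: form_axis_sum[OF assms] form_axis)

lemma matrix_bernstein_continuous:
  assumes C: "matrix_bernstein C"
  shows "continuous_on {0..T} (\<lambda>t. C t $ i $ j)"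
proof (rule continuous_on_half_line)
  have "continuous_on {0<..} (\<lambda>t. form (C t) v)" for v
    using C bernstein_deriv(1)[of "\<lambda>t. form (C t) v"]
    by (auto simp: matrix_bernstein_def intro!: continuous_at_imp_continuous_on DERIV_isCont)
  then have "continuous_on {0<..} (\<lambda>t. (form (C t) (axis i 1 + axis j 1) - form (C t) (axis i 1) - form (C t) (axis j 1)) / 2)"
    by (intro continuous_intros) auto
  then show "continuous_on {0<..} (\<lambda>t. C t $ i $ j)"
  proof (rule continuous_on_eq)
    fix t :: real assume "t \<in> {0<..}"
    then have "transpose (C t) = C t" using C by (auto simp: matrix_bernstein_def)
    from matrix_entry_polar[OF this, of i j]
    show "(form (C t) (axis i 1 + axis j 1) - form (C t) (axis i 1) - form (C t) (axis j 1)) / 2 = C t $ i $ j" ..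
  qed
  show "((\<lambda>t. C t $ i $ j) \<longlongrightarrow> C 0 $ i $ j) (at_right 0)"
    using C by (intro tendsto_intros) (simp add: matrix_bernstein_def)
qed

lemma psd_matrix_add: "psd_matrix A \<Longrightarrow> psd_matrix B \<Longrightarrow> psd_matrix (A + B)"
  using symmetric_component[of A] symmetric_component[of B]
  unfolding psd_matrix_def by (simp add: form_add) (simp add: transpose_def vec_eq_iff)

lemma psd_matrix_mat: "0 \<le> c \<Longrightarrow> psd_matrix (mat c)"
  by (simp add: psd_matrix_def form_mat)

text \<open>The substitution x = (t - s)/2, for the function that dominates the convolution
  integrands below.\<close>

lemma integrable_reflect_half:
  fixes f :: "real \<Rightarrow> real"
  assumes "f integrable_on {0..t / 2}" "0 < t"
  shows "(\<lambda>s. f ((t - s) / 2)) integrable_on {0..t}"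
proof -
  have "(\<lambda>x. f ((- 1 / 2) *\<^sub>R x + t / 2)) integrable_on ((\<lambda>x. (1 / (- 1 / 2)) *\<^sub>R x + - ((1 / (- 1 / 2)) *\<^sub>R (t / 2))) ` cbox 0 (t / 2))"
    using assms by (intro integrable_affinity) auto
  moreover have "(\<lambda>x. (1 / (- 1 / 2)) *\<^sub>R x + - ((1 / (- 1 / 2)) *\<^sub>R (t / 2))) ` cbox 0 (t / 2) = {0..t}"
  proof (intro set_eqI iffI)
    fix y :: real assume "y \<in> {0..t}"
    then show "y \<in> (\<lambda>x. (1 / (- 1 / 2)) *\<^sub>R x + - ((1 / (- 1 / 2)) *\<^sub>R (t / 2))) ` cbox 0 (t / 2)"
      by (intro image_eqI[of _ _ "(t - y) / 2"]) (auto simp: field_simps)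
  qed auto
  moreover have "(\<lambda>x. f ((- 1 / 2) *\<^sub>R x + t / 2)) = (\<lambda>x. f ((t - x) / 2))"
    by (rule ext, rule arg_cong[of _ _ f]) (simp add: field_simps)
  ultimately show ?thesis by (simp only:)
qed

lemma matrix_duality_exists:
  fixes N :: "real^'n^'n"
  assumes N: "psd_matrix N" and K: "cm_matrix K" and Ki: "\<And>i j. locally_integrable (\<lambda>t. K t $ i $ j)"
    and nd: "\<And>v. v \<noteq> 0 \<Longrightarrow> \<exists>t>0. form (K t) v \<noteq> 0"
  obtains C where "matrix_bernstein C"
    "\<And>t i j. 0 < t \<Longrightarrow> ((\<lambda>s. (K (t - s) ** C s) $ i $ j) has_integral (t *\<^sub>R mat 1 - N ** C t) $ i $ j) {0..t}"
proof -
  let ?N = "\<lambda>n. N + mat (inverse (real (Suc n)))"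
  obtain t0 c where t0: "0 < t0" and c: "0 < c" and tc: "\<And>v. c * (norm v)\<^sup>2 \<le> form (K t0) v"
    using uniformly_positive[OF K nd] by blast
  have cm: "completely_monotone (\<lambda>t. form (K t) v)" for v using K by (simp add: cm_matrix_def)
  have "\<forall>n. \<exists>p. is_approximant N K n (fst p) (snd p)"
    using approximant_exists[OF N K] by simp
  from choice[OF this] obtain f where f: "\<forall>n. is_approximant N K n (fst (f n)) (snd (f n))" by (rule exE)
  define L where "L n = fst (f n)" for n
  define C where "C n = snd (f n)" for n
  have p: "is_approximant N K n (L n) (C n)" for n using f by (simp add: L_def C_def)
  note p = p[unfolded is_approximant_def]
  have Lpsd: "psd_matrix (L n t)" for n t using p[of n] by blast
  have Lf: "form (L n t) v = exp_approx (\<lambda>t. form (K t) v) (real (Suc n)) ((Suc n)\<^sup>2) t" for n t v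
    using p[of n] by blast
  have C0: "C n 0 = 0" and Csym: "transpose (C n t) = C n t" for n t using p[of n] by blast+
  have Cder: "\<exists>g. completely_monotone g \<and> (\<forall>t. 0 \<le> g t \<and> ((\<lambda>t. form (C n t) v) has_real_derivative g t) (at t))" for n v
    using p[of n] by blast
  have Ceq: "((\<lambda>s. (L n (t - s) ** C n s) $ i $ j) has_integral (t *\<^sub>R mat 1 - ?N n ** C n t) $ i $ j) {0..t}" if "0 \<le> t" for n t i j
    using p[of n] that by blast
  have Llim: "(\<lambda>n. L n t) \<longlonglongrightarrow> K t" if "0 < t" for t
  proof -
    have "(\<lambda>n. L n t) \<longlonglongrightarrow> polar (form (K t))"
    proof (rule symmetric_tendsto_polar)
      show "(\<lambda>n. form (L n t) v) \<longlonglongrightarrow> form (K t) v" for v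
        unfolding Lf by (rule exp_approx_tendsto[OF cm that])
      show "transpose (L n t) = L n t" for n using Lpsd by (simp add: psd_matrix_def)
    qed
    then show ?thesis using K that polar_form by (metis cm_matrix_def)
  qed
  have Lbound: "trace (L n t) \<le> trace (K (t / 2))" if "0 < t" "t \<le> real (Suc n)" for n t
    unfolding trace_def form_axis[symmetric] Lf by (intro sum_mono exp_approx_bounds(3)[OF cm that])
  \<comment> \<open>Entrywise convergence at \<open>t0\<close> perturbs the form by at most c/2
    times the squared norm, uniformly in \<open>v\<close>, so half of the constant survives.\<close>
  obtain n0 where n0: "\<And>n v. n \<ge> n0 \<Longrightarrow> c / 2 * (norm v)\<^sup>2 \<le> form (L n t0) v"
  proof -
    have "(\<lambda>n. \<Sum>i\<in>UNIV. \<Sum>j\<in>UNIV. \<bar>(K t0 - L n t0) $ i $ j\<bar>) \<longlonglongrightarrow> (\<Sum>i\<in>UNIV. \<Sum>j\<in>UNIV. \<bar>(K t0 - K t0) $ i $ j\<bar>)"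
      by (intro tendsto_intros Llim t0)
    then have "\<forall>\<^sub>F n in sequentially. (\<Sum>i\<in>UNIV. \<Sum>j\<in>UNIV. \<bar>(K t0 - L n t0) $ i $ j\<bar>) < c / 2"
      using c by (intro order_tendstoD(2)) auto
    then obtain n0 where n0: "\<And>n. n \<ge> n0 \<Longrightarrow> (\<Sum>i\<in>UNIV. \<Sum>j\<in>UNIV. \<bar>(K t0 - L n t0) $ i $ j\<bar>) < c / 2"
      by (auto simp: eventually_sequentially)
    have "c / 2 * (norm v)\<^sup>2 \<le> form (L n t0) v" if "n \<ge> n0" for n v
    proof -
      have "form (K t0 - L n t0) v \<le> (\<Sum>i\<in>UNIV. \<Sum>j\<in>UNIV. \<bar>(K t0 - L n t0) $ i $ j\<bar>) * (norm v)\<^sup>2"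
        using form_le_norm[of "K t0 - L n t0" v] by linarith
      also have "\<dots> \<le> c / 2 * (norm v)\<^sup>2" using n0[OF that] by (intro mult_right_mono) auto
      finally show ?thesis using tc[of v] unfolding form_diff by linarith
    qed
    then show ?thesis using that by blast
  qed
  have Cmono: "form (C n s) v \<le> form (C n t) v" if "s \<le> t" for n s t v
  proof -
    obtain g where g: "\<And>t. 0 \<le> g t" "\<And>t. ((\<lambda>t. form (C n t) v) has_real_derivative g t) (at t)" using Cder by blast
    show ?thesis by (rule DERIV_nonneg_imp_nondecreasing[OF that]) (use g in blast)
  qed
  have Cpsd: "psd_matrix (C n t)" if "0 \<le> t" for n t
    using Cmono[OF that, of n] Csym C0 by (simp add: psd_matrix_def) (simp add: form_def)
  have trmono: "trace (C n s) \<le> trace (C n t)" if "s \<le> t" for n s t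
    unfolding trace_def form_axis[symmetric] by (intro sum_mono Cmono that)
  \<comment> \<open>Obtained by solving (c/2) x t0 \<le> (T + t0) \<open>CARD('n)\<close> for the
    trace x; the right-hand side is the trace of \<open>T + t0\<close> times the identity.\<close>
  define B where "B T = 2 * real CARD('n) * (T + t0) / (c * t0)" for T
  txt \<open>Take the trace of the equation at \<open>T + t\<^sub>0\<close> and keep only the times in \<open>[T, T + t\<^sub>0]\<close>, where
    the kernel is at least \<open>c/2\<close>.\<close>
  have trB: "trace (C n T) \<le> B T" if n: "n \<ge> n0" and T: "0 \<le> T" for n T
  proof -
    let ?t = "T + t0"
    let ?h = "\<lambda>s. trace (L n (?t - s) ** C n s)"
    have I: "(?h has_integral (\<Sum>i\<in>UNIV. (?t *\<^sub>R mat 1 - ?N n ** C n ?t) $ i $ i)) {0..?t}"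
      unfolding trace_def using T t0 by (intro has_integral_sum Ceq) auto
    have "(\<Sum>i\<in>UNIV. (?t *\<^sub>R mat 1 - ?N n ** C n ?t) $ i $ i) = ?t * real CARD('n) - trace (?N n ** C n ?t)"
      by (simp add: trace_def sum_subtractf mat_def)
    also have "\<dots> \<le> ?t * real CARD('n)"
      using trace_product_nonneg[OF psd_matrix_add[OF N psd_matrix_mat] Cpsd] T t0 by simp
    finally have up: "(\<Sum>i\<in>UNIV. (?t *\<^sub>R mat 1 - ?N n ** C n ?t) $ i $ i) \<le> ?t * real CARD('n)" .
    have "?h integrable_on {T..?t}"
      by (rule integrable_subinterval_real[OF has_integral_integrable[OF I]]) (use T in auto)
    then obtain y where y: "(?h has_integral y) {T..?t}" by (auto simp: integrable_on_def)
    have "((\<lambda>_. c / 2 * trace (C n T)) has_integral (c / 2 * trace (C n T)) * t0) {T..?t}"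
      using has_integral_const_real[of "c / 2 * trace (C n T)" T ?t] t0 by (simp add: mult.commute)
    then have "(c / 2 * trace (C n T)) * t0 \<le> y"
    proof (rule has_integral_le[OF _ y])
      fix s assume s: "s \<in> {T..?t}"
      have "c / 2 * trace (C n T) \<le> c / 2 * trace (C n s)" using trmono[of T s n] s c by simp
      also have "\<dots> \<le> ?h s"
      proof (rule trace_product_ge)
        show "transpose (L n (?t - s)) = L n (?t - s)" using Lpsd by (simp add: psd_matrix_def)
        show "psd_matrix (C n s)" using Cpsd s T by simp
        show "c / 2 * (norm v)\<^sup>2 \<le> form (L n (?t - s)) v" for v
          using n0[OF n, of v] exp_approx_antimono[OF cm, of "real (Suc n)" "?t - s" t0 v "(Suc n)\<^sup>2"] s
          unfolding Lf by simp
      qed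
      finally show "c / 2 * trace (C n T) \<le> ?h s" .
    qed
    also have "y \<le> (\<Sum>i\<in>UNIV. (?t *\<^sub>R mat 1 - ?N n ** C n ?t) $ i $ i)"
      by (rule has_integral_subset_le[OF _ y I]) (use T Lpsd Cpsd in \<open>auto intro: trace_product_nonneg\<close>)
    finally have "(c / 2 * trace (C n T)) * t0 \<le> ?t * real CARD('n)" using up by linarith
    then show ?thesis using c t0 by (simp add: B_def field_simps)
  qed
  have Bpos: "0 < B T" if "0 \<le> T" for T using that t0 c by (simp add: B_def)
  \<comment> \<open>Countably many scalar sequences: all entries at all positive rational times.
    Dividing by \<open>B q\<close> gives the common bound 1 for the choice of a subsequence, and the
    shift by \<open>n0\<close> makes the trace bound valid from the start.\<close>
  let ?S = "{q :: real. q \<in> \<rat> \<and> 0 < q} \<times> (UNIV :: ('n \<times> 'n) set)"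
  let ?f = "\<lambda>n (q, i, j). C (n + n0) q $ i $ j / B q"
  obtain k where k: "strict_mono k" "\<And>x. x \<in> ?S \<Longrightarrow> \<exists>l. (\<lambda>n. ?f (k n) x) \<longlonglongrightarrow> l"
  proof (rule function_convergent_subsequence[of ?S ?f 1])
    have "countable {q :: real. q \<in> \<rat> \<and> 0 < q}" by (rule countable_subset[OF _ countable_rat]) auto
    then show "countable ?S" by (rule countable_SIGMA) (rule countable_finite, rule finite)
    fix n x assume x: "x \<in> ?S"
    obtain q i j where q: "x = (q, i, j)" "0 < q" using x by auto
    have "\<bar>C (n + n0) q $ i $ j\<bar> \<le> B q"
      using psd_entry_le_trace[OF Cpsd[of q "n + n0"], of i j] trB[of "n + n0" q] q by simp
    then show "norm (?f n x) \<le> 1" using q Bpos[of q] by simp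
  qed (rule that)
  define m where "m n = k n + n0" for n
  have m: "filterlim m at_top sequentially"
    by (rule filterlim_at_top_mono[OF filterlim_subseq[OF k(1)]]) (simp add: m_def)
  have mn0: "m n \<ge> n0" for n by (simp add: m_def)
  have rat: "convergent (\<lambda>n. form (C (m n) q) v)" if "q \<in> \<rat>" "0 < q" for q v
  proof -
    have "convergent (\<lambda>n. C (m n) q $ i $ j)" for i j
    proof -
      have "\<exists>l. (\<lambda>n. C (m n) q $ i $ j / B q) \<longlonglongrightarrow> l" using k(2)[of "(q, i, j)"] that by (auto simp: m_def)
      then obtain l where "(\<lambda>n. C (m n) q $ i $ j / B q) \<longlonglongrightarrow> l" by (rule exE)
      from tendsto_mult_right[OF this, of "B q"] show ?thesis using Bpos[of q] that by (auto simp: convergent_def)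
    qed
    then show ?thesis unfolding form_expand by (intro convergent_sum convergent_mult convergent_const)
  qed
  define F where "F v t = lim (\<lambda>n. form (C (m n) t) v)" for v t
  have F: "(\<forall>t>0. (\<lambda>n. form (C (m n) t) v) \<longlonglongrightarrow> F v t) \<and> bernstein (F v)" for v
  proof -
    have "\<forall>n. \<exists>g. completely_monotone g \<and> (\<forall>t. 0 \<le> g t \<and> ((\<lambda>t. form (C (m n) t) v) has_real_derivative g t) (at t))"
      using Cder by blast
    from choice[OF this] obtain g where g: "\<And>n. completely_monotone (g n)"
      "\<And>n t. ((\<lambda>t. form (C (m n) t) v) has_real_derivative g n t) (at t)" by blast
    have b: "form (C (m n) t) v \<le> (real CARD('n))\<^sup>2 * B t * (norm v)\<^sup>2" if "0 \<le> t" for n t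
    proof -
      have "\<bar>C (m n) t $ i $ j\<bar> \<le> B t" for i j
        using psd_entry_le_trace[OF Cpsd[OF that], of "m n" i j] trB[OF mn0 that, of n] by linarith
      then have "(\<Sum>i\<in>UNIV. \<Sum>j\<in>UNIV. \<bar>C (m n) t $ i $ j\<bar>) \<le> (\<Sum>i\<in>(UNIV::'n set). \<Sum>j\<in>(UNIV::'n set). B t)"
        by (intro sum_mono)
      then have "(\<Sum>i\<in>UNIV. \<Sum>j\<in>UNIV. \<bar>C (m n) t $ i $ j\<bar>) * (norm v)\<^sup>2 \<le> (real CARD('n))\<^sup>2 * B t * (norm v)\<^sup>2"
        by (intro mult_right_mono) (simp_all add: power2_eq_square)
      then show ?thesis using form_le_norm[of "C (m n) t" v] by linarith
    qed
    have z: "form (C (m n) 0) v = 0" for n by (simp add: C0 form_def)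
    show ?thesis
      unfolding F_def using bernstein_limit[of g "\<lambda>n t. form (C (m n) t) v", OF g z b rat] by blast
  qed
  have C_lim: "(\<lambda>n. C (m n) t) \<longlonglongrightarrow> polar (\<lambda>v. F v t)" if "0 < t" for t
    using F that Csym by (intro symmetric_tendsto_polar) auto
  have C_form: "form (polar (\<lambda>v. F v t)) v = F v t" if "0 < t" for t v
    by (rule form_polar_limit[of "\<lambda>n. C (m n) t" _ sequentially]) (use F that Csym in auto)
  have "\<forall>v. \<exists>l. (F v \<longlongrightarrow> l) (at_right 0)" using bernstein_limit_at_0 F by blast
  from choice[OF this] obtain F0 where F0: "\<And>v. (F v \<longlongrightarrow> F0 v) (at_right 0)" by blast
  \<comment> \<open>Off the positive half-line \<open>D\<close> takes the limit at 0, which is the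
    extension convention for Bernstein functions.\<close>
  define D where "D t = (if 0 < t then polar (\<lambda>v. F v t) else polar F0)" for t
  have D: "matrix_bernstein D"
    unfolding matrix_bernstein_def
  proof (intro conjI allI impI)
    show "transpose (D t) = D t" for t by (simp add: D_def polar_symmetric)
    fix v
    have eq: "F v t = form (D t) v" if "0 < t" for t using C_form that by (simp add: D_def)
    have Fv: "bernstein (F v)" using F by blast
    have der: "((\<lambda>t. form (D t) v) has_real_derivative deriv (F v) t) (at t)" if "0 < t" for t
      by (rule has_field_derivative_transform_within_open[OF bernstein_deriv(1)[OF Fv that], of "{0<..}"])
        (use that eq in auto)
    have "completely_monotone (deriv (\<lambda>t. form (D t) v))"
      by (rule completely_monotone_cong[of "deriv (F v)"]) (use Fv der in \<open>auto simp: bernstein_def intro: DERIV_imp_deriv[symmetric]\<close>)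
    then show "bernstein (\<lambda>t. form (D t) v)"
      using der eq bernstein_deriv(3)[OF Fv] by (auto simp: bernstein_def real_differentiable_def)
  next
    have "((\<lambda>t. D t) \<longlongrightarrow> polar F0) (at_right 0)"
    proof (rule symmetric_tendsto_polar)
      fix v
      have "\<forall>\<^sub>F t in at_right 0. F v t = form (D t) v" using C_form by (auto simp: eventually_at_filter D_def)
      from Lim_transform_eventually[OF F0 this] show "((\<lambda>t. form (D t) v) \<longlongrightarrow> F0 v) (at_right 0)" .
    qed (simp add: D_def polar_symmetric)
    moreover have "D 0 = polar F0" by (simp add: D_def)
    ultimately show "(D \<longlongrightarrow> D 0) (at_right 0)" by (simp only:)
  qed
  have D_lim: "(\<lambda>n. C (m n) t) \<longlonglongrightarrow> D t" if "0 < t" for t using C_lim that by (simp add: D_def)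
  have eq: "((\<lambda>s. (K (t - s) ** D s) $ i $ j) has_integral (t *\<^sub>R mat 1 - N ** D t) $ i $ j) {0..t}" if t: "0 < t" for t i j
  proof -
    obtain n1 where n1: "\<And>n. n \<ge> n1 \<Longrightarrow> t \<le> real (m n)"
    proof -
      have "filterlim (\<lambda>n. real (m n)) at_top sequentially" by (rule filterlim_compose[OF filterlim_real_sequentially m])
      then have "\<forall>\<^sub>F n in sequentially. t \<le> real (m n)" by (simp add: filterlim_at_top)
      then show ?thesis using that by (auto simp: eventually_sequentially)
    qed
    \<comment> \<open>The estimate of the approximate kernel by \<open>K\<close> at half the time
      needs \<open>t \<le> Suc n\<close>, hence the tail of the subsequence.\<close>
    define u where "u n = m (n + n1)" for n
    have uu: "filterlim u at_top sequentially" unfolding u_def by (rule filterlim_compose[OF m filterlim_add_const_nat_at_top])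
    have u1: "t \<le> real (Suc (u n))" "u n \<ge> n0" for n using n1[of "n + n1"] mn0 by (auto simp: u_def)
    have Du: "(\<lambda>n. C (u n) s) \<longlonglongrightarrow> D s" if "0 < s" for s
      unfolding u_def using LIMSEQ_ignore_initial_segment[OF D_lim[OF that], of n1] .
    have Lu: "(\<lambda>n. L (u n) s) \<longlonglongrightarrow> K s" if "0 < s" for s
      using filterlim_compose[OF Llim[OF that] uu] .
    txt \<open>The dominating function: the approximants of \<open>K\<close> at \<open>s\<close> lie below \<open>K (s/2)\<close>.\<close>
    let ?h = "\<lambda>s. real CARD('n) * B t * trace (K ((t - s) / 2))"
    have Kint: "(\<lambda>s. trace (K s)) integrable_on {0..T}" for T
      unfolding trace_def by (intro integrable_sum set_lebesgue_integral_eq_integral(1) locally_integrableD[OF Ki]) auto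
    \<comment> \<open>On the open interval, because the convergence of \<open>L\<close> and of
      \<open>C\<close> is known at positive arguments only.\<close>
    have h: "?h integrable_on {0<..<t}"
      unfolding integrable_on_open_interval_real
      by (intro integrable_on_mult_right integrable_reflect_half[OF Kint t])
    have fi: "(\<lambda>s. (L (u n) (t - s) ** C (u n) s) $ i $ j) integrable_on {0<..<t}" for n
      unfolding integrable_on_open_interval_real using Ceq[of t "u n" i j] t by (auto intro: has_integral_integrable)
    have le: "norm ((L (u n) (t - s) ** C (u n) s) $ i $ j) \<le> ?h s" if s: "s \<in> {0<..<t}" for n s
    proof -
      have "\<bar>L (u n) (t - s) $ i $ l * C (u n) s $ l $ j\<bar> \<le> trace (K ((t - s) / 2)) * B t" for l
        unfolding abs_mult
      proof (rule mult_mono)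
        show "\<bar>L (u n) (t - s) $ i $ l\<bar> \<le> trace (K ((t - s) / 2))"
          using psd_entry_le_trace[OF Lpsd[of "u n" "t - s"], of i l] Lbound[of "t - s" "u n"] s u1(1)[of n] by simp
        show "\<bar>C (u n) s $ l $ j\<bar> \<le> B t"
          using psd_entry_le_trace[OF Cpsd[of s "u n"], of l j] trmono[of s t "u n"] trB[OF u1(2), of t n] s by simp
        show "0 \<le> trace (K ((t - s) / 2))" using s by (intro trace_nonneg cm_matrix_psd[OF K]) simp
      qed simp
      then have "(\<Sum>l\<in>UNIV. \<bar>L (u n) (t - s) $ i $ l * C (u n) s $ l $ j\<bar>) \<le> (\<Sum>l\<in>(UNIV::'n set). trace (K ((t - s) / 2)) * B t)"
        by (intro sum_mono)
      from order_trans[OF sum_abs this] show ?thesis by (simp add: matrix_matrix_mult_def mult_ac)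
    qed
    have conv: "(\<lambda>n. (L (u n) (t - s) ** C (u n) s) $ i $ j) \<longlonglongrightarrow> (K (t - s) ** D s) $ i $ j" if s: "s \<in> {0<..<t}" for s
      unfolding matrix_matrix_mult_def vec_lambda_beta using s by (intro tendsto_intros Lu Du) auto
    note dc = dominated_convergence[OF fi h le conv]
    have "integral {0<..<t} (\<lambda>s. (L (u n) (t - s) ** C (u n) s) $ i $ j) = (t *\<^sub>R mat 1 - ?N (u n) ** C (u n) t) $ i $ j" for n
      unfolding integral_open_interval_real[symmetric] using Ceq[of t "u n" i j] t by (intro integral_unique) auto
    then have 1: "(\<lambda>n. (t *\<^sub>R mat 1 - ?N (u n) ** C (u n) t) $ i $ j) \<longlonglongrightarrow> integral {0<..<t} (\<lambda>s. (K (t - s) ** D s) $ i $ j)"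
      using dc(2) by simp
    have 2: "(\<lambda>n. (t *\<^sub>R mat 1 - ?N (u n) ** C (u n) t) $ i $ j) \<longlonglongrightarrow> (t *\<^sub>R mat 1 - (N + mat 0) ** D t) $ i $ j"
    proof -
      have inv: "(\<lambda>n. inverse (real (Suc (u n)))) \<longlonglongrightarrow> 0"
        by (rule filterlim_compose[OF LIMSEQ_inverse_real_of_nat uu])
      have "(\<lambda>n. (mat (inverse (real (Suc (u n)))) :: real^'n^'n) $ a $ b) \<longlonglongrightarrow> mat 0 $ a $ b" for a b
        using inv by (cases "a = b") (simp_all add: mat_def)
      then have "(\<lambda>n. mat (inverse (real (Suc (u n)))) :: real^'n^'n) \<longlonglongrightarrow> mat 0"
        by (intro vec_tendstoI)
      then show ?thesis
        unfolding matrix_matrix_mult_def vector_minus_component vector_add_component vec_lambda_beta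
        by (intro tendsto_intros Du t)
    qed
    have int_eq: "integral {0..t} (\<lambda>s. (K (t - s) ** D s) $ i $ j) = (t *\<^sub>R mat 1 - N ** D t) $ i $ j"
      unfolding integral_open_interval_real LIMSEQ_unique[OF 1 2] by simp
    have "(\<lambda>s. (K (t - s) ** D s) $ i $ j) integrable_on {0..t}"
      using dc(1) by (simp add: integrable_on_open_interval_real)
    from integrable_integral[OF this] show ?thesis unfolding int_eq .
  qed
  show ?thesis by (rule that[OF D eq])
qed

section \<open>Duality and uniqueness\<close>

lemma LICM_locally_integrable:
  assumes "LICM f"
  shows "locally_integrable f"
  unfolding locally_integrable_def
proof (intro allI impI)
  fix T :: real
  have "f absolutely_integrable_on {0<..1}" using assms by (simp add: LICM_def)
  then have 1: "f absolutely_integrable_on {0..1}"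
    by (subst (asm) absolutely_integrable_spike_set_eq[of _ "{0..1}"])
      (auto intro: negligible_subset[of "{0}"])
  have "continuous_on {1..T} f"
    using completely_monotone_continuous[of f] assms by (auto simp: LICM_def intro: continuous_on_subset)
  then have 2: "f absolutely_integrable_on {1..T}" by (rule absolutely_integrable_continuous_real)
  have "f absolutely_integrable_on {0..1} \<union> {1..T}"
    by (rule absolutely_integrable_Un[OF 1 2])
  then show "f absolutely_integrable_on {0..T}" by (rule set_integrable_subset) auto
qed

lemma locally_integrable_LICM:
  assumes "completely_monotone f" "locally_integrable f"
  shows "LICM f"
  unfolding LICM_def using assms(1) locally_integrableD[OF assms(2), of 1]
  by (auto intro: set_integrable_subset)

lemma completely_monotone_scale:
  assumes "completely_monotone f" "0 \<le> c"
  shows "completely_monotone (\<lambda>t. c * f t)"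
  by (rule completely_monotoneI[where D="\<lambda>n t. c * (deriv ^^ n) f t"])
    (use completely_monotoneD[OF assms(1)] assms(2) in \<open>auto intro!: DERIV_cmult mult_nonneg_nonneg simp: mult.left_commute[of _ c]\<close>)

lemma bernstein_scale:
  assumes "bernstein f" "0 \<le> c"
  shows "bernstein (\<lambda>t. c * f t)"
proof -
  have d: "((\<lambda>t. c * f t) has_real_derivative c * deriv f t) (at t)" if "0 < t" for t
    using bernstein_deriv(1)[OF assms(1) that] by (rule DERIV_cmult)
  have "completely_monotone (deriv (\<lambda>t. c * f t))"
    by (rule completely_monotone_cong[OF completely_monotone_scale[of "deriv f" c]])
      (use assms d in \<open>auto simp: bernstein_def intro: DERIV_imp_deriv[symmetric]\<close>)
  then show ?thesis
    using d assms bernstein_deriv(3)[OF assms(1)] by (auto simp: bernstein_def real_differentiable_def)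
qed

lemma matrix_bernstein_scale:
  assumes "matrix_bernstein C" "0 \<le> c"
  shows "matrix_bernstein (\<lambda>t. c *\<^sub>R C t)"
  unfolding matrix_bernstein_def form_scaleR
proof (intro conjI allI impI)
  show "transpose (c *\<^sub>R C t) = c *\<^sub>R C t" if "0 < t" for t
  proof -
    have "C t $ i $ j = C t $ j $ i" for i j
      using assms(1) that by (intro symmetric_component) (simp add: matrix_bernstein_def)
    then show ?thesis by (simp add: transpose_def vec_eq_iff)
  qed
  show "bernstein (\<lambda>t. c * form (C t) v)" for v
    using assms by (intro bernstein_scale) (auto simp: matrix_bernstein_def)
  show "((\<lambda>t. c *\<^sub>R C t) \<longlongrightarrow> c *\<^sub>R C 0) (at_right 0)"
    using assms by (intro tendsto_intros) (simp add: matrix_bernstein_def)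
qed

lemma bernstein_iterated_differentiable:
  assumes "bernstein f" "0 < t"
  shows "(deriv ^^ n) f differentiable (at t)"
  using assms by (cases n) (auto simp: bernstein_def completely_monotone_def funpow_swap1)

text \<open>The derivative of a Bernstein function is a kernel as in the first problem, so the pair
  (\<open>C 0\<close>, \<open>K\<close>) can take the role of the pair (N, F).\<close>

lemma matrix_bernstein_decompose:
  assumes C: "matrix_bernstein C"
  obtains K where "cm_matrix K" "\<And>t. transpose (K t) = K t" "\<And>i j. locally_integrable (\<lambda>t. K t $ i $ j)"
    "\<And>t i j. 0 \<le> t \<Longrightarrow> C t $ i $ j = C 0 $ i $ j + integral {0..t} (\<lambda>s. K s $ i $ j)"
    "\<And>t v. 0 < t \<Longrightarrow> form (K t) v = deriv (\<lambda>t. form (C t) v) t"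
proof -
  let ?f = "\<lambda>v t. form (C t) v"
  have b: "bernstein (?f v)" for v using C by (simp add: matrix_bernstein_def)
  have Cs: "transpose (C t) = C t" if "0 \<le> t" for t
    using that C matrix_bernstein_psd_0[OF C] by (cases "t = 0") (auto simp: matrix_bernstein_def psd_matrix_def)
  define K where "K t = polar (\<lambda>v. deriv (?f v) t)" for t
  have Kf: "form (K t) v = deriv (?f v) t" if "0 < t" for t v
    unfolding K_def
    using form_polar_deriv[of C t 1 v, OF Cs bernstein_iterated_differentiable[OF b] that] by simp
  have cm: "cm_matrix K"
    unfolding cm_matrix_def
  proof (intro conjI allI impI)
    show "transpose (K t) = K t" for t by (simp add: K_def polar_symmetric)
    show "completely_monotone (\<lambda>t. form (K t) v)" for v
      by (rule completely_monotone_cong[of "deriv (?f v)"]) (use b Kf in \<open>auto simp: bernstein_def\<close>)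
  qed
  \<comment> \<open>The derivative may be unbounded at 0; this form of the fundamental theorem asks
    for continuity on the closed interval and for derivatives only inside.\<close>
  have hi: "(deriv (?f v) has_integral ?f v T - ?f v 0) {0..T}" if "0 \<le> T" for T v
  proof (rule fundamental_theorem_of_calculus_interior[OF that])
    show "continuous_on {0..T} (?f v)"
      unfolding form_expand by (intro continuous_intros matrix_bernstein_continuous[OF C])
    show "(?f v has_vector_derivative deriv (?f v) x) (at x)" if "x \<in> {0<..<T}" for x
      using bernstein_deriv(1)[OF b, of x] that by (simp add: has_real_derivative_iff_has_vector_derivative)
  qed
  have li: "locally_integrable (deriv (?f v))" for v
  proof -
    \<comment> \<open>The derivative has a known sign for positive \<open>t\<close> only. Setting it
      to 0 elsewhere makes it non-negative, and a non-negative function with a gauge integral is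
      absolutely integrable.\<close>
    let ?g = "\<lambda>t. if 0 < t then deriv (?f v) t else 0"
    have "locally_integrable ?g"
      unfolding locally_integrable_def
    proof (intro allI impI nonnegative_absolutely_integrable_1)
      fix T :: real assume "0 < T"
      then have "deriv (?f v) integrable_on {0..T}" using hi[of T v] by (auto intro: has_integral_integrable)
      then show "?g integrable_on {0..T}"
        by (rule integrable_spike[of _ _ "{0}"]) auto
      show "0 \<le> ?g x" for x using bernstein_deriv(2)[OF b] by simp
    qed
    then show ?thesis by (subst locally_integrable_AE_cong[of _ ?g]) auto
  qed
  have Kentry: "K t $ i $ j = (1 / 2) * (deriv (?f (axis i 1 + axis j 1)) t - deriv (?f (axis i 1)) t - deriv (?f (axis j 1)) t)" for t i j
    by (simp add: K_def polar_def)
  have "C t $ i $ j = C 0 $ i $ j + integral {0..t} (\<lambda>s. K s $ i $ j)" if "0 \<le> t" for t i j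
  proof -
    have "((\<lambda>s. K s $ i $ j) has_integral (1 / 2) * ((?f (axis i 1 + axis j 1) t - ?f (axis i 1 + axis j 1) 0)
        - (?f (axis i 1) t - ?f (axis i 1) 0) - (?f (axis j 1) t - ?f (axis j 1) 0))) {0..t}"
      unfolding Kentry by (intro has_integral_mult_right has_integral_diff hi that)
    then show ?thesis
      using matrix_entry_polar[OF Cs[OF that], of i j] matrix_entry_polar[OF Cs[of 0], of i j]
      by (simp add: integral_unique field_simps)
  qed
  moreover have "locally_integrable (\<lambda>t. K t $ i $ j)" for i j
    unfolding Kentry by (intro locally_integrable_mult locally_integrable_diff li)
  moreover have "transpose (K t) = K t" for t by (simp add: K_def polar_symmetric)
  ultimately show ?thesis using Kf by (intro that[OF cm])
qed

lemma conv_cong_pos: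
  assumes "\<And>s. 0 < s \<Longrightarrow> f s = f' s" "\<And>s. 0 < s \<Longrightarrow> g s = g' s"
  shows "conv f g t = conv f' g' t" and "conv_exists f g t \<longleftrightarrow> conv_exists f' g' t"
proof -
  have "AE s in lebesgue. s \<notin> {0, t}"
    by (auto simp: eventually_ae_filter_negligible intro!: exI[of _ "{0, t}"])
  then have ae: "AE s in lebesgue. indicator {0..t} s *\<^sub>R (f (t - s) * g s) = indicator {0..t} s *\<^sub>R (f' (t - s) * g' s)"
    by eventually_elim (use assms in \<open>auto simp: indicator_def\<close>)
  show "conv f g t = conv f' g' t"
    unfolding conv_def set_lebesgue_integral_def using lebesgue_cong_AE(2)[OF ae] .
  show "conv_exists f g t \<longleftrightarrow> conv_exists f' g' t"
    unfolding conv_exists_def set_integrable_def using lebesgue_cong_AE(1)[OF ae] .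
qed

text \<open>Both sides equal \<open>c h + c (1 \<star> p) + h (1 \<star> k) + 1 \<star> (k \<star> p)\<close>.\<close>

lemma conv_duality:
  assumes k: "locally_integrable k" and p: "locally_integrable p" and t: "0 \<le> t"
    and C: "\<And>s. 0 \<le> s \<Longrightarrow> C s = c + integral {0..s} k"
    and H: "\<And>s. 0 \<le> s \<Longrightarrow> H s = h + integral {0..s} p"
  shows "c * H t + conv k H t = h * C t + conv p C t"
proof -
  \<comment> \<open>The expansion of a convolution with a constant plus a primitive; applied to (k,
    H) and to (p, C), it leaves the same double convolution on both sides.\<close>
  have *: "conv q G t = g * integral {0..t} q + conv (\<lambda>_. 1) (conv r q) t"
    if q: "locally_integrable q" and r: "locally_integrable r" and G: "\<And>s. 0 \<le> s \<Longrightarrow> G s = g + integral {0..s} r" for q r g G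
  proof -
    have ir: "locally_integrable (conv (\<lambda>_. 1) r)" by (rule conv_AE_exists(2)[OF locally_integrable_one(1) r])
    have cg: "locally_integrable (\<lambda>_. g)" "locally_bounded (\<lambda>_. g)" by (rule locally_integrable_continuous, simp)+
    have eb: "locally_bounded (conv (\<lambda>_. 1) r)"
      using locally_integrable_continuous(2)[of "conv (\<lambda>_. 1) r"] continuous_on_indefinite[OF r]
      by (simp add: conv_integral[OF r, abs_def])
    have "conv q G t = conv q (\<lambda>s. g + conv (\<lambda>_. 1) r s) t"
      by (rule conv_cong_pos) (use G in \<open>auto simp: conv_integral[OF r]\<close>)
    also have "\<dots> = conv q (\<lambda>_. g) t + conv q (conv (\<lambda>_. 1) r) t"
      using conv_commute(2)[OF q cg(1)] conv_commute(2)[OF q ir] conv_exists_bounded[OF cg q] conv_exists_bounded[OF ir eb q]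
      by (intro conv_add_right) auto
    also have "conv q (\<lambda>_. g) t = g * integral {0..t} q"
      using conv_commute(1)[OF q cg(1)] conv_integral[OF q] by simp
    also have "conv q (conv (\<lambda>_. 1) r) t = conv (conv (\<lambda>_. 1) r) q t" by (rule conv_commute(1)[OF q ir])
    also have "\<dots> = conv (\<lambda>_. 1) (conv r q) t" by (rule conv_assoc[OF locally_integrable_one r q, symmetric])
    finally show ?thesis .
  qed
  have "conv p k = conv k p" using conv_commute(1)[OF p k] by auto
  then show ?thesis using *[OF k p H] *[OF p k C] C[OF t] H[OF t] by (simp add: algebra_simps)
qed

text \<open>Under the identification of symmetric tensors with \<open>6 \<times> 6\<close> matrices the right-hand side
  \<open>t (\<delta>\<^sub>j\<^sub>r \<delta>\<^sub>k\<^sub>s + \<delta>\<^sub>j\<^sub>s \<delta>\<^sub>k\<^sub>r)\<close> becomes \<open>2 t\<close> times the identity.\<close>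

definition matrix_equation :: "real^'n^'n \<Rightarrow> (real \<Rightarrow> real^'n^'n) \<Rightarrow> (real \<Rightarrow> real^'n^'n) \<Rightarrow> real \<Rightarrow> bool" where
  "matrix_equation N F C t \<longleftrightarrow> (\<forall>i j. (\<forall>k. conv_exists (\<lambda>s. F s $ i $ k) (\<lambda>s. C s $ k $ j) t) \<and>
     (\<Sum>k\<in>UNIV. N $ i $ k * C t $ k $ j) + (\<Sum>k\<in>UNIV. conv (\<lambda>s. F s $ i $ k) (\<lambda>s. C s $ k $ j) t)
      = 2 * t * of_bool (i = j))"

lemma matrix_bernstein_locally:
  assumes "matrix_bernstein C"
  shows "locally_integrable (\<lambda>t. C t $ i $ j)" "locally_bounded (\<lambda>t. C t $ i $ j)"
  using locally_integrable_continuous[of "\<lambda>t. C t $ i $ j"] matrix_bernstein_continuous[OF assms] by blast+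

lemma matrix_solution:
  fixes N :: "real^'n^'n"
  assumes N: "psd_matrix N" and K: "cm_matrix K" and Ki: "\<And>i j. locally_integrable (\<lambda>t. K t $ i $ j)"
    and nd: "\<And>v. v \<noteq> 0 \<Longrightarrow> \<exists>t>0. form (K t) v \<noteq> 0"
  obtains C where "matrix_bernstein C" "\<And>t. 0 < t \<Longrightarrow> matrix_equation N K C t"
proof -
  obtain D where D: "matrix_bernstein D"
    "\<And>t i j. 0 < t \<Longrightarrow> ((\<lambda>s. (K (t - s) ** D s) $ i $ j) has_integral (t *\<^sub>R mat 1 - N ** D t) $ i $ j) {0..t}"
    using matrix_duality_exists[OF N K Ki nd] by blast
  \<comment> \<open>The factor 2 passes from the right-hand side \<open>t\<close> to the right-hand
    side \<open>2 * t\<close>.\<close>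
  let ?C = "\<lambda>t. 2 *\<^sub>R D t"
  have C: "matrix_bernstein ?C" by (rule matrix_bernstein_scale[OF D(1)]) simp
  have ex: "conv_exists (\<lambda>s. K s $ i $ k) (\<lambda>s. ?C s $ k $ j) t" for i j k t
    using conv_exists_bounded[OF matrix_bernstein_locally[OF C] Ki] conv_commute(2)[OF Ki matrix_bernstein_locally(1)[OF C]] by blast
  have "matrix_equation N K ?C t" if t: "0 < t" for t
    unfolding matrix_equation_def
  proof (intro allI conjI ex)
    fix i j
    let ?K = "\<lambda>k s. K s $ i $ k" let ?c = "\<lambda>k s. ?C s $ k $ j"
    have "((\<lambda>s. 2 * (K (t - s) ** D s) $ i $ j) has_integral 2 * (t *\<^sub>R mat 1 - N ** D t) $ i $ j) {0..t}"
      by (intro has_integral_mult_right D t)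
    moreover have "2 * (K (t - s) ** D s) $ i $ j = (\<Sum>k\<in>UNIV. ?K k (t - s) * ?c k s)" for s
      by (simp add: matrix_matrix_mult_def sum_distrib_left mult_ac)
    ultimately have "((\<lambda>s. \<Sum>k\<in>UNIV. ?K k (t - s) * ?c k s) has_integral 2 * (t *\<^sub>R mat 1 - N ** D t) $ i $ j) {0..t}" by simp
    moreover have "((\<lambda>s. \<Sum>k\<in>UNIV. ?K k (t - s) * ?c k s) has_integral (\<Sum>k\<in>UNIV. conv (?K k) (?c k) t)) {0..t}"
      using ex[of i _ j t] has_integral_set_lebesgue unfolding conv_exists_def conv_def
      by (intro has_integral_sum) auto
    ultimately have "(\<Sum>k\<in>UNIV. conv (?K k) (?c k) t) = 2 * (t *\<^sub>R mat 1 - N ** D t) $ i $ j"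
      using has_integral_unique by blast
    then show "(\<Sum>k\<in>UNIV. N $ i $ k * ?c k t) + (\<Sum>k\<in>UNIV. conv (?K k) (?c k) t) = 2 * t * of_bool (i = j)"
      by (simp add: matrix_matrix_mult_def mat_def sum_distrib_left algebra_simps)
  qed
  then show ?thesis using that C by blast
qed

lemma matrix_dual_solution:
  fixes C :: "real \<Rightarrow> real^'n^'n"
  assumes C: "matrix_bernstein C" and nd: "\<And>v. v \<noteq> 0 \<Longrightarrow> \<not> (\<lambda>t. form (C t) v) constant_on {0..}"
  obtains N F where "psd_matrix N" "cm_matrix F" "\<And>t. transpose (F t) = F t" "\<And>i j. locally_integrable (\<lambda>t. F t $ i $ j)"
    "\<And>t. 0 < t \<Longrightarrow> matrix_equation N F C t"
proof -
  obtain K where K: "cm_matrix K" "\<And>t. transpose (K t) = K t" "\<And>i j. locally_integrable (\<lambda>t. K t $ i $ j)"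
    "\<And>t i j. 0 \<le> t \<Longrightarrow> C t $ i $ j = C 0 $ i $ j + integral {0..t} (\<lambda>s. K s $ i $ j)"
    "\<And>t v. 0 < t \<Longrightarrow> form (K t) v = deriv (\<lambda>t. form (C t) v) t"
    by (rule matrix_bernstein_decompose[OF C]) (rule that)
  \<comment> \<open>If the derivative of the form vanished for all \<open>t\<close>, the form of
    \<open>C\<close>, being continuous up to 0, would be constant.\<close>
  have ndK: "\<exists>t>0. form (K t) v \<noteq> 0" if v: "v \<noteq> 0" for v
  proof (rule ccontr)
    assume z: "\<not> (\<exists>t>0. form (K t) v \<noteq> 0)"
    have "form (C t) v = form (C 0) v" if t: "0 \<le> t" for t
    proof (cases "t = 0")
      case False
      show ?thesis
      proof (rule DERIV_isconst_end[where f="\<lambda>t. form (C t) v"])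
        show "0 < t" using t False by simp
        show "continuous_on {0..t} (\<lambda>t. form (C t) v)"
          unfolding form_expand by (intro continuous_intros matrix_bernstein_continuous[OF C])
        show "((\<lambda>t. form (C t) v) has_real_derivative 0) (at x)" if "0 < x" for x
          using bernstein_deriv(1)[of "\<lambda>t. form (C t) v" x] C K(5)[OF that, of v] z that by (simp add: matrix_bernstein_def)
      qed
    qed simp
    then have "\<forall>t\<in>{0..}. form (C t) v = form (C 0) v" by blast
    then have "(\<lambda>t. form (C t) v) constant_on {0..}" unfolding constant_on_def by (rule exI)
    then show False using nd[OF v] by simp
  qed
  obtain H where H: "matrix_bernstein H" "\<And>t. 0 < t \<Longrightarrow> matrix_equation (C 0) K H t"
    using matrix_solution[OF matrix_bernstein_psd_0[OF C] K(1,3) ndK] by blast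
  obtain P where P: "cm_matrix P" "\<And>t. transpose (P t) = P t" "\<And>i j. locally_integrable (\<lambda>t. P t $ i $ j)"
    "\<And>t i j. 0 \<le> t \<Longrightarrow> H t $ i $ j = H 0 $ i $ j + integral {0..t} (\<lambda>s. P s $ i $ j)"
    by (rule matrix_bernstein_decompose[OF H(1)]) (rule that)
  have C0s: "C 0 $ i $ j = C 0 $ j $ i" for i j
    using matrix_bernstein_psd_0[OF C] by (intro symmetric_component) (simp add: psd_matrix_def)
  have Hs: "H t $ i $ j = H t $ j $ i" if "0 < t" for t i j
    using H(1) that by (intro symmetric_component) (simp add: matrix_bernstein_def)
  have ex: "conv_exists (\<lambda>s. P s $ i $ k) (\<lambda>s. C s $ k $ j) t" for i j k t
    using conv_exists_bounded[OF matrix_bernstein_locally[OF C] P(3)] conv_commute(2)[OF P(3) matrix_bernstein_locally(1)[OF C]] by blast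
  have "matrix_equation (H 0) P C t" if t: "0 < t" for t
    unfolding matrix_equation_def
  proof (intro allI conjI ex)
    fix i j
    \<comment> \<open>The scalar duality exchanges the two factors, so the product appears
      transposed; by the symmetry of \<open>C 0\<close>, \<open>K\<close> and \<open>H\<close> it is
      the (j, i) entry of the equation for \<open>H\<close>.\<close>
    have "H 0 $ i $ k * C t $ k $ j + conv (\<lambda>s. P s $ i $ k) (\<lambda>s. C s $ k $ j) t
        = C 0 $ j $ k * H t $ k $ i + conv (\<lambda>s. K s $ j $ k) (\<lambda>s. H s $ k $ i) t" for k
    proof -
      have "conv (\<lambda>s. K s $ j $ k) (\<lambda>s. H s $ k $ i) t = conv (\<lambda>s. K s $ k $ j) (\<lambda>s. H s $ i $ k) t"
        by (rule conv_cong_pos) (use symmetric_component[OF K(2)] Hs in auto)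
      then show ?thesis
        using conv_duality[OF K(3)[of k j] P(3)[of i k] less_imp_le[OF t] K(4)[of _ k j] P(4)[of _ i k]] C0s[of k j] Hs[OF t, of k i]
        by simp
    qed
    then have "(\<Sum>k\<in>UNIV. H 0 $ i $ k * C t $ k $ j + conv (\<lambda>s. P s $ i $ k) (\<lambda>s. C s $ k $ j) t)
        = (\<Sum>k\<in>UNIV. C 0 $ j $ k * H t $ k $ i + conv (\<lambda>s. K s $ j $ k) (\<lambda>s. H s $ k $ i) t)" by simp
    then show "(\<Sum>k\<in>UNIV. H 0 $ i $ k * C t $ k $ j) + (\<Sum>k\<in>UNIV. conv (\<lambda>s. P s $ i $ k) (\<lambda>s. C s $ k $ j) t)
        = 2 * t * of_bool (i = j)"
      using H(2)[OF t] by (simp add: matrix_equation_def sum.distrib eq_commute[of i j])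
  qed
  then show ?thesis using that[OF matrix_bernstein_psd_0[OF H(1)] P(1,2,3)] by blast
qed

section \<open>Uniqueness of either unknown when the other is given\<close>

lemma conv_diff_right:
  assumes "conv_exists f g t" "conv_exists f h t"
  shows "conv f (\<lambda>s. g s - h s) t = conv f g t - conv f h t"
  using set_integral_diff(2)[OF assms[unfolded conv_exists_def]]
  by (simp add: conv_def right_diff_distrib)

lemma conv_diff_left:
  assumes "conv_exists f h t" "conv_exists g h t"
  shows "conv (\<lambda>s. f s - g s) h t = conv f h t - conv g h t"
  using set_integral_diff(2)[OF assms[unfolded conv_exists_def]]
  by (simp add: conv_def left_diff_distrib)

lemma conv_zero_right: "conv f (\<lambda>_. 0) t = 0"
  by (simp add: conv_def set_lebesgue_integral_def)

text \<open>A known solution, shared by both uniqueness proofs. Only \<open>C\<close> carries a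
  bound, so it is the left factor in every use of \<open>conv_assoc\<close>.\<close>

locale solved_equation =
  fixes N :: "real^'n^'n" and F C :: "real \<Rightarrow> real^'n^'n"
  assumes N_sym: "transpose N = N" and F_sym: "\<And>t. 0 < t \<Longrightarrow> transpose (F t) = F t"
    and C_sym: "\<And>t. 0 < t \<Longrightarrow> transpose (C t) = C t"
    and F_int: "\<And>i j. locally_integrable (\<lambda>t. F t $ i $ j)"
    and C_int: "\<And>i j. locally_integrable (\<lambda>t. C t $ i $ j)"
    and C_bdd: "\<And>i j. locally_bounded (\<lambda>t. C t $ i $ j)"
    and solves: "\<And>t. 0 < t \<Longrightarrow> matrix_equation N F C t"
begin

text \<open>Transposing turns the right inverse into a left one: C N + C \<star> F is also 2t times
  the identity.\<close>

lemma transposed_equation: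
  assumes t: "0 < t"
  shows "(\<Sum>k\<in>UNIV. N $ k $ j * C t $ i $ k + conv (\<lambda>s. C s $ i $ k) (\<lambda>s. F s $ k $ j) t) = 2 * t * of_bool (i = j)"
proof -
  have "conv (\<lambda>s. C s $ i $ k) (\<lambda>s. F s $ k $ j) t = conv (\<lambda>s. F s $ j $ k) (\<lambda>s. C s $ k $ i) t" for k
    unfolding conv_commute(1)[OF C_int F_int]
    by (rule conv_cong_pos) (use symmetric_component[OF F_sym] symmetric_component[OF C_sym] in auto)
  moreover have "N $ k $ j * C t $ i $ k = N $ j $ k * C t $ k $ i" for k
    using symmetric_component[OF N_sym, of k j] symmetric_component[OF C_sym[OF t], of i k] by simp
  ultimately show ?thesis
    using solves[OF t] by (simp add: matrix_equation_def sum.distrib eq_commute[of i j])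
qed

text \<open>The difference E satisfies N E + F \<star> E = 0. Convolving with C from the left gives
  (C N + C \<star> F) \<star> E = 0, and the bracket is 2t times the identity.\<close>

lemma unique_solution:
  assumes D: "\<And>i j. locally_integrable (\<lambda>t. D t $ i $ j)"
    and eq: "AE t in lebesgue. 0 < t \<longrightarrow> matrix_equation N F D t"
  shows "AE t in lebesgue. 0 < t \<longrightarrow> D t = C t"
proof -
  define E where "E k j s = D s $ k $ j - C s $ k $ j" for k j s
  have E: "locally_integrable (E k j)" for k j unfolding E_def by (intro locally_integrable_diff D C_int)
  have z: "AE t in lebesgue. 0 < t \<longrightarrow> (\<Sum>k\<in>UNIV. N $ i $ k * E k j t + conv (\<lambda>s. F s $ i $ k) (E k j) t) = 0" for i j
    using eq
  proof eventually_elim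
    case (elim t)
    show ?case
    proof
      assume t: "0 < t"
      have "conv (\<lambda>s. F s $ i $ k) (E k j) t = conv (\<lambda>s. F s $ i $ k) (\<lambda>s. D s $ k $ j) t - conv (\<lambda>s. F s $ i $ k) (\<lambda>s. C s $ k $ j) t" for k
        unfolding E_def using elim solves[OF t] t by (intro conv_diff_right) (auto simp: matrix_equation_def)
      then have "(\<Sum>k\<in>UNIV. N $ i $ k * E k j t + conv (\<lambda>s. F s $ i $ k) (E k j) t)
        = ((\<Sum>k\<in>UNIV. N $ i $ k * D t $ k $ j) + (\<Sum>k\<in>UNIV. conv (\<lambda>s. F s $ i $ k) (\<lambda>s. D s $ k $ j) t))
        - ((\<Sum>k\<in>UNIV. N $ i $ k * C t $ k $ j) + (\<Sum>k\<in>UNIV. conv (\<lambda>s. F s $ i $ k) (\<lambda>s. C s $ k $ j) t))"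
        by (simp add: E_def sum.distrib sum_subtractf right_diff_distrib)
      moreover have "(\<Sum>k\<in>UNIV. N $ i $ k * D t $ k $ j) + (\<Sum>k\<in>UNIV. conv (\<lambda>s. F s $ i $ k) (\<lambda>s. D s $ k $ j) t) = 2 * t * of_bool (i = j)"
        "(\<Sum>k\<in>UNIV. N $ i $ k * C t $ k $ j) + (\<Sum>k\<in>UNIV. conv (\<lambda>s. F s $ i $ k) (\<lambda>s. C s $ k $ j) t) = 2 * t * of_bool (i = j)"
        using elim solves[OF t] t by (simp_all only: matrix_equation_def)
      ultimately show "(\<Sum>k\<in>UNIV. N $ i $ k * E k j t + conv (\<lambda>s. F s $ i $ k) (E k j) t) = 0" by simp
    qed
  qed
  have conv0: "(\<Sum>k\<in>UNIV. N $ i $ k * conv (\<lambda>s. C s $ l $ i) (E k j) t + conv (conv (\<lambda>s. C s $ l $ i) (\<lambda>s. F s $ i $ k)) (E k j) t) = 0" for i j l t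
  proof -
    let ?C = "\<lambda>s. C s $ l $ i"
    have FE: "locally_integrable (conv (\<lambda>s. F s $ i $ k) (E k j))" for k by (intro conv_AE_exists F_int E)
    have "conv ?C (\<lambda>s. \<Sum>k\<in>UNIV. N $ i $ k * E k j s + conv (\<lambda>s. F s $ i $ k) (E k j) s) t = conv ?C (\<lambda>_. 0) t"
      by (rule conv_AE_cong(1)[OF z])
    moreover have "conv ?C (\<lambda>s. N $ i $ k * E k j s + conv (\<lambda>s. F s $ i $ k) (E k j) s) t
       = N $ i $ k * conv ?C (E k j) t + conv (conv ?C (\<lambda>s. F s $ i $ k)) (E k j) t"
     and "conv_exists ?C (\<lambda>s. N $ i $ k * E k j s + conv (\<lambda>s. F s $ i $ k) (E k j) s) t" for k
      using conv_add_right[of ?C "\<lambda>s. N $ i $ k * E k j s" t "conv (\<lambda>s. F s $ i $ k) (E k j)"]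
        conv_exists_bounded[OF C_int C_bdd locally_integrable_mult[OF E]] conv_exists_bounded[OF C_int C_bdd FE]
      by (simp_all add: conv_mult_right conv_assoc[OF C_int C_bdd F_int E])
    ultimately show ?thesis
      using conv_sum_right[of UNIV ?C "\<lambda>k s. N $ i $ k * E k j s + conv (\<lambda>s. F s $ i $ k) (E k j) s" t]
      by (simp add: conv_zero_right)
  qed
  \<comment> \<open>No bound is at hand for either factor of these convolutions, so their existence
    is taken almost everywhere, which suffices for \<open>linear_conv_zero\<close>.\<close>
  have ex: "AE t in lebesgue. \<forall>i k. conv_exists (conv (\<lambda>s. C s $ l $ i) (\<lambda>s. F s $ i $ k)) (E k j) t" for l j
    by (intro eventually_all_finite conv_AE_exists(1) conv_AE_exists(2) C_int F_int E)
  have "AE t in lebesgue. 0 < t \<longrightarrow> E l j t = 0" for l j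
  proof (rule linear_conv_zero(2)[OF E, where q=0])
    show "AE t in lebesgue. 0 < t \<longrightarrow> 0 * t + conv (\<lambda>s. s) (E l j) t = 0"
      using ex[of l j]
    proof eventually_elim
      case (elim t)
      \<comment> \<open>Summed over \<open>i\<close>, this is the (l, k) entry of C N + C \<star>
        F.\<close>
      let ?G = "\<lambda>k i s. N $ i $ k * C s $ l $ i + conv (\<lambda>s. C s $ l $ i) (\<lambda>s. F s $ i $ k) s"
      have G: "conv (?G k i) (E k j) t = N $ i $ k * conv (\<lambda>s. C s $ l $ i) (E k j) t + conv (conv (\<lambda>s. C s $ l $ i) (\<lambda>s. F s $ i $ k)) (E k j) t"
        "conv_exists (?G k i) (E k j) t" for i k
        using conv_add_left[of "\<lambda>s. N $ i $ k * C s $ l $ i" "E k j" t "conv (\<lambda>s. C s $ l $ i) (\<lambda>s. F s $ i $ k)"] elim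
          conv_exists_mult(2)[OF conv_exists_bounded[OF C_int C_bdd E]]
        by (simp_all add: conv_mult_left)
      have "0 = (\<Sum>i\<in>UNIV. \<Sum>k\<in>UNIV. conv (?G k i) (E k j) t)" unfolding G(1) by (simp add: conv0)
      also have "\<dots> = (\<Sum>k\<in>UNIV. \<Sum>i\<in>UNIV. conv (?G k i) (E k j) t)" by (rule sum.swap)
      also have "\<dots> = (\<Sum>k\<in>UNIV. conv (\<lambda>s. \<Sum>i\<in>UNIV. ?G k i s) (E k j) t)"
        using conv_sum_left[of UNIV "?G _" "E _ j" t] G(2) by simp
      also have "\<dots> = (\<Sum>k\<in>UNIV. conv (\<lambda>s. 2 * of_bool (l = k) * s) (E k j) t)"
        by (intro sum.cong refl conv_cong_pos) (use transposed_equation in \<open>auto simp: mult_ac\<close>)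
      also have "\<dots> = 2 * conv (\<lambda>s. s) (E l j) t"
      proof -
        have "conv (\<lambda>s. 2 * of_bool (l = k) * s) (E k j) t = (if l = k then 2 * conv (\<lambda>s. s) (E l j) t else 0)" for k
          unfolding conv_mult_left by simp
        then show ?thesis by simp
      qed
      finally show ?case by simp
    qed
  qed
  then have "AE t in lebesgue. \<forall>l j. 0 < t \<longrightarrow> E l j t = 0" by (intro eventually_all_finite)
  then show ?thesis by eventually_elim (auto simp: E_def vec_eq_iff)
qed

text \<open>With Q = M - N and P = G - F one has Q C + P \<star> C = 0. Multiplying by N from the
  right and adding the convolution with F gives Q (C N + C \<star> F) + P \<star> (C N + C \<star>
  F) = 0, that is, 2(Q t + P \<star> t) = 0; the constant and the function part then vanish
  separately.\<close>

lemma unique_kernel: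
  assumes G: "\<And>i j. locally_integrable (\<lambda>t. G t $ i $ j)"
    and eq: "AE t in lebesgue. 0 < t \<longrightarrow> matrix_equation M G C t"
  shows "M = N" and "AE t in lebesgue. 0 < t \<longrightarrow> G t = F t"
proof -
  define P where "P i k s = G s $ i $ k - F s $ i $ k" for i k s
  define Q where "Q i k = M $ i $ k - N $ i $ k" for i k
  have P: "locally_integrable (P i k)" for i k unfolding P_def by (intro locally_integrable_diff G F_int)
  define Z where "Z i j t = (\<Sum>k\<in>UNIV. Q i k * C t $ k $ j + conv (P i k) (\<lambda>s. C s $ k $ j) t)" for i j t
  have z: "AE t in lebesgue. 0 < t \<longrightarrow> Z i j t = 0" for i j
    using eq
  proof eventually_elim
    case (elim t)
    show ?case
    proof
      assume t: "0 < t"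
      have "conv (P i k) (\<lambda>s. C s $ k $ j) t = conv (\<lambda>s. G s $ i $ k) (\<lambda>s. C s $ k $ j) t - conv (\<lambda>s. F s $ i $ k) (\<lambda>s. C s $ k $ j) t" for k
        unfolding P_def using elim solves[OF t] t by (intro conv_diff_left) (auto simp: matrix_equation_def)
      then have "Z i j t
        = ((\<Sum>k\<in>UNIV. M $ i $ k * C t $ k $ j) + (\<Sum>k\<in>UNIV. conv (\<lambda>s. G s $ i $ k) (\<lambda>s. C s $ k $ j) t))
        - ((\<Sum>k\<in>UNIV. N $ i $ k * C t $ k $ j) + (\<Sum>k\<in>UNIV. conv (\<lambda>s. F s $ i $ k) (\<lambda>s. C s $ k $ j) t))"
        by (simp add: Z_def Q_def sum.distrib sum_subtractf left_diff_distrib)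
      moreover have "(\<Sum>k\<in>UNIV. M $ i $ k * C t $ k $ j) + (\<Sum>k\<in>UNIV. conv (\<lambda>s. G s $ i $ k) (\<lambda>s. C s $ k $ j) t) = 2 * t * of_bool (i = j)"
        "(\<Sum>k\<in>UNIV. N $ i $ k * C t $ k $ j) + (\<Sum>k\<in>UNIV. conv (\<lambda>s. F s $ i $ k) (\<lambda>s. C s $ k $ j) t) = 2 * t * of_bool (i = j)"
        using elim solves[OF t] t by (simp_all only: matrix_equation_def)
      ultimately show "Z i j t = 0" by simp
    qed
  qed
  have PC: "locally_integrable (conv (P i k) (\<lambda>s. C s $ k $ j))" for i k j by (intro conv_AE_exists P C_int)
  have CF: "locally_integrable (conv (\<lambda>s. C s $ k $ j) (\<lambda>s. F s $ j $ l))" for k j l by (intro conv_AE_exists C_int F_int)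
  \<comment> \<open>Neither \<open>F\<close> nor \<open>P\<close> is known to be locally bounded;
    commuting the scalar convolutions keeps \<open>C\<close> in front whenever brackets
    move.\<close>
  have assoc: "conv (\<lambda>s. F s $ j $ l) (conv (P i k) (\<lambda>s. C s $ k $ j)) t = conv (P i k) (conv (\<lambda>s. C s $ k $ j) (\<lambda>s. F s $ j $ l)) t" for i j k l t
  proof -
    let ?F = "\<lambda>s. F s $ j $ l" and ?C = "\<lambda>s. C s $ k $ j" and ?P = "P i k"
    have "conv ?F (conv ?P ?C) t = conv (conv ?P ?C) ?F t" by (rule conv_commute(1)[OF F_int PC])
    also have "\<dots> = conv (conv ?C ?P) ?F t" by (rule arg_cong[where f="\<lambda>q. conv q ?F t"], rule ext, rule conv_commute(1)[OF P C_int])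
    also have "conv (conv ?C ?P) ?F t = conv ?C (conv ?P ?F) t" by (rule conv_assoc[OF C_int C_bdd P F_int, symmetric])
    also have "\<dots> = conv ?C (conv ?F ?P) t" by (rule arg_cong[where f="\<lambda>q. conv ?C q t"], rule ext, rule conv_commute(1)[OF P F_int])
    also have "conv ?C (conv ?F ?P) t = conv (conv ?C ?F) ?P t" by (rule conv_assoc[OF C_int C_bdd F_int P])
    also have "\<dots> = conv ?P (conv ?C ?F) t" by (rule conv_commute(1)[OF CF P])
    finally show ?thesis .
  qed
  have exFC: "conv_exists (\<lambda>s. F s $ j $ l) (\<lambda>s. C s $ k $ j) t" for j k l t
    using conv_exists_bounded[OF C_int C_bdd F_int] conv_commute(2)[OF F_int C_int] by blast
  have exPC: "conv_exists (P i k) (\<lambda>s. C s $ k $ j) t" for i j k t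
    using conv_exists_bounded[OF C_int C_bdd P] conv_commute(2)[OF P C_int] by blast
  have "AE t in lebesgue. 0 < t \<longrightarrow> Q i l * t + conv (\<lambda>s. s) (P i l) t = 0" for i l
  proof -
    have e1: "AE t in lebesgue. \<forall>j k. conv_exists (\<lambda>s. F s $ j $ l) (conv (P i k) (\<lambda>s. C s $ k $ j)) t"
      by (intro eventually_all_finite conv_AE_exists(1) F_int PC)
    have e2: "AE t in lebesgue. \<forall>j k. conv_exists (P i k) (conv (\<lambda>s. C s $ k $ j) (\<lambda>s. F s $ j $ l)) t"
      by (intro eventually_all_finite conv_AE_exists(1) P CF)
    have z': "AE t in lebesgue. \<forall>j. 0 < t \<longrightarrow> Z i j t = 0" by (intro eventually_all_finite z)
    show ?thesis
      using e1 e2 z'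
    proof eventually_elim
      case (elim t)
      show ?case
      proof
        assume t: "0 < t"
        let ?C = "\<lambda>k j s. C s $ k $ j" and ?F = "\<lambda>j s. F s $ j $ l"
        let ?G = "\<lambda>k j s. N $ j $ l * C s $ k $ j + conv (?C k j) (?F j) s"
        have FZ: "conv (?F j) (Z i j) t = (\<Sum>k\<in>UNIV. Q i k * conv (?C k j) (?F j) t + conv (P i k) (conv (?C k j) (?F j)) t)" for j
        proof -
          have "conv (?F j) (\<lambda>s. Q i k * C s $ k $ j + conv (P i k) (?C k j) s) t
            = Q i k * conv (?C k j) (?F j) t + conv (P i k) (conv (?C k j) (?F j)) t"
            "conv_exists (?F j) (\<lambda>s. Q i k * C s $ k $ j + conv (P i k) (?C k j) s) t" for k
            using conv_add_right[of "?F j" "\<lambda>s. Q i k * C s $ k $ j" t "conv (P i k) (?C k j)"] elim(1)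
              conv_exists_mult(1)[OF exFC[of j l k]]
            by (simp_all add: conv_mult_right assoc conv_commute(1)[OF F_int C_int])
          then show ?thesis
            using conv_sum_right[of UNIV "?F j" "\<lambda>k s. Q i k * C s $ k $ j + conv (P i k) (?C k j) s" t]
            by (simp add: Z_def[abs_def])
        qed
        have "conv (?F j) (Z i j) t = 0" for j
          using conv_AE_cong(1)[OF z[of i j], of "?F j" t] by (simp add: conv_zero_right)
        \<comment> \<open>The (i, l) entry of Z N + Z \<star> F, which vanishes because Z
          does.\<close>
        then have "0 = (\<Sum>j\<in>UNIV. Z i j t * N $ j $ l + conv (?F j) (Z i j) t)" using elim(3) t by simp
        also have "\<dots> = (\<Sum>j\<in>UNIV. \<Sum>k\<in>UNIV. Q i k * ?G k j t + (N $ j $ l * conv (P i k) (?C k j) t + conv (P i k) (conv (?C k j) (?F j)) t))"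
          unfolding FZ Z_def sum_distrib_right sum.distrib[symmetric] by (intro sum.cong refl) (simp add: algebra_simps)
        also have "\<dots> = (\<Sum>k\<in>UNIV. \<Sum>j\<in>UNIV. Q i k * ?G k j t + (N $ j $ l * conv (P i k) (?C k j) t + conv (P i k) (conv (?C k j) (?F j)) t))"
          by (rule sum.swap)
        also have "\<dots> = (\<Sum>k\<in>UNIV. Q i k * (\<Sum>j\<in>UNIV. ?G k j t) + conv (P i k) (\<lambda>s. \<Sum>j\<in>UNIV. ?G k j s) t)"
        proof (rule sum.cong[OF refl])
          fix k
          have c: "conv (P i k) (?G k j) t = N $ j $ l * conv (P i k) (?C k j) t + conv (P i k) (conv (?C k j) (?F j)) t"
            "conv_exists (P i k) (?G k j) t" for j
            using conv_add_right[of "P i k" "\<lambda>s. N $ j $ l * C s $ k $ j" t "conv (?C k j) (?F j)"] elim(2)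
              conv_exists_mult(1)[OF exPC[of i k j]]
            by (simp_all add: conv_mult_right)
          have S: "conv (P i k) (\<lambda>s. \<Sum>j\<in>UNIV. ?G k j s) t
            = (\<Sum>j\<in>UNIV. N $ j $ l * conv (P i k) (?C k j) t + conv (P i k) (conv (?C k j) (?F j)) t)"
            unfolding c(1)[symmetric] by (rule conv_sum_right[THEN conjunct1]) (simp_all add: c(2))
          show "(\<Sum>j\<in>UNIV. Q i k * ?G k j t + (N $ j $ l * conv (P i k) (?C k j) t + conv (P i k) (conv (?C k j) (?F j)) t))
              = Q i k * (\<Sum>j\<in>UNIV. ?G k j t) + conv (P i k) (\<lambda>s. \<Sum>j\<in>UNIV. ?G k j s) t"
            unfolding S sum_distrib_left[of "Q i k"] sum.distrib[of "\<lambda>j. Q i k * ?G k j t", symmetric] ..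
        qed
        also have "\<dots> = (\<Sum>k\<in>UNIV. Q i k * (2 * t * of_bool (k = l)) + conv (P i k) (\<lambda>s. 2 * of_bool (k = l) * s) t)"
        proof (intro sum.cong refl arg_cong2[where f="(+)"] arg_cong2[where f="(*)"] transposed_equation t conv_cong_pos)
          show "(\<Sum>j\<in>UNIV. ?G k j s) = 2 * of_bool (k = l) * s" if "0 < s" for k s
            using transposed_equation[OF that] by simp
        qed
        also have "\<dots> = 2 * (Q i l * t + conv (P i l) (\<lambda>s. s) t)"
        proof -
          have "Q i k * (2 * t * of_bool (k = l)) + conv (P i k) (\<lambda>s. 2 * of_bool (k = l) * s) t
            = (if k = l then 2 * (Q i l * t + conv (P i l) (\<lambda>s. s) t) else 0)" for k
            unfolding conv_mult_right by (simp add: algebra_simps)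
          then show ?thesis by simp
        qed
        also have "conv (P i l) (\<lambda>s. s) t = conv (\<lambda>s. s) (P i l) t"
          by (rule conv_commute(1)[OF P]) (rule locally_integrable_continuous, simp)
        finally show "Q i l * t + conv (\<lambda>s. s) (P i l) t = 0" by simp
      qed
    qed
  qed
  note zero = linear_conv_zero[OF P this]
  have "Q i l = 0" for i l by (rule zero(1))
  then show "M = N" by (simp add: Q_def vec_eq_iff)
  have "AE t in lebesgue. \<forall>i k. 0 < t \<longrightarrow> P i k t = 0" by (intro eventually_all_finite zero(2))
  then show "AE t in lebesgue. 0 < t \<longrightarrow> G t = F t" by eventually_elim (auto simp: P_def vec_eq_iff)
qed

end

section \<open>Tensors and \<open>6 \<times> 6\<close> matrices\<close>

lemma UNIV_6: "(UNIV :: 6 set) = {1, 2, 3, 4, 5, 6}"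
proof -
  have "card (UNIV :: 6 set) = 6" by simp
  have "x \<in> {1, 2, 3, 4, 5, 6}" for x :: 6
  proof (induct x)
    case (of_int z)
    \<comment> \<open>In this type the numeral 6 is the residue 0.\<close>
    then have "z = 0 \<or> z = 1 \<or> z = 2 \<or> z = 3 \<or> z = 4 \<or> z = 5" by fastforce
    then show ?case by auto
  qed
  then show ?thesis by auto
qed

text \<open>A left inverse of \<open>idx_pair\<close> that ignores the order of the pair.\<close>

definition pair_idx :: "3 \<Rightarrow> 3 \<Rightarrow> 6" where
  "pair_idx i j = (if i = j then (if i = 1 then 1 else if i = 2 then 2 else 3)
     else if i = 1 \<and> j = 2 \<or> i = 2 \<and> j = 1 then 6 else if i = 1 \<or> j = 1 then 5 else 4)"

lemma forall_6: "(\<forall>I::6. P I) \<longleftrightarrow> P 1 \<and> P 2 \<and> P 3 \<and> P 4 \<and> P 5 \<and> P 6"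
proof -
  have "(\<forall>I::6. P I) \<longleftrightarrow> (\<forall>I\<in>UNIV. P I)" by simp
  then show ?thesis unfolding UNIV_6 by simp
qed

lemma sum_6: "(\<Sum>I\<in>(UNIV::6 set). f I) = f 1 + f 2 + f 3 + f 4 + f 5 + f 6"
  unfolding UNIV_6 by (simp add: add.assoc)

lemma pair_idx_idx_pair: "pair_idx (fst (idx_pair I)) (snd (idx_pair I)) = I"
proof -
  have "\<forall>I. pair_idx (fst (idx_pair I)) (snd (idx_pair I)) = I"
    unfolding forall_6 by (simp add: pair_idx_def idx_pair_def)
  then show ?thesis ..
qed

lemma idx_pair_pair_idx: "idx_pair (pair_idx i j) = (i, j) \<or> idx_pair (pair_idx i j) = (j, i)"
proof -
  have "\<forall>i j. idx_pair (pair_idx i j) = (i, j) \<or> idx_pair (pair_idx i j) = (j, i)"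
    unfolding forall_3 by (simp add: pair_idx_def idx_pair_def)
  then show ?thesis by blast
qed

lemma pair_idx_commute: "pair_idx i j = pair_idx j i"
  by (auto simp: pair_idx_def)

lemma idx_factor_pos: "0 < idx_factor I"
  by (simp add: idx_factor_def)

text \<open>The reason for the factor \<open>sqrt 2\<close>: each off-diagonal pair occurs twice in
  the double sum, and its squared weight is 2.\<close>

lemma sum_pair_idx: "(\<Sum>l\<in>UNIV. \<Sum>m\<in>UNIV. Y (pair_idx l m) / (idx_factor (pair_idx l m))\<^sup>2) = (\<Sum>K\<in>UNIV. Y K :: real)"
  unfolding sum_3 sum_6 by (simp add: pair_idx_def idx_factor_def)

text \<open>On diagonal pairs both products contribute, giving 2; on off-diagonal pairs only one
  does, and 2 divided by the two weights is 1.\<close>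

lemma identity_tensor:
  "of_bool (j = r) * of_bool (k = s) + of_bool (j = s) * of_bool (k = r)
    = 2 * of_bool (pair_idx j k = pair_idx r s) / (idx_factor (pair_idx j k) * idx_factor (pair_idx r s))"
proof -
  have "\<forall>j k r s. of_bool (j = r) * of_bool (k = s) + of_bool (j = s) * of_bool (k = r)
    = 2 * of_bool (pair_idx j k = pair_idx r s) / (idx_factor (pair_idx j k) * idx_factor (pair_idx r s))"
    unfolding forall_3 by (simp add: pair_idx_def idx_factor_def)
  then show ?thesis by blast
qed

text \<open>Dividing by the weights inverts \<open>mat6\<close> on tensors with the symmetries;
  \<open>vec6\<close> and \<open>ten2\<close> do this for symmetric rank-2 tensors, with weights
  that make the quadratic forms agree.\<close>

definition ten4 :: "real^6^6 \<Rightarrow> tensor4" where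
  "ten4 M = (\<chi> i j k l. M $ pair_idx i j $ pair_idx k l / (idx_factor (pair_idx i j) * idx_factor (pair_idx k l)))"

definition vec6 :: "tensor2 \<Rightarrow> real^6" where
  "vec6 e = (\<chi> I. idx_factor I * e $ fst (idx_pair I) $ snd (idx_pair I))"

definition ten2 :: "real^6 \<Rightarrow> tensor2" where
  "ten2 v = (\<chi> i j. v $ pair_idx i j / idx_factor (pair_idx i j))"

lemma idx_factor_nonzero: "idx_factor I \<noteq> 0"
  using idx_factor_pos[of I] by simp

lemma tensor_entry:
  assumes "sym4 R"
  shows "R $ i $ j $ k $ l = mat6 R $ pair_idx i j $ pair_idx k l / (idx_factor (pair_idx i j) * idx_factor (pair_idx k l))"
proof -
  have 1: "R $ a $ b $ c $ d = R $ b $ a $ c $ d" "R $ a $ b $ c $ d = R $ c $ d $ a $ b" for a b c d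
    using assms unfolding sym4_def by blast+
  then have 2: "R $ a $ b $ c $ d = R $ a $ b $ d $ c" for a b c d by metis
  show ?thesis
    using idx_pair_pair_idx[of i j] idx_pair_pair_idx[of k l] 1(1)[of i j] 2[of _ _ k l]
    by (auto simp: mat6_def idx_factor_nonzero)
qed

lemma ten4_mat6: "sym4 R \<Longrightarrow> ten4 (mat6 R) = R"
  by (simp add: vec_eq_iff ten4_def tensor_entry)

lemma mat6_ten4: "mat6 (ten4 M) = M"
  by (simp add: vec_eq_iff mat6_def ten4_def pair_idx_idx_pair idx_factor_nonzero)

lemma sym4_ten4: "transpose M = M \<Longrightarrow> sym4 (ten4 M)"
  using symmetric_component[of M]
  by (auto simp: sym4_def ten4_def pair_idx_commute mult.commute)

lemma mat6_symmetric:
  assumes "sym4 R"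
  shows "transpose (mat6 R) = mat6 R"
proof -
  have "R $ a $ b $ c $ d = R $ c $ d $ a $ b" for a b c d using assms unfolding sym4_def by blast
  then show ?thesis by (simp add: transpose_def vec_eq_iff mat6_def mult.commute)
qed

lemma sym2_ten2: "sym2 (ten2 v)"
  by (simp add: sym2_def ten2_def transpose_def vec_eq_iff pair_idx_commute)

lemma vec6_ten2: "vec6 (ten2 v) = v"
  by (simp add: vec_eq_iff vec6_def ten2_def pair_idx_idx_pair idx_factor_nonzero)

lemma qform_mat6:
  assumes R: "sym4 R" and e: "sym2 e"
  shows "qform R e = form (mat6 R) (vec6 e)"
proof -
  have e': "e $ i $ j = vec6 e $ pair_idx i j / idx_factor (pair_idx i j)" for i j
    using idx_pair_pair_idx[of i j] symmetric_component[OF e[unfolded sym2_def], of i j]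
    by (auto simp: vec6_def idx_factor_nonzero)
  let ?T = "\<lambda>I J. mat6 R $ I $ J * vec6 e $ I * vec6 e $ J"
  have "qform R e = (\<Sum>i\<in>UNIV. \<Sum>j\<in>UNIV. (\<Sum>k\<in>UNIV. \<Sum>l\<in>UNIV. ?T (pair_idx i j) (pair_idx k l) / (idx_factor (pair_idx k l))\<^sup>2) / (idx_factor (pair_idx i j))\<^sup>2)"
    unfolding qform_def tensor_entry[OF R] e' sum_divide_distrib
    by (intro sum.cong refl) (simp add: power2_eq_square)
  also have "\<dots> = (\<Sum>I\<in>UNIV. \<Sum>J\<in>UNIV. ?T I J)"
  proof -
    have "(\<Sum>k\<in>UNIV. \<Sum>l\<in>UNIV. ?T I (pair_idx k l) / (idx_factor (pair_idx k l))\<^sup>2) = (\<Sum>J\<in>UNIV. ?T I J)" for I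
      by (rule sum_pair_idx[of "?T I"])
    then show ?thesis unfolding sum_pair_idx[of "\<lambda>I. \<Sum>J\<in>UNIV. ?T I J", symmetric] by (simp only:)
  qed
  finally show ?thesis by (simp add: form_expand mult_ac)
qed

lemma form_mat6: "sym4 R \<Longrightarrow> form (mat6 R) v = qform R (ten2 v)"
  using qform_mat6[OF _ sym2_ten2, of R v] by (simp add: vec6_ten2)

lemma psd_matrix_mat6: "sym4 N \<Longrightarrow> psd4 N \<Longrightarrow> psd_matrix (mat6 N)"
  using sym2_ten2 by (simp add: psd_matrix_def mat6_symmetric form_mat6 psd4_def)

lemma psd4_ten4: "psd_matrix M \<Longrightarrow> psd4 (ten4 M)"
  by (simp add: psd4_def psd_matrix_def qform_mat6 sym4_ten4 mat6_ten4)

lemma tendsto_mat6: "(C \<longlongrightarrow> A) F \<Longrightarrow> ((\<lambda>t. mat6 (C t)) \<longlongrightarrow> mat6 A) F"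
  unfolding mat6_def by (intro vec_tendstoI) (simp, intro tendsto_intros)

lemma tendsto_ten4: "(C \<longlongrightarrow> A) F \<Longrightarrow> ((\<lambda>t. ten4 (C t)) \<longlongrightarrow> ten4 A) F"
  unfolding ten4_def by (intro vec_tendstoI) (simp, intro tendsto_intros, simp_all add: idx_factor_nonzero)

lemma bernstein_cong:
  assumes f: "bernstein f" and eq: "\<And>t. 0 < t \<Longrightarrow> f t = g t"
  shows "bernstein g"
proof -
  have d: "(g has_real_derivative deriv f t) (at t)" if "0 < t" for t
    by (rule has_field_derivative_transform_within_open[OF bernstein_deriv(1)[OF f that], of "{0<..}"]) (use that eq in auto)
  have "completely_monotone (deriv g)"
    by (rule completely_monotone_cong[of "deriv f"]) (use f d in \<open>auto simp: bernstein_def intro: DERIV_imp_deriv[symmetric]\<close>)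
  then show ?thesis using d eq bernstein_deriv(3)[OF f] by (auto simp: bernstein_def real_differentiable_def)
qed

lemma tensor_bernstein_mat6:
  assumes "tensor_bernstein C"
  shows "matrix_bernstein (\<lambda>t. mat6 (C t))"
  unfolding matrix_bernstein_def
proof (intro conjI allI impI)
  have s: "sym4 (C t)" if "0 < t" for t using assms that by (simp add: tensor_bernstein_def)
  then show "transpose (mat6 (C t)) = mat6 (C t)" if "0 < t" for t using that by (simp add: mat6_symmetric)
  show "bernstein (\<lambda>t. form (mat6 (C t)) v)" for v
    by (rule bernstein_cong[of "\<lambda>t. qform (C t) (ten2 v)"])
      (use assms s in \<open>auto simp: tensor_bernstein_def sym2_ten2 form_mat6\<close>)
  show "((\<lambda>t. mat6 (C t)) \<longlongrightarrow> mat6 (C 0)) (at_right 0)"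
    using assms by (intro tendsto_mat6) (simp add: tensor_bernstein_def)
qed

lemma tensor_bernstein_ten4:
  assumes C: "matrix_bernstein C"
  shows "tensor_bernstein (\<lambda>t. ten4 (C t))"
  unfolding tensor_bernstein_def
proof (intro conjI allI impI)
  have s: "transpose (C t) = C t" if "0 < t" for t using C that by (simp add: matrix_bernstein_def)
  then show "sym4 (ten4 (C t))" if "0 < t" for t using that by (simp add: sym4_ten4)
  show "bernstein (\<lambda>t. qform (ten4 (C t)) e)" if "sym2 e" for e
    by (rule bernstein_cong[of "\<lambda>t. form (C t) (vec6 e)"])
      (use C s that in \<open>auto simp: matrix_bernstein_def qform_mat6 sym4_ten4 mat6_ten4\<close>)
  show "((\<lambda>t. ten4 (C t)) \<longlongrightarrow> ten4 (C 0)) (at_right 0)"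
    using C by (intro tendsto_ten4) (simp add: matrix_bernstein_def)
qed

lemma tensor_LICM_mat6:
  assumes F: "tensor_LICM F"
  shows "cm_matrix (\<lambda>t. mat6 (F t))" and "locally_integrable (\<lambda>t. mat6 (F t) $ i $ j)"
proof -
  have s: "sym4 (F t)" if "0 < t" for t using F that by (simp add: tensor_LICM_def)
  have L: "LICM (\<lambda>t. qform (F t) (ten2 v))" for v using F by (simp add: tensor_LICM_def sym2_ten2)
  show "cm_matrix (\<lambda>t. mat6 (F t))"
    unfolding cm_matrix_def
  proof (intro conjI allI impI)
    show "transpose (mat6 (F t)) = mat6 (F t)" if "0 < t" for t using s[OF that] by (rule mat6_symmetric)
    show "completely_monotone (\<lambda>t. form (mat6 (F t)) v)" for v
      by (rule completely_monotone_cong[of "\<lambda>t. qform (F t) (ten2 v)"])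
        (use L s in \<open>auto simp: LICM_def form_mat6\<close>)
  qed
  let ?q = "\<lambda>v t. qform (F t) (ten2 v)"
  have "locally_integrable (\<lambda>t. (1 / 2) * (?q (axis i 1 + axis j 1) t - ?q (axis i 1) t - ?q (axis j 1) t))"
    by (intro locally_integrable_mult locally_integrable_diff LICM_locally_integrable L)
  moreover have "mat6 (F t) $ i $ j = (1 / 2) * (?q (axis i 1 + axis j 1) t - ?q (axis i 1) t - ?q (axis j 1) t)" if "0 < t" for t
    using matrix_entry_polar[OF mat6_symmetric[OF s[OF that]], of i j] s[OF that] by (simp add: form_mat6)
  ultimately show "locally_integrable (\<lambda>t. mat6 (F t) $ i $ j)"
    by (subst locally_integrable_AE_cong) auto
qed

lemma tensor_LICM_ten4:
  assumes F: "cm_matrix F" "\<And>t. transpose (F t) = F t" "\<And>i j. locally_integrable (\<lambda>t. F t $ i $ j)"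
  shows "tensor_LICM (\<lambda>t. ten4 (F t))"
  unfolding tensor_LICM_def
proof (intro conjI allI impI)
  show "sym4 (ten4 (F t))" for t using F(2) by (rule sym4_ten4)
  show "LICM (\<lambda>t. qform (ten4 (F t)) e)" if e: "sym2 e" for e
  proof -
    have "locally_integrable (\<lambda>t. form (F t) (vec6 e))"
      unfolding form_expand by (intro locally_integrable_sum locally_integrable_mult F(3)) auto
    then have "LICM (\<lambda>t. form (F t) (vec6 e))"
      using F(1) by (intro locally_integrable_LICM) (simp_all add: cm_matrix_def)
    then show ?thesis by (simp add: qform_mat6 sym4_ten4 F(2) e mat6_ten4)
  qed
qed

text \<open>The weights at the contracted pair combine to the inverse square that
  \<open>sum_pair_idx\<close> absorbs; those at the free pairs match the ones in
  \<open>identity_tensor\<close> and cancel. Symmetry at positive times is enough for the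
  convolutions, since the endpoints are null.\<close>

lemma equation_at_iff:
  assumes N: "sym4 N" and F: "\<And>s. 0 < s \<Longrightarrow> sym4 (F s)" and C: "\<And>s. 0 < s \<Longrightarrow> sym4 (C s)" and t: "0 < t"
  shows "equation_at N F C t \<longleftrightarrow> matrix_equation (mat6 N) (\<lambda>s. mat6 (F s)) (\<lambda>s. mat6 (C s)) t"
proof -
  let ?p = pair_idx and ?f = "\<lambda>i j. idx_factor (pair_idx i j)"
  let ?F = "\<lambda>I K s. mat6 (F s) $ I $ K" and ?C = "\<lambda>K J s. mat6 (C s) $ K $ J"
  have cv: "conv (\<lambda>u. F u $ j $ k $ l $ m) (\<lambda>u. C u $ l $ m $ r $ s) t
      = conv (?F (?p j k) (?p l m)) (?C (?p l m) (?p r s)) t / (?f l m)\<^sup>2 / (?f j k * ?f r s)"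
    and ce: "conv_exists (\<lambda>u. F u $ j $ k $ l $ m) (\<lambda>u. C u $ l $ m $ r $ s) t
      \<longleftrightarrow> conv_exists (?F (?p j k) (?p l m)) (?C (?p l m) (?p r s)) t" for j k l m r s
  proof -
    let ?a = "1 / (?f j k * ?f l m)" and ?b = "1 / (?f l m * ?f r s)"
    let ?F' = "?F (?p j k) (?p l m)" and ?C' = "?C (?p l m) (?p r s)"
    have 1: "F u $ j $ k $ l $ m = ?a * ?F' u" "C u $ l $ m $ r $ s = ?b * ?C' u" if "0 < u" for u
      using tensor_entry[OF F[OF that]] tensor_entry[OF C[OF that]] by simp_all
    have "conv (\<lambda>u. F u $ j $ k $ l $ m) (\<lambda>u. C u $ l $ m $ r $ s) t = conv (\<lambda>u. ?a * ?F' u) (\<lambda>u. ?b * ?C' u) t"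
      by (rule conv_cong_pos(1)) (rule 1, assumption)+
    then show "conv (\<lambda>u. F u $ j $ k $ l $ m) (\<lambda>u. C u $ l $ m $ r $ s) t
      = conv ?F' ?C' t / (?f l m)\<^sup>2 / (?f j k * ?f r s)"
      unfolding conv_mult_left conv_mult_right by (simp add: power2_eq_square)
    have "conv_exists (\<lambda>u. F u $ j $ k $ l $ m) (\<lambda>u. C u $ l $ m $ r $ s) t \<longleftrightarrow> conv_exists (\<lambda>u. ?a * ?F' u) (\<lambda>u. ?b * ?C' u) t"
      by (rule conv_cong_pos(2)) (rule 1, assumption)+
    also have "\<dots> \<longleftrightarrow> conv_exists ?F' ?C' t"
    proof
      assume "conv_exists (\<lambda>u. ?a * ?F' u) (\<lambda>u. ?b * ?C' u) t"
      from conv_exists_mult(2)[OF conv_exists_mult(1)[OF this, of "1 / ?b"], of "1 / ?a"]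
      show "conv_exists ?F' ?C' t" by (simp add: idx_factor_nonzero)
    qed (intro conv_exists_mult)
    finally show "conv_exists (\<lambda>u. F u $ j $ k $ l $ m) (\<lambda>u. C u $ l $ m $ r $ s) t \<longleftrightarrow> conv_exists ?F' ?C' t" .
  qed
  have prod: "N $ j $ k $ l $ m * C t $ l $ m $ r $ s
      = mat6 N $ ?p j k $ ?p l m * ?C (?p l m) (?p r s) t / (?f l m)\<^sup>2 / (?f j k * ?f r s)" for j k l m r s
    unfolding tensor_entry[OF N, of j] tensor_entry[OF C[OF t], of l] by (simp add: power2_eq_square)
  define S where "S I J = (\<Sum>K\<in>UNIV. mat6 N $ I $ K * ?C K J t) + (\<Sum>K\<in>UNIV. conv (?F I K) (?C K J) t)" for I J
  have sum: "(\<Sum>l\<in>UNIV. \<Sum>m\<in>UNIV. N $ j $ k $ l $ m * C t $ l $ m $ r $ s)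
     + (\<Sum>l\<in>UNIV. \<Sum>m\<in>UNIV. conv (\<lambda>u. F u $ j $ k $ l $ m) (\<lambda>u. C u $ l $ m $ r $ s) t) = S (?p j k) (?p r s) / (?f j k * ?f r s)" for j k r s
    unfolding prod cv sum_divide_distrib[symmetric] S_def
      sum_pair_idx[of "\<lambda>K. mat6 N $ ?p j k $ K * ?C K (?p r s) t"] sum_pair_idx[of "\<lambda>K. conv (?F (?p j k) K) (?C K (?p r s)) t"]
    by (simp add: add_divide_distrib)
  have eq: "S (?p j k) (?p r s) / (?f j k * ?f r s) = t * (of_bool (j = r) * of_bool (k = s) + of_bool (j = s) * of_bool (k = r))
      \<longleftrightarrow> S (?p j k) (?p r s) = 2 * t * of_bool (?p j k = ?p r s)" for j k r s
    unfolding identity_tensor by (simp add: field_simps idx_factor_nonzero)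
  have surj: "(\<forall>j k. Q (?p j k)) \<longleftrightarrow> (\<forall>I. Q I)" for Q :: "6 \<Rightarrow> bool"
  proof
    assume Q: "\<forall>j k. Q (?p j k)"
    show "\<forall>I. Q I"
    proof
      fix I from Q have "Q (?p (fst (idx_pair I)) (snd (idx_pair I)))" by blast
      then show "Q I" unfolding pair_idx_idx_pair .
    qed
  qed blast
  define P where "P I J \<longleftrightarrow> (\<forall>K. conv_exists (?F I K) (?C K J) t) \<and> S I J = 2 * t * of_bool (I = J)" for I J
  have "(\<forall>l m. conv_exists (?F I (?p l m)) (?C (?p l m) J) t) \<longleftrightarrow> (\<forall>K. conv_exists (?F I K) (?C K J) t)" for I J
    by (rule surj)
  then have "equation_at N F C t \<longleftrightarrow> (\<forall>j k r s. P (?p j k) (?p r s))"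
    unfolding equation_at_def ce sum eq P_def by (simp only:)
  also have "\<dots> \<longleftrightarrow> (\<forall>I J. P I J)"
    unfolding surj[of "P _"] by (rule surj)
  finally show ?thesis unfolding matrix_equation_def S_def P_def .
qed

text \<open>The entries may themselves be vectors, so that four applications descend to the
  components of a rank-4 tensor.\<close>

lemma absolutely_integrable_vec:
  fixes f :: "'a::euclidean_space \<Rightarrow> 'b::euclidean_space^'n"
  assumes "\<And>i. (\<lambda>x. f x $ i) absolutely_integrable_on S"
  shows "f absolutely_integrable_on S"
proof (rule absolutely_integrable_componentwise)
  fix b :: "'b^'n" assume "b \<in> Basis"
  then obtain i u where b: "b = axis i u" by (auto simp: Basis_vec_def)
  show "(\<lambda>x. f x \<bullet> b) absolutely_integrable_on S"
    unfolding b inner_axis by (rule absolutely_integrable_component[OF assms])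
qed

text \<open>Linear growth covers both uses: Bernstein functions are concave, and completely monotone
  functions are bounded on [1,\<infinity>[.\<close>

lemma laplace_integrable:
  fixes g :: "real \<Rightarrow> real"
  assumes g: "locally_integrable g" and cont: "continuous_on {0<..} g"
    and growth: "\<And>t. 1 \<le> t \<Longrightarrow> \<bar>g t\<bar> \<le> a * t" and p: "0 < p"
  shows "(\<lambda>t. exp (- p * t) * g t) absolutely_integrable_on {0..}"
proof -
  have "(\<lambda>t. exp (- p * t) * g t) absolutely_integrable_on {0..1}"
    by (rule absolutely_integrable_bounded_measurable_product_real[OF _ _ _ locally_integrableD[OF g]])
      (auto intro!: continuous_imp_measurable_on_sets_lebesgue continuous_intros compact_imp_bounded compact_continuous_image)
  moreover have "(\<lambda>t. exp (- p * t) * g t) absolutely_integrable_on {1..}"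
  proof (rule measurable_bounded_by_integrable_imp_absolutely_integrable)
    show "(\<lambda>t. exp (- p * t) * g t) \<in> borel_measurable (lebesgue_on {1..})"
      by (intro continuous_imp_measurable_on_sets_lebesgue continuous_intros continuous_on_subset[OF cont]) auto
    \<comment> \<open>Half of the exponent absorbs the linear factor, as t \<le> (2/p) exp(pt/2);
      the other half remains for integrability.\<close>
    show "(\<lambda>t. (2 * \<bar>a\<bar> / p) * exp (- (p / 2) * t)) integrable_on {1..}"
      using p by (intro integrable_on_mult_right integrable_on_exp_minus_to_infinity) auto
    fix t :: real assume t: "t \<in> {1..}"
    have "p * t / 2 \<le> exp (p * t / 2)" using exp_ge_add_one_self[of "p * t / 2"] by linarith
    then have "t \<le> 2 / p * exp (p / 2 * t)" using p by (simp add: field_simps)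
    then have "\<bar>a\<bar> * t \<le> \<bar>a\<bar> * (2 / p * exp (p / 2 * t))" by (intro mult_left_mono) auto
    moreover have "\<bar>g t\<bar> \<le> \<bar>a\<bar> * t"
    proof (rule order_trans)
      show "\<bar>g t\<bar> \<le> a * t" using growth t by simp
      show "a * t \<le> \<bar>a\<bar> * t" using t by (intro mult_right_mono) auto
    qed
    ultimately have "exp (- p * t) * \<bar>g t\<bar> \<le> exp (- p * t) * (\<bar>a\<bar> * (2 / p * exp (p / 2 * t)))"
      by (intro mult_left_mono) auto
    also have "\<dots> = (2 * \<bar>a\<bar> / p) * (exp (- p * t) * exp (p / 2 * t))" by simp
    also have "exp (- p * t) * exp (p / 2 * t) = exp (- (p / 2) * t)" by (simp add: exp_add[symmetric])
    finally show "norm (exp (- p * t) * g t) \<le> (2 * \<bar>a\<bar> / p) * exp (- (p / 2) * t)" by (simp add: abs_mult)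
  qed simp
  ultimately have "(\<lambda>t. exp (- p * t) * g t) absolutely_integrable_on ({0..1} \<union> {1..})" by (rule absolutely_integrable_Un)
  moreover have "{0..1} \<union> {1..} = {0::real..}" by auto
  ultimately show ?thesis by simp
qed

lemma admissible_ten4:
  assumes sym: "\<And>t. 0 < t \<Longrightarrow> transpose (M t) = M t"
    and int: "\<And>i j. locally_integrable (\<lambda>t. M t $ i $ j)" and cont: "\<And>i j. continuous_on {0<..} (\<lambda>t. M t $ i $ j)"
    and growth: "\<And>t i j. 1 \<le> t \<Longrightarrow> \<bar>M t $ i $ j\<bar> \<le> a * t"
  shows "admissible (\<lambda>t. ten4 (M t))"
  unfolding admissible_def
proof (intro conjI allI impI)
  show "sym4 (ten4 (M t))" if "0 < t" for t using sym[OF that] by (rule sym4_ten4)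
  have e: "ten4 (M t) $ i $ j $ k $ l = (1 / (idx_factor (pair_idx i j) * idx_factor (pair_idx k l))) * M t $ pair_idx i j $ pair_idx k l" for t i j k l
    by (simp add: ten4_def)
  show "(\<lambda>t. ten4 (M t)) absolutely_integrable_on {0..T}" for T
    by (intro absolutely_integrable_vec) (unfold e, intro set_integrable_mult_right locally_integrableD int)
  show "(\<lambda>t. exp (- p * t) *\<^sub>R ten4 (M t)) absolutely_integrable_on {0..}" if p: "0 < p" for p
  proof (intro absolutely_integrable_vec)
    fix i j k l
    have "(\<lambda>t. (1 / (idx_factor (pair_idx i j) * idx_factor (pair_idx k l))) * (exp (- p * t) * M t $ pair_idx i j $ pair_idx k l)) absolutely_integrable_on {0..}"
      by (intro set_integrable_mult_right laplace_integrable[OF int cont growth p])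
    then show "(\<lambda>t. (exp (- p * t) *\<^sub>R ten4 (M t)) $ i $ j $ k $ l) absolutely_integrable_on {0..}"
      by (simp add: e mult_ac)
  qed
qed

lemma admissible_mat6:
  assumes "admissible R"
  shows "locally_integrable (\<lambda>t. mat6 (R t) $ i $ j)"
  unfolding locally_integrable_def
proof (intro allI impI)
  fix T :: real assume "0 < T"
  then have R: "R absolutely_integrable_on {0..T}" using assms by (simp add: admissible_def)
  let ?a = "fst (idx_pair i)" and ?b = "snd (idx_pair i)" and ?c = "fst (idx_pair j)" and ?d = "snd (idx_pair j)"
  have "bounded_linear (\<lambda>R :: tensor4. R $ ?a $ ?b $ ?c $ ?d)"
    by (intro bounded_linear_compose[OF bounded_linear_vec_nth] bounded_linear_vec_nth)
  from absolutely_integrable_linear[OF R this]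
  have "(\<lambda>t. idx_factor i * idx_factor j * R t $ ?a $ ?b $ ?c $ ?d) absolutely_integrable_on {0..T}"
    by (intro set_integrable_mult_right) (simp add: o_def)
  then show "(\<lambda>t. mat6 (R t) $ i $ j) absolutely_integrable_on {0..T}" by (simp add: mat6_def)
qed

text \<open>Each diagonal entry is concave and lies below its tangent at 1, hence grows at most
  linearly; the trace then controls the other entries.\<close>

lemma admissible_matrix_bernstein:
  assumes C: "matrix_bernstein C"
  shows "admissible (\<lambda>t. ten4 (C t))"
proof -
  let ?f = "\<lambda>i t. form (C t) (axis i 1)"
  have b: "bernstein (?f i)" for i using C by (simp add: matrix_bernstein_def)
  have tangent: "?f i t \<le> (?f i 1 + deriv (?f i) 1) * t" if t: "1 \<le> t" for i t
  proof -
    have "?f i t - deriv (?f i) 1 * t \<le> ?f i 1 - deriv (?f i) 1 * 1"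
    proof (rule DERIV_nonpos_imp_nonincreasing[OF t])
      fix x :: real assume x: "1 \<le> x"
      then have "((\<lambda>t. ?f i t - deriv (?f i) 1 * t) has_real_derivative deriv (?f i) x - deriv (?f i) 1) (at x)"
        by (intro DERIV_diff DERIV_cmult_Id bernstein_deriv(1)[OF b]) simp
      moreover have "deriv (?f i) x \<le> deriv (?f i) 1"
        by (rule completely_monotone_antimono[OF b[of i, unfolded bernstein_def, THEN conjunct2]]) (use x in simp_all)
      ultimately show "\<exists>y. ((\<lambda>t. ?f i t - deriv (?f i) 1 * t) has_real_derivative y) (at x) \<and> y \<le> 0" by auto
    qed
    moreover have "?f i 1 \<le> ?f i 1 * t" using mult_left_mono[OF t bernstein_deriv(3)[OF b[of i], of 1]] by simp
    moreover have "0 \<le> deriv (?f i) 1" using bernstein_deriv(2)[OF b] by simp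
    ultimately show ?thesis by (simp add: distrib_right)
  qed
  show ?thesis
  proof (rule admissible_ten4[where a="\<Sum>i\<in>UNIV. ?f i 1 + deriv (?f i) 1"])
    show "transpose (C t) = C t" if "0 < t" for t using C that by (simp add: matrix_bernstein_def)
    show "locally_integrable (\<lambda>t. C t $ i $ j)" for i j by (rule matrix_bernstein_locally[OF C])
    show "continuous_on {0<..} (\<lambda>t. C t $ i $ j)" for i j
    proof (rule continuous_at_imp_continuous_on, rule ballI)
      fix x :: real assume x: "x \<in> {0<..}"
      have "continuous_on {0<..<x + 1} (\<lambda>t. C t $ i $ j)"
        by (rule continuous_on_subset[OF matrix_bernstein_continuous[OF C, of "x + 1"]]) auto
      then show "isCont (\<lambda>t. C t $ i $ j) x" using x by (simp add: continuous_on_eq_continuous_at)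
    qed
    fix t :: real and i j :: 6 assume t: "1 \<le> t"
    then have "\<bar>C t $ i $ j\<bar> \<le> trace (C t)" by (intro psd_entry_le_trace matrix_bernstein_psd[OF C]) simp
    also have "\<dots> \<le> (\<Sum>i\<in>UNIV. (?f i 1 + deriv (?f i) 1) * t)"
      unfolding trace_def form_axis[symmetric] by (intro sum_mono tangent t)
    finally show "\<bar>C t $ i $ j\<bar> \<le> (\<Sum>i\<in>UNIV. ?f i 1 + deriv (?f i) 1) * t" by (simp add: sum_distrib_right)
  qed
qed

lemma admissible_cm_matrix:
  assumes F: "cm_matrix F" "\<And>t. transpose (F t) = F t" "\<And>i j. locally_integrable (\<lambda>t. F t $ i $ j)"
  shows "admissible (\<lambda>t. ten4 (F t))"
proof (rule admissible_ten4[where a="trace (F 1)", OF F(2,3)])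
  show "continuous_on {0<..} (\<lambda>t. F t $ i $ j)" for i j
    unfolding matrix_entry_polar[OF F(2)] using F(1)
    by (intro continuous_intros completely_monotone_continuous) (auto simp: cm_matrix_def)
  fix t :: real and i j :: 6 assume t: "1 \<le> t"
  then have "\<bar>F t $ i $ j\<bar> \<le> trace (F t)" by (intro psd_entry_le_trace cm_matrix_psd[OF F(1)]) simp
  also have "\<dots> \<le> trace (F 1)"
    unfolding trace_def form_axis[symmetric] using t by (intro sum_mono cm_matrix_antimono[OF F(1)]) auto
  also have "\<dots> \<le> trace (F 1) * t"
    using t mult_left_mono[of 1 t "trace (F 1)"] trace_nonneg[OF cm_matrix_psd[OF F(1), of 1]] by simp
  finally show "\<bar>F t $ i $ j\<bar> \<le> trace (F 1) * t" .
qed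

section \<open>Both problems for tensors\<close>

lemma sym4_limit:
  assumes "(C \<longlongrightarrow> A) F" "\<forall>\<^sub>F t in F. sym4 (C t)" "F \<noteq> bot"
  shows "sym4 A"
proof -
  have c: "((\<lambda>t. C t $ i $ j $ k $ l) \<longlongrightarrow> A $ i $ j $ k $ l) F" for i j k l by (intro tendsto_intros assms)
  have "A $ i $ j $ k $ l = A $ j $ i $ k $ l" for i j k l
    by (rule tendsto_unique[OF assms(3) c Lim_transform_eventually[OF c]])
      (use assms(2) in eventually_elim, simp add: sym4_def)
  moreover have "A $ i $ j $ k $ l = A $ k $ l $ i $ j" for i j k l
    by (rule tendsto_unique[OF assms(3) c Lim_transform_eventually[OF c]])
      (use assms(2) in eventually_elim, simp add: sym4_def)
  ultimately show ?thesis by (simp add: sym4_def)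
qed

lemma forward_problem:
  assumes N: "sym4 N" "psd4 N" and F: "tensor_LICM F"
    and nd: "\<forall>v :: real^6. v \<noteq> 0 \<longrightarrow> (\<exists>t>0. v \<bullet> (mat6 (F t) *v v) \<noteq> 0)"
  shows "\<exists>C. admissible C \<and> tensor_bernstein C \<and> (\<forall>t>0. equation_at N F C t)
            \<and> (\<forall>D. admissible D \<and> (AE t in lebesgue. 0 < t \<longrightarrow> equation_at N F D t)
                 \<longrightarrow> (AE t in lebesgue. 0 < t \<longrightarrow> D t = C t))"
proof -
  let ?N = "mat6 N" and ?F = "\<lambda>t. mat6 (F t)"
  note F' = tensor_LICM_mat6[OF F]
  have Fs: "sym4 (F t)" if "0 < t" for t using F that by (simp add: tensor_LICM_def)
  obtain C where C: "matrix_bernstein C" "\<And>t. 0 < t \<Longrightarrow> matrix_equation ?N ?F C t"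
  proof -
    have "\<exists>t>0. form (?F t) v \<noteq> 0" if "v \<noteq> 0" for v using nd that unfolding form_def by simp
    from matrix_solution[OF psd_matrix_mat6[OF N] F' this] that show ?thesis by metis
  qed
  have Cs: "transpose (C t) = C t" if "0 < t" for t using C(1) that by (simp add: matrix_bernstein_def)
  interpret solved_equation ?N ?F C
    by unfold_locales (rule mat6_symmetric[OF N(1)] mat6_symmetric[OF Fs] Cs F'(2) matrix_bernstein_locally[OF C(1)] C(2); assumption?)+
  have eq: "equation_at N F (\<lambda>t. ten4 (C t)) t" if "0 < t" for t
    using C(2)[OF that] equation_at_iff[where F=F and C="\<lambda>t. ten4 (C t)", OF N(1) Fs sym4_ten4[OF Cs] that] by (simp only: mat6_ten4)
  have uniq: "AE t in lebesgue. 0 < t \<longrightarrow> D t = ten4 (C t)"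
    if D: "admissible D" and ae: "AE t in lebesgue. 0 < t \<longrightarrow> equation_at N F D t" for D
  proof -
    have Ds: "sym4 (D t)" if "0 < t" for t using D that by (simp add: admissible_def)
    have "AE t in lebesgue. 0 < t \<longrightarrow> matrix_equation ?N ?F (\<lambda>s. mat6 (D s)) t"
      using ae
    proof eventually_elim
      case (elim t)
      show ?case
      proof
        assume t: "0 < t"
        then have "equation_at N F D t" using elim by blast
        then show "matrix_equation ?N ?F (\<lambda>s. mat6 (D s)) t"
          using equation_at_iff[where F=F and C=D, OF N(1) Fs Ds t] by simp
      qed
    qed
    from unique_solution[OF admissible_mat6[OF D] this]
    show ?thesis
    proof eventually_elim
      case (elim t)
      show ?case
      proof
        assume t: "0 < t"
        then have "mat6 (D t) = C t" using elim by blast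
        then show "D t = ten4 (C t)" using ten4_mat6[OF Ds[OF t]] by (simp only:)
      qed
    qed
  qed
  show ?thesis
    by (intro exI[of _ "\<lambda>t. ten4 (C t)"] conjI allI impI admissible_matrix_bernstein tensor_bernstein_ten4 C(1) eq)
      (use uniq in \<open>blast\<close>)+
qed

lemma inverse_problem:
  assumes C: "tensor_bernstein C"
    and nd: "\<forall>e. sym2 e \<and> e \<noteq> 0 \<longrightarrow> \<not> (\<lambda>t. qform (C t) e) constant_on {0..}"
  shows "\<exists>N F. sym4 N \<and> psd4 N \<and> admissible F \<and> tensor_LICM F \<and> (\<forall>t>0. equation_at N F C t)
            \<and> (\<forall>M G. sym4 M \<and> admissible G \<and> (AE t in lebesgue. 0 < t \<longrightarrow> equation_at M G C t)
                 \<longrightarrow> M = N \<and> (AE t in lebesgue. 0 < t \<longrightarrow> G t = F t))"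
proof -
  let ?C = "\<lambda>t. mat6 (C t)"
  note C' = tensor_bernstein_mat6[OF C]
  have Cs: "sym4 (C t)" if "0 < t" for t using C that by (simp add: tensor_bernstein_def)
  \<comment> \<open>Non-constancy is stated on the closed half-line, so translating it to matrices
    needs the symmetries at 0 too; they are inherited from positive times by the limit.\<close>
  have C0: "sym4 (C 0)"
    by (rule sym4_limit[of C _ "at_right 0"]) (use C Cs in \<open>auto simp: tensor_bernstein_def eventually_at_filter\<close>)
  have nd': "\<not> (\<lambda>t. form (?C t) v) constant_on {0..}" if "v \<noteq> 0" for v
  proof -
    have "ten2 v \<noteq> 0"
    proof
      assume "ten2 v = 0"
      then have "vec6 (ten2 v) = 0" by (simp add: vec6_def vec_eq_iff)
      then show False using that by (simp add: vec6_ten2)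
    qed
    moreover have "form (?C t) v = qform (C t) (ten2 v)" if "t \<in> {0..}" for t
      using form_mat6[OF Cs, of t v] form_mat6[OF C0, of v] that by (cases "t = 0") auto
    ultimately show ?thesis using nd sym2_ten2[of v] unfolding constant_on_def by metis
  qed
  obtain N F where NF: "psd_matrix N" "cm_matrix F" "\<And>t. transpose (F t) = F t" "\<And>i j. locally_integrable (\<lambda>t. F t $ i $ j)"
    "\<And>t. 0 < t \<Longrightarrow> matrix_equation N F ?C t"
    by (rule matrix_dual_solution[OF C'], erule nd', rule that)
  have Ns: "transpose N = N" using NF(1) by (simp add: psd_matrix_def)
  interpret solved_equation N F ?C
    by unfold_locales (rule Ns NF(3,4,5) mat6_symmetric[OF Cs] matrix_bernstein_locally[OF C']; assumption?)+
  have eq: "equation_at (ten4 N) (\<lambda>t. ten4 (F t)) C t" if "0 < t" for t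
    using NF(5)[OF that] equation_at_iff[where F="\<lambda>t. ten4 (F t)" and C=C, OF sym4_ten4[OF Ns] sym4_ten4[OF NF(3)] Cs that] by (simp only: mat6_ten4)
  have uniq: "M = ten4 N \<and> (AE t in lebesgue. 0 < t \<longrightarrow> G t = ten4 (F t))"
    if M: "sym4 M" and G: "admissible G" and ae: "AE t in lebesgue. 0 < t \<longrightarrow> equation_at M G C t" for M G
  proof -
    have Gs: "sym4 (G t)" if "0 < t" for t using G that by (simp add: admissible_def)
    have "AE t in lebesgue. 0 < t \<longrightarrow> matrix_equation (mat6 M) (\<lambda>s. mat6 (G s)) ?C t"
      using ae
    proof eventually_elim
      case (elim t)
      show ?case
      proof
        assume t: "0 < t"
        then have "equation_at M G C t" using elim by blast
        then show "matrix_equation (mat6 M) (\<lambda>s. mat6 (G s)) ?C t"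
          using equation_at_iff[where F=G and C=C, OF M Gs Cs t] by simp
      qed
    qed
    note u = unique_kernel[OF admissible_mat6[OF G] this]
    have "M = ten4 N" using ten4_mat6[OF M] by (simp only: u(1))
    moreover have "AE t in lebesgue. 0 < t \<longrightarrow> G t = ten4 (F t)"
      using u(2)
    proof eventually_elim
      case (elim t)
      show ?case
      proof
        assume t: "0 < t"
        then have "mat6 (G t) = F t" using elim by blast
        then show "G t = ten4 (F t)" using ten4_mat6[OF Gs[OF t]] by (simp only:)
      qed
    qed
    ultimately show ?thesis by blast
  qed
  show ?thesis
    by (intro exI[of _ "ten4 N"] exI[of _ "\<lambda>t. ten4 (F t)"] conjI allI impI sym4_ten4[OF Ns] psd4_ten4[OF NF(1)]
        admissible_cm_matrix[OF NF(2,3,4)] tensor_LICM_ten4[OF NF(2,3,4)] eq)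
      (use uniq in \<open>blast\<close>)+
qed

theorem theorem5p1:
  shows "(\<forall>(N :: tensor4) (F :: real \<Rightarrow> tensor4).
      sym4 N \<and> psd4 N \<and> tensor_LICM F
      \<and> (\<forall>v :: real^6. v \<noteq> 0 \<longrightarrow> (\<exists>t>0. v \<bullet> (mat6 (F t) *v v) \<noteq> 0))
      \<and> (\<forall>\<^sub>F t in at_right 0. invertible (mat6 (F t)))
      \<and> (\<exists>F0. ((\<lambda>t. matrix_inv (mat6 (F t))) \<longlongrightarrow> F0) (at_right 0))
      \<longrightarrow> (\<exists>C. admissible C \<and> tensor_bernstein C \<and> (\<forall>t>0. equation_at N F C t)
            \<and> (\<forall>D. admissible D \<and> (AE t in lebesgue. 0 < t \<longrightarrow> equation_at N F D t)
                 \<longrightarrow> (AE t in lebesgue. 0 < t \<longrightarrow> D t = C t))))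
    \<and> (\<forall>C :: real \<Rightarrow> tensor4.
      tensor_bernstein C
      \<and> (\<forall>e. sym2 e \<and> e \<noteq> 0 \<longrightarrow> \<not> (\<lambda>t. qform (C t) e) constant_on {0..})
      \<longrightarrow> (\<exists>N F. sym4 N \<and> psd4 N \<and> admissible F \<and> tensor_LICM F \<and> (\<forall>t>0. equation_at N F C t)
            \<and> (\<forall>M G. sym4 M \<and> admissible G \<and> (AE t in lebesgue. 0 < t \<longrightarrow> equation_at M G C t)
                 \<longrightarrow> M = N \<and> (AE t in lebesgue. 0 < t \<longrightarrow> G t = F t))))"
  by (intro conjI allI impI; elim conjE) (rule forward_problem inverse_problem; assumption)+

end
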